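(* Let $\Lambda\in[1/\sqrt2,\infty)$ and let $(M^{2m+1},H,J,\theta)$ be a pseudo-Hermitian manifold in which any two points can be joined by a CR K-chain of order $\Lambda$. Suppose its pseudo-Hermitian sectional curvature is bounded from above by a negative constant $-k$. Then $M$ is a CR Kobayashi hyperbolic manifold of order $\Lambda$, i.e. $d_M^{K,\Lambda}(p,q)>0$ for all $p\ne q$ in $M$.
   Context: All manifolds are connected and smooth; all maps are smooth. Pseudo-Hermitian manifold. $(M^{2m+1},H,J,\theta)$ is an orientable manifold of real dimension $2m+1$ ($m\ge 1$) with a CR structure, i.e. a complex rank-$m$ subbundle $T_{1,0}M\subset TM\otimes\mathbb C$ with $T_{1,0}M\cap T_{0,1}M=\{0\}$, $T_{0,1}M=\overline{T_{1,0}M}$ and $[\Gamma(T_{1,0}M),\Gamma(T_{1,0}M)]\subseteq\Gamma(T_{1,0}M)$; $H=\mathrm{Re}(T_{1,0}M\oplus T_{0,1}M)$ and $J(X+\overline X)=i(X-\overline X)$ for $X\in T_{1,0}M$; $\theta$ is a nowhere vanishing 1-form with $\ker\theta=H$ such that the Levi form $L_\theta(X,Y)=d\theta(X,JY)$ is positive definite on $H$. Convention: $d\theta(X,Y)=\frac12\big(X\theta(Y)-Y\theta(X)-\theta([X,Y])\big)$ (same convention for all 1-forms). The Reeb field $\xi$ is given by $\theta(\xi)=1$, $d\theta(\xi,\cdot)=0$; $\pi_H:TM=H\oplus\mathbb R\xi\to H$ is the projection; $J\xi=0$. $G_\theta(X,Y)=L_\theta(\pi_HX,\pi_HY)$; the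 Webster metric is $g_\theta=G_\theta+\theta\otimes\theta$. The Carnot–Carathéodory distance of two points is the infimum of $\int\sqrt{L_\theta(\gamma',\gamma')}\,dt$ over Lipschitz curves $\gamma$ joining them with $\gamma'\in H$ a.e. The Tanaka–Webster connection $\nabla$ is the unique linear connection with $\nabla_X\Gamma(H)\subset\Gamma(H)$, $\nabla J=0$, $\nabla g_\theta=0$, and torsion satisfying $T_\nabla(X,Y)=2d\theta(X,Y)\xi$ and $T_\nabla(\xi,JX)+JT_\nabla(\xi,X)=0$ for $X,Y\in H$. With $R(X,Y)Z=\nabla_X\nabla_YZ-\nabla_Y\nabla_XZ-\nabla_{[X,Y]}Z$ and a local unitary frame $\{\eta_i\}$ of $T_{1,0}M$ ($L_\theta(\eta_i,\eta_{\bar j})=\delta_{ij}$), $R_{i\bar jk\bar l}=g_\theta(R(\eta_k,\eta_{\bar l})\eta_i,\eta_{\bar j})$; the pseudo-Hermitian sectional curvature in the direction of a nonzero $X=X^i\eta_i$ is $\frac{\sum R_{i\bar jk\bar l}X^iX^{\bar j}X^kX^{\bar l}}{(\sum|X^i|^2)^2}$, $X^{\bar j}=\overline{X^j}$. A map $f$ between pseudo-Hermitian manifolds is CR if $df(H)\subset\widetilde H$ and $df\circ J=\widetilde J\circ df$ on $H$. A linear map $B$ of Euclidean spaces has generalized dilatation $\le\Lambda$ if the eigenvalues $\lambda_1\ge\dots\ge\lambda_l\ge0$ of $B^tB$ ($l$ = dimension of the domain) satisfy $\lambda_1\le\Lambda^2\sum_{k=2}^l\lambda_k$; $f$ has bounded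 generalized dilatation of order $\Lambda$ if this holds for every $df_x$ with respect to the Webster metrics. $D^3(-1)$: let $(B,g_B)$ be the unit disc in $\mathbb C$ with its complete Kähler metric of constant (holomorphic sectional) curvature $-1$, complex structure $J_B$, Kähler form $\omega_B(X,Y)=g_B(J_BX,Y)=d\alpha_B$. On $B\times\mathbb R$ (coordinate $t$ on $\mathbb R$, projection $\pi$ to $B$) put $\theta=dt+\pi^*\alpha_B$, $H=\ker\theta$, $J$ the horizontal lift of $J_B$; so $L_\theta=\pi^*g_B$ on $H$, $\xi=\partial/\partial t$. This is $D^3(-1)$, a Sasakian space form (zero pseudo-Hermitian torsion) of constant pseudo-Hermitian curvature $-1$. $\rho_{CC}$ is its Carnot–Carathéodory distance. CR K-chain of order $\Lambda$ between $p,q\in M$: finitely many points $p=p_0,p_1,\dots,p_k=q$ in $M$, points $a_1,b_1,\dots,a_k,b_k\in D^3(-1)$ and CR maps $f_1,\dots,f_k:D^3(-1)\to M$ of bounded generalized dilatation of order $\Lambda$ with $f_i(a_i)=p_{i-1}$, $f_i(b_i)=p_i$. $d_M^{K,\Lambda}(p,q)=\inf\sum_{i=1}^k\rho_{CC}(a_i,b_i)$ over all such chains; it is well-defined if any two points can be joined by such a chain. $M$ is CR Kobayashi hyperbolic of order $\Lambda$ if $d_M^{K,\Lambda}$ is well-defined and $d_M^{K,\Lambda}(p,q)>0$ for $p\ne q$. *)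

theory Defs
  imports "HOL-Analysis.Analysis" "HOL-Combinatorics.Permutations"
begin

section \<open>Smooth manifolds\<close>

text \<open>\<open>Ck_on n f S\<close>: all iterated directional derivatives of \<open>f\<close> up to order \<open>n\<close> exist and are
  continuous on the (open) set \<open>S\<close>.\<close>

primrec Ck_on ::
  "nat \<Rightarrow> ('e::real_normed_vector \<Rightarrow> 'f::real_normed_vector) \<Rightarrow> 'e set \<Rightarrow> bool" where
  "Ck_on 0 f S \<longleftrightarrow> continuous_on S f"
| "Ck_on (Suc n) f S \<longleftrightarrow> (\<forall>x\<in>S. f differentiable (at x)) \<and>
     (\<forall>v. Ck_on n (\<lambda>x. frechet_derivative f (at x) v) S)"

definition smooth_on ::
  "('e::real_normed_vector \<Rightarrow> 'f::real_normed_vector) \<Rightarrow> 'e set \<Rightarrow> bool" where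
  "smooth_on f S \<longleftrightarrow> (\<forall>n. Ck_on n f S)"

type_synonym ('a, 'e) chart = "'a set \<times> ('a \<Rightarrow> 'e)"

abbreviation chart_dom :: "('a, 'e) chart \<Rightarrow> 'a set" where "chart_dom \<equiv> fst"
abbreviation chart_map :: "('a, 'e) chart \<Rightarrow> 'a \<Rightarrow> 'e" where "chart_map \<equiv> snd"

definition chart_inv :: "('a, 'e) chart \<Rightarrow> 'e \<Rightarrow> 'a" where
  "chart_inv c = inv_into (chart_dom c) (chart_map c)"

definition is_chart :: "'a topology \<Rightarrow> ('a, 'e::euclidean_space) chart \<Rightarrow> bool" where
  "is_chart X c \<longleftrightarrow> openin X (chart_dom c) \<and> open (chart_map c ` chart_dom c) \<and>
     homeomorphic_map (subtopology X (chart_dom c)) (top_of_set (chart_map c ` chart_dom c))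
       (chart_map c)"

definition smooth_atlas :: "'a topology \<Rightarrow> ('a, 'e::euclidean_space) chart set \<Rightarrow> bool" where
  "smooth_atlas X A \<longleftrightarrow> (\<forall>c\<in>A. is_chart X c) \<and> (\<Union>c\<in>A. chart_dom c) = topspace X \<and>
     (\<forall>c\<in>A. \<forall>c'\<in>A.
        smooth_on (chart_map c' \<circ> chart_inv c) (chart_map c ` (chart_dom c \<inter> chart_dom c')))"

record ('a, 'e) manifold_data =
  mtop :: "'a topology"
  atlas :: "('a, 'e) chart set"

abbreviation points :: "('a, 'e, 'r) manifold_data_scheme \<Rightarrow> 'a set" where
  "points M \<equiv> topspace (mtop M)"

definition smooth_manifold :: "('a, 'e::euclidean_space, 'r) manifold_data_scheme \<Rightarrow> bool" where
  "smooth_manifold M \<longleftrightarrow> Hausdorff_space (mtop M) \<and> second_countable (mtop M) \<and>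
     connected_space (mtop M) \<and> smooth_atlas (mtop M) (atlas M)"

text \<open>Determinant of an endomorphism of a Euclidean space (Leibniz formula in the standard basis).\<close>

definition lin_det :: "('e::euclidean_space \<Rightarrow> 'e) \<Rightarrow> real" where
  "lin_det f = (\<Sum>\<sigma> | \<sigma> permutes Basis. of_int (sign \<sigma>) * (\<Prod>b\<in>Basis. f b \<bullet> \<sigma> b))"

definition orientable :: "('a, 'e::euclidean_space, 'r) manifold_data_scheme \<Rightarrow> bool" where
  "orientable M \<longleftrightarrow> (\<exists>A. smooth_atlas (mtop M) A \<and> smooth_atlas (mtop M) (atlas M \<union> A) \<and>
     (\<forall>c\<in>A. \<forall>c'\<in>A. \<forall>x\<in>chart_dom c \<inter> chart_dom c'.
        lin_det (frechet_derivative (chart_map c' \<circ> chart_inv c) (at (chart_map c x))) > 0))"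

text \<open>Every point \<open>p\<close> is given one preferred chart of the atlas, and a tangent vector at \<open>p\<close> is
  represented by its coordinates in that chart.  So every tangent space is the model space \<open>'e\<close>,
  and a vector field is a map \<open>'a \<Rightarrow> 'e\<close> whose value at \<open>p\<close> is to be read in the chart at \<open>p\<close>;
  smoothness of a field is tested after transporting all its values to one common chart.\<close>

definition chart_at :: "('a, 'e, 'r) manifold_data_scheme \<Rightarrow> 'a \<Rightarrow> ('a, 'e) chart" where
  "chart_at M p = (SOME c. c \<in> atlas M \<and> p \<in> chart_dom c)"

text \<open>Differential at \<open>p\<close> of a function with values in a vector space.\<close>

definition mderiv :: "('a, 'e::euclidean_space, 'r) manifold_data_scheme \<Rightarrow>
    ('a \<Rightarrow> 'f::real_normed_vector) \<Rightarrow> 'a \<Rightarrow> 'e \<Rightarrow> 'f" where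
  "mderiv M g p v = frechet_derivative (g \<circ> chart_inv (chart_at M p))
     (at (chart_map (chart_at M p) p)) v"

definition smooth_fun_on :: "('a, 'e::euclidean_space, 'r) manifold_data_scheme \<Rightarrow> 'a set \<Rightarrow>
    ('a \<Rightarrow> 'f::real_normed_vector) \<Rightarrow> bool" where
  "smooth_fun_on M U g \<longleftrightarrow>
     (\<forall>c\<in>atlas M. smooth_on (g \<circ> chart_inv c) (chart_map c ` (U \<inter> chart_dom c)))"

definition smooth_field_on :: "('a, 'e::euclidean_space, 'r) manifold_data_scheme \<Rightarrow> 'a set \<Rightarrow>
    ('a \<Rightarrow> 'e) \<Rightarrow> bool" where
  "smooth_field_on M U X \<longleftrightarrow>
     (\<forall>c\<in>atlas M. smooth_fun_on M (U \<inter> chart_dom c) (\<lambda>q. mderiv M (chart_map c) q (X q)))"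

definition smooth_map :: "('a, 'e::euclidean_space, 'r) manifold_data_scheme \<Rightarrow>
    ('b, 'f::euclidean_space, 's) manifold_data_scheme \<Rightarrow> ('a \<Rightarrow> 'b) \<Rightarrow> bool" where
  "smooth_map M N f \<longleftrightarrow> continuous_map (mtop M) (mtop N) f \<and>
     (\<forall>c'\<in>atlas N. smooth_fun_on M {x \<in> points M. f x \<in> chart_dom c'} (chart_map c' \<circ> f))"

definition mdiff :: "('a, 'e::euclidean_space, 'r) manifold_data_scheme \<Rightarrow>
    ('b, 'f::euclidean_space, 's) manifold_data_scheme \<Rightarrow> ('a \<Rightarrow> 'b) \<Rightarrow> 'a \<Rightarrow> 'e \<Rightarrow> 'f" where
  "mdiff M N f p = mderiv M (chart_map (chart_at N (f p)) \<circ> f) p"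

definition lie_bracket :: "('a, 'e::euclidean_space, 'r) manifold_data_scheme \<Rightarrow>
    ('a \<Rightarrow> 'e) \<Rightarrow> ('a \<Rightarrow> 'e) \<Rightarrow> 'a \<Rightarrow> 'e" where
  "lie_bracket M X Y p = (let \<phi> = chart_map (chart_at M p) in
     mderiv M (\<lambda>q. mderiv M \<phi> q (Y q)) p (X p) - mderiv M (\<lambda>q. mderiv M \<phi> q (X q)) p (Y p))"

text \<open>The local extension of a tangent vector \<open>u\<close> at \<open>p\<close> to a field that is constant in the
  preferred chart at \<open>p\<close>.\<close>

definition const_ext :: "('a, 'e::euclidean_space, 'r) manifold_data_scheme \<Rightarrow>
    'a \<Rightarrow> 'e \<Rightarrow> 'a \<Rightarrow> 'e" where
  "const_ext M p u q = frechet_derivative (chart_map (chart_at M q) \<circ> chart_inv (chart_at M p))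
     (at (chart_map (chart_at M p) q)) u"

definition smooth_form :: "('a, 'e::euclidean_space, 'r) manifold_data_scheme \<Rightarrow>
    ('a \<Rightarrow> 'e \<Rightarrow> real) \<Rightarrow> bool" where
  "smooth_form M \<alpha> \<longleftrightarrow> (\<forall>p\<in>points M. linear (\<alpha> p)) \<and>
     (\<forall>U X. openin (mtop M) U \<and> smooth_field_on M U X \<longrightarrow> smooth_fun_on M U (\<lambda>q. \<alpha> q (X q)))"

text \<open>Exterior derivative of a 1-form, with the factor 1/2 of the convention in use here; the
  second definition evaluates it on vectors, where the choice of extensions does not matter.\<close>

definition dform_field :: "('a, 'e::euclidean_space, 'r) manifold_data_scheme \<Rightarrow>
    ('a \<Rightarrow> 'e \<Rightarrow> real) \<Rightarrow> ('a \<Rightarrow> 'e) \<Rightarrow> ('a \<Rightarrow> 'e) \<Rightarrow> 'a \<Rightarrow> real" where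
  "dform_field M \<alpha> X Y p = (mderiv M (\<lambda>q. \<alpha> q (Y q)) p (X p) - mderiv M (\<lambda>q. \<alpha> q (X q)) p (Y p)
     - \<alpha> p (lie_bracket M X Y p)) / 2"

definition dform :: "('a, 'e::euclidean_space, 'r) manifold_data_scheme \<Rightarrow>
    ('a \<Rightarrow> 'e \<Rightarrow> real) \<Rightarrow> 'a \<Rightarrow> 'e \<Rightarrow> 'e \<Rightarrow> real" where
  "dform M \<alpha> p u v = dform_field M \<alpha> (const_ext M p u) (const_ext M p v) p"


section \<open>Complexified tangent vectors\<close>

text \<open>The pair \<open>(u, v)\<close> stands for \<open>u + \<i> v\<close>.\<close>

type_synonym 'e cvec = "'e \<times> 'e"

definition cscale :: "complex \<Rightarrow> 'e::real_vector cvec \<Rightarrow> 'e cvec" where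
  "cscale c z = (Re c *\<^sub>R fst z - Im c *\<^sub>R snd z, Im c *\<^sub>R fst z + Re c *\<^sub>R snd z)"

definition vconj :: "'e::real_vector cvec \<Rightarrow> 'e cvec" where
  "vconj z = (fst z, - snd z)"

definition cbilinear :: "('e \<Rightarrow> 'e \<Rightarrow> real) \<Rightarrow> 'e cvec \<Rightarrow> 'e cvec \<Rightarrow> complex" where
  "cbilinear b z w = Complex (b (fst z) (fst w) - b (snd z) (snd w))
     (b (fst z) (snd w) + b (snd z) (fst w))"

definition smooth_cfield_on :: "('a, 'e::euclidean_space, 'r) manifold_data_scheme \<Rightarrow> 'a set \<Rightarrow>
    ('a \<Rightarrow> 'e cvec) \<Rightarrow> bool" where
  "smooth_cfield_on M U Z \<longleftrightarrow> smooth_field_on M U (fst \<circ> Z) \<and> smooth_field_on M U (snd \<circ> Z)"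

definition clie_bracket :: "('a, 'e::euclidean_space, 'r) manifold_data_scheme \<Rightarrow>
    ('a \<Rightarrow> 'e cvec) \<Rightarrow> ('a \<Rightarrow> 'e cvec) \<Rightarrow> 'a \<Rightarrow> 'e cvec" where
  "clie_bracket M Z W p =
     (lie_bracket M (fst \<circ> Z) (fst \<circ> W) p - lie_bracket M (snd \<circ> Z) (snd \<circ> W) p,
      lie_bracket M (fst \<circ> Z) (snd \<circ> W) p + lie_bracket M (snd \<circ> Z) (fst \<circ> W) p)"


section \<open>Pseudo-Hermitian manifolds\<close>

record ('a, 'e) ph_data = "('a, 'e) manifold_data" +
  T10 :: "'a \<Rightarrow> 'e cvec set"
  theta :: "'a \<Rightarrow> 'e \<Rightarrow> real"

definition complex_subbundle :: "nat \<Rightarrow> ('a, 'e::euclidean_space, 'r) manifold_data_scheme \<Rightarrow>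
    ('a \<Rightarrow> 'e cvec set) \<Rightarrow> bool" where
  "complex_subbundle m M E \<longleftrightarrow> (\<forall>p\<in>points M. \<exists>U Z. openin (mtop M) U \<and> p \<in> U \<and>
     (\<forall>i<m. smooth_cfield_on M U (Z i)) \<and>
     (\<forall>q\<in>U. E q = {\<Sum>i<m. cscale (c i) (Z i q) | c :: nat \<Rightarrow> complex. True} \<and>
        (\<forall>c :: nat \<Rightarrow> complex. (\<Sum>i<m. cscale (c i) (Z i q)) = 0 \<longrightarrow> (\<forall>i<m. c i = 0))))"

definition T01 :: "('a, 'e::euclidean_space, 'r) ph_data_scheme \<Rightarrow> 'a \<Rightarrow> 'e cvec set" where
  "T01 M p = vconj ` T10 M p"

definition cr_structure :: "nat \<Rightarrow> ('a, 'e::euclidean_space, 'r) ph_data_scheme \<Rightarrow> bool" where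
  "cr_structure m M \<longleftrightarrow> complex_subbundle m M (T10 M) \<and>
     (\<forall>p\<in>points M. T10 M p \<inter> T01 M p = {0}) \<and>
     (\<forall>U Z W. openin (mtop M) U \<and> smooth_cfield_on M U Z \<and> smooth_cfield_on M U W \<and>
        (\<forall>q\<in>U. Z q \<in> T10 M q \<and> W q \<in> T10 M q) \<longrightarrow> (\<forall>q\<in>U. clie_bracket M Z W q \<in> T10 M q))"

definition Hbundle :: "('a, 'e::euclidean_space, 'r) ph_data_scheme \<Rightarrow> 'a \<Rightarrow> 'e set" where
  "Hbundle M p = {fst (Z + W) | Z W. Z \<in> T10 M p \<and> W \<in> T01 M p}"

text \<open>\<open>J (Z + conj Z) = \<i> (Z - conj Z)\<close> for \<open>Z\<close> in \<open>T10\<close>.\<close>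

definition JH :: "('a, 'e::euclidean_space, 'r) ph_data_scheme \<Rightarrow> 'a \<Rightarrow> 'e \<Rightarrow> 'e" where
  "JH M p u = (THE w. \<exists>Z\<in>T10 M p. (u, 0) = Z + vconj Z \<and> (w, 0) = cscale \<i> (Z - vconj Z))"

definition levi :: "('a, 'e::euclidean_space, 'r) ph_data_scheme \<Rightarrow> 'a \<Rightarrow> 'e \<Rightarrow> 'e \<Rightarrow> real" where
  "levi M p u v = dform M (theta M) p u (JH M p v)"

definition pseudo_hermitian :: "nat \<Rightarrow> ('a, 'e::euclidean_space, 'r) ph_data_scheme \<Rightarrow> bool" where
  "pseudo_hermitian m M \<longleftrightarrow> 1 \<le> m \<and> DIM('e) = 2 * m + 1 \<and>
     smooth_manifold M \<and> orientable M \<and> cr_structure m M \<and>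
     smooth_form M (theta M) \<and>
     (\<forall>p\<in>points M. (\<exists>v. theta M p v \<noteq> 0) \<and> {v. theta M p v = 0} = Hbundle M p) \<and>
     (\<forall>p\<in>points M. \<forall>u\<in>Hbundle M p. u \<noteq> 0 \<longrightarrow> levi M p u u > 0)"

definition reeb :: "('a, 'e::euclidean_space, 'r) ph_data_scheme \<Rightarrow> 'a \<Rightarrow> 'e" where
  "reeb M p = (THE v. theta M p v = 1 \<and> (\<forall>w. dform M (theta M) p v w = 0))"

definition projH :: "('a, 'e::euclidean_space, 'r) ph_data_scheme \<Rightarrow> 'a \<Rightarrow> 'e \<Rightarrow> 'e" where
  "projH M p v = v - theta M p v *\<^sub>R reeb M p"

text \<open>The extension of \<open>J\<close> to the whole tangent bundle by \<open>J \<xi> = 0\<close>.\<close>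

definition Jext :: "('a, 'e::euclidean_space, 'r) ph_data_scheme \<Rightarrow> 'a \<Rightarrow> 'e \<Rightarrow> 'e" where
  "Jext M p v = JH M p (projH M p v)"

definition webster :: "('a, 'e::euclidean_space, 'r) ph_data_scheme \<Rightarrow> 'a \<Rightarrow> 'e \<Rightarrow> 'e \<Rightarrow> real" where
  "webster M p u v = levi M p (projH M p u) (projH M p v) + theta M p u * theta M p v"


section \<open>Tanaka--Webster connection and curvature\<close>

text \<open>\<open>D p v Y\<close> is the covariant derivative at \<open>p\<close>, in the direction \<open>v\<close>, of a field \<open>Y\<close> that is
  smooth near \<open>p\<close>.  Since fields need only be smooth near \<open>p\<close>, locality in \<open>Y\<close> is the Leibniz
  rule for the indicator function of an open neighbourhood of \<open>p\<close>.\<close>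

type_synonym ('a, 'e) covariant = "'a \<Rightarrow> 'e \<Rightarrow> ('a \<Rightarrow> 'e) \<Rightarrow> 'e"

definition linear_connection :: "('a, 'e::euclidean_space, 'r) manifold_data_scheme \<Rightarrow>
    ('a, 'e) covariant \<Rightarrow> bool" where
  "linear_connection M D \<longleftrightarrow> (\<forall>U Y. openin (mtop M) U \<and> smooth_field_on M U Y \<longrightarrow>
     (\<forall>X. smooth_field_on M U X \<longrightarrow> smooth_field_on M U (\<lambda>q. D q (X q) Y)) \<and>
     (\<forall>p\<in>U. linear (\<lambda>v. D p v Y)) \<and>
     (\<forall>p\<in>U. \<forall>v Y'. smooth_field_on M U Y' \<longrightarrow> D p v (\<lambda>q. Y q + Y' q) = D p v Y + D p v Y') \<and>
     (\<forall>p\<in>U. \<forall>v. \<forall>h :: 'a \<Rightarrow> real. smooth_fun_on M U h \<longrightarrow>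
        D p v (\<lambda>q. h q *\<^sub>R Y q) = h p *\<^sub>R D p v Y + mderiv M h p v *\<^sub>R Y p))"

definition torsion :: "('a, 'e::euclidean_space, 'r) manifold_data_scheme \<Rightarrow>
    ('a, 'e) covariant \<Rightarrow> ('a \<Rightarrow> 'e) \<Rightarrow> ('a \<Rightarrow> 'e) \<Rightarrow> 'a \<Rightarrow> 'e" where
  "torsion M D X Y p = D p (X p) Y - D p (Y p) X - lie_bracket M X Y p"

definition horizontal_on :: "('a, 'e::euclidean_space, 'r) ph_data_scheme \<Rightarrow> 'a set \<Rightarrow>
    ('a \<Rightarrow> 'e) \<Rightarrow> bool" where
  "horizontal_on M U X \<longleftrightarrow> smooth_field_on M U X \<and> (\<forall>q\<in>U. X q \<in> Hbundle M q)"

definition tanaka_webster :: "('a, 'e::euclidean_space, 'r) ph_data_scheme \<Rightarrow>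
    ('a, 'e) covariant \<Rightarrow> bool" where
  "tanaka_webster M D \<longleftrightarrow> linear_connection M D \<and>
     (\<forall>U Y. openin (mtop M) U \<and> horizontal_on M U Y \<longrightarrow>
        (\<forall>p\<in>U. \<forall>v. D p v Y \<in> Hbundle M p)) \<and>
     (\<forall>U Y. openin (mtop M) U \<and> smooth_field_on M U Y \<longrightarrow>
        (\<forall>p\<in>U. \<forall>v. D p v (\<lambda>q. Jext M q (Y q)) = Jext M p (D p v Y))) \<and>
     (\<forall>U Y Z. openin (mtop M) U \<and> smooth_field_on M U Y \<and> smooth_field_on M U Z \<longrightarrow>
        (\<forall>p\<in>U. \<forall>v. mderiv M (\<lambda>q. webster M q (Y q) (Z q)) p v =
           webster M p (D p v Y) (Z p) + webster M p (Y p) (D p v Z))) \<and>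
     (\<forall>U X Y. openin (mtop M) U \<and> horizontal_on M U X \<and> horizontal_on M U Y \<longrightarrow>
        (\<forall>p\<in>U. torsion M D X Y p = (2 * dform M (theta M) p (X p) (Y p)) *\<^sub>R reeb M p)) \<and>
     (\<forall>U X. openin (mtop M) U \<and> horizontal_on M U X \<longrightarrow>
        (\<forall>p\<in>U. torsion M D (reeb M) (\<lambda>q. Jext M q (X q)) p
           + Jext M p (torsion M D (reeb M) X p) = 0))"

definition ccovariant :: "('a, 'e::real_vector) covariant \<Rightarrow>
    ('a \<Rightarrow> 'e cvec) \<Rightarrow> ('a \<Rightarrow> 'e cvec) \<Rightarrow> 'a \<Rightarrow> 'e cvec" where
  "ccovariant D Z W p =
     (D p (fst (Z p)) (fst \<circ> W) - D p (snd (Z p)) (snd \<circ> W),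
      D p (fst (Z p)) (snd \<circ> W) + D p (snd (Z p)) (fst \<circ> W))"

definition curvature :: "('a, 'e::euclidean_space, 'r) manifold_data_scheme \<Rightarrow>
    ('a, 'e) covariant \<Rightarrow> ('a \<Rightarrow> 'e cvec) \<Rightarrow> ('a \<Rightarrow> 'e cvec) \<Rightarrow> ('a \<Rightarrow> 'e cvec) \<Rightarrow> 'a \<Rightarrow> 'e cvec" where
  "curvature M D X Y Z p = ccovariant D X (ccovariant D Y Z) p
     - ccovariant D Y (ccovariant D X Z) p - ccovariant D (clie_bracket M X Y) Z p"

definition unitary_frame_on :: "nat \<Rightarrow> ('a, 'e::euclidean_space, 'r) ph_data_scheme \<Rightarrow> 'a set \<Rightarrow>
    (nat \<Rightarrow> 'a \<Rightarrow> 'e cvec) \<Rightarrow> bool" where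
  "unitary_frame_on m M U \<eta> \<longleftrightarrow>
     (\<forall>i<m. smooth_cfield_on M U (\<eta> i) \<and> (\<forall>q\<in>U. \<eta> i q \<in> T10 M q)) \<and>
     (\<forall>q\<in>U. \<forall>i<m. \<forall>j<m.
        cbilinear (levi M q) (\<eta> i q) (vconj (\<eta> j q)) = (if i = j then 1 else 0))"

text \<open>\<open>curv_comp M D \<eta> p i j k l\<close> is the component with indices \<open>i\<close>, \<open>j\<close>-bar, \<open>k\<close>, \<open>l\<close>-bar.\<close>

definition curv_comp :: "('a, 'e::euclidean_space, 'r) ph_data_scheme \<Rightarrow> ('a, 'e) covariant \<Rightarrow>
    (nat \<Rightarrow> 'a \<Rightarrow> 'e cvec) \<Rightarrow> 'a \<Rightarrow> nat \<Rightarrow> nat \<Rightarrow> nat \<Rightarrow> nat \<Rightarrow> complex" where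
  "curv_comp M D \<eta> p i j k l =
     cbilinear (webster M p) (curvature M D (\<eta> k) (vconj \<circ> \<eta> l) (\<eta> i) p) (vconj (\<eta> j p))"

text \<open>Curvature in the direction with coefficients \<open>x\<close> in the frame \<open>\<eta>\<close>.  The sum is real by the
  symmetries of the curvature; \<open>Re\<close> only adjusts its type.\<close>

definition ph_sectional_curvature :: "nat \<Rightarrow> ('a, 'e::euclidean_space, 'r) ph_data_scheme \<Rightarrow>
    ('a, 'e) covariant \<Rightarrow> (nat \<Rightarrow> 'a \<Rightarrow> 'e cvec) \<Rightarrow> 'a \<Rightarrow> (nat \<Rightarrow> complex) \<Rightarrow> real" where
  "ph_sectional_curvature m M D \<eta> p x =
     Re (\<Sum>i<m. \<Sum>j<m. \<Sum>k<m. \<Sum>l<m.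
           curv_comp M D \<eta> p i j k l * x i * cnj (x j) * x k * cnj (x l))
       / (\<Sum>i<m. (cmod (x i))\<^sup>2)\<^sup>2"

definition ph_curvature_le :: "nat \<Rightarrow> ('a, 'e::euclidean_space, 'r) ph_data_scheme \<Rightarrow>
    ('a, 'e) covariant \<Rightarrow> real \<Rightarrow> bool" where
  "ph_curvature_le m M D \<kappa> \<longleftrightarrow>
     (\<forall>U \<eta> p x. openin (mtop M) U \<and> unitary_frame_on m M U \<eta> \<and> p \<in> U \<and> (\<exists>i<m. x i \<noteq> 0) \<longrightarrow>
        ph_sectional_curvature m M D \<eta> p x \<le> \<kappa>)"


section \<open>CR maps and generalized dilatation\<close>

definition cr_map :: "('a, 'e::euclidean_space, 'r) ph_data_scheme \<Rightarrow>
    ('b, 'f::euclidean_space, 's) ph_data_scheme \<Rightarrow> ('a \<Rightarrow> 'b) \<Rightarrow> bool" where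
  "cr_map M N f \<longleftrightarrow> smooth_map M N f \<and>
     (\<forall>p\<in>points M. \<forall>u\<in>Hbundle M p. mdiff M N f p u \<in> Hbundle N (f p) \<and>
        mdiff M N f p (JH M p u) = JH N (f p) (mdiff M N f p u))"

text \<open>\<open>g\<close> and \<open>h\<close> are the inner products of the domain and the codomain, \<open>Bt\<close> is the adjoint of
  \<open>B\<close>, and \<open>lam\<close> lists the eigenvalues of \<open>Bt \<circ> B\<close> with multiplicity in decreasing order.\<close>

definition gen_dilatation_le :: "('e::euclidean_space \<Rightarrow> 'e \<Rightarrow> real) \<Rightarrow>
    ('f::euclidean_space \<Rightarrow> 'f \<Rightarrow> real) \<Rightarrow> ('e \<Rightarrow> 'f) \<Rightarrow> real \<Rightarrow> bool" where
  "gen_dilatation_le g h B \<Lambda> \<longleftrightarrow> (\<exists>Bt e lam.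
     (\<forall>v w. g (Bt w) v = h w (B v)) \<and>
     (\<forall>i<DIM('e). \<forall>j<DIM('e). g (e i) (e j) = (if i = j then 1 else 0)) \<and>
     (\<forall>i<DIM('e). Bt (B (e i)) = lam i *\<^sub>R e i) \<and>
     (\<forall>i j. i \<le> j \<and> j < DIM('e) \<longrightarrow> lam j \<le> lam i) \<and>
     lam 0 \<le> \<Lambda>\<^sup>2 * (\<Sum>k=1..<DIM('e). lam k))"

definition bounded_gen_dilatation :: "('a, 'e::euclidean_space, 'r) ph_data_scheme \<Rightarrow>
    ('b, 'f::euclidean_space, 's) ph_data_scheme \<Rightarrow> ('a \<Rightarrow> 'b) \<Rightarrow> real \<Rightarrow> bool" where
  "bounded_gen_dilatation M N f \<Lambda> \<longleftrightarrow>
     (\<forall>p\<in>points M. gen_dilatation_le (webster M p) (webster N (f p)) (mdiff M N f p) \<Lambda>)"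


section \<open>Carnot--Caratheodory distance\<close>

definition lipschitz_curve :: "('a, 'e::euclidean_space, 'r) manifold_data_scheme \<Rightarrow>
    real \<Rightarrow> real \<Rightarrow> (real \<Rightarrow> 'a) \<Rightarrow> bool" where
  "lipschitz_curve M a b \<gamma> \<longleftrightarrow> continuous_map (top_of_set {a..b}) (mtop M) \<gamma> \<and>
     (\<forall>t\<in>{a..b}. \<exists>I C. \<exists>c\<in>atlas M. open I \<and> t \<in> I \<and> \<gamma> ` (I \<inter> {a..b}) \<subseteq> chart_dom c \<and>
        C-lipschitz_on (I \<inter> {a..b}) (chart_map c \<circ> \<gamma>))"

definition velocity :: "('a, 'e::euclidean_space, 'r) manifold_data_scheme \<Rightarrow>
    (real \<Rightarrow> 'a) \<Rightarrow> real \<Rightarrow> 'e" where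
  "velocity M \<gamma> t = vector_derivative (chart_map (chart_at M (\<gamma> t)) \<circ> \<gamma>) (at t)"

definition horizontal_curve :: "('a, 'e::euclidean_space, 'r) ph_data_scheme \<Rightarrow>
    real \<Rightarrow> real \<Rightarrow> (real \<Rightarrow> 'a) \<Rightarrow> bool" where
  "horizontal_curve M a b \<gamma> \<longleftrightarrow> lipschitz_curve M a b \<gamma> \<and>
     (AE t in lebesgue. t \<in> {a..b} \<longrightarrow>
        (chart_map (chart_at M (\<gamma> t)) \<circ> \<gamma>) differentiable (at t) \<and>
        velocity M \<gamma> t \<in> Hbundle M (\<gamma> t))"

definition cc_dist :: "('a, 'e::euclidean_space, 'r) ph_data_scheme \<Rightarrow> 'a \<Rightarrow> 'a \<Rightarrow> real" where
  "cc_dist M p q = Inf {LINT t:{a..b}|lebesgue.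
       sqrt (levi M (\<gamma> t) (velocity M \<gamma> t) (velocity M \<gamma> t)) | a b \<gamma>.
     a \<le> b \<and> \<gamma> a = p \<and> \<gamma> b = q \<and> horizontal_curve M a b \<gamma>}"


section \<open>The Sasakian space form of dimension 3 and curvature -1\<close>

text \<open>The complete metric of curvature -1 on the unit disc is \<open>4 |dz|\<^sup>2 / (1 - |z|\<^sup>2)\<^sup>2\<close>.\<close>

definition poincare_metric :: "complex \<Rightarrow> complex \<Rightarrow> complex \<Rightarrow> real" where
  "poincare_metric z v w = 4 * (v \<bullet> w) / (1 - (cmod z)\<^sup>2)\<^sup>2"

text \<open>The form \<open>4 (x dy - y dx) / (1 - |z|\<^sup>2)\<close>.  With the factor 1/2 in the exterior derivative it is
  a primitive of the Kaehler form \<open>\<omega> (v, w) = poincare_metric z (\<i> v) w\<close>; another primitive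
  differs from it by an exact form \<open>df\<close> and gives an isomorphic space through
  \<open>(z, t) \<mapsto> (z, t + f z)\<close>.\<close>

definition alphaB :: "complex \<Rightarrow> complex \<Rightarrow> real" where
  "alphaB z w = 4 * Im (cnj z * w) / (1 - (cmod z)\<^sup>2)"

text \<open>The horizontal lift: the vector over \<open>w\<close> in the kernel of \<open>dt + alphaB\<close>.\<close>

definition hlift :: "complex \<Rightarrow> complex \<Rightarrow> complex \<times> real" where
  "hlift z w = (w, - alphaB z w)"

text \<open>\<open>T10\<close> consists of the vectors \<open>u - \<i> J u\<close>, where \<open>u = hlift z w\<close> and
  \<open>J u = hlift z (\<i> * w)\<close>.\<close>

definition D3 :: "(complex \<times> real, complex \<times> real) ph_data" where
  "D3 = \<lparr> mtop = top_of_set (ball 0 1 \<times> UNIV),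
          atlas = {(ball 0 1 \<times> UNIV, \<lambda>x. x)},
          T10 = (\<lambda>x. {(hlift (fst x) w, - hlift (fst x) (\<i> * w)) | w. True}),
          theta = (\<lambda>x v. snd v + alphaB (fst x) (fst v)) \<rparr>"


text \<open>The data of this space, computed from the general definitions: the Levi form is the metric of
  the disc, \<open>H = ker \<theta>\<close>, \<open>J\<close> is the lift of the multiplication by \<open>\<i>\<close>, and the Reeb field
  is \<open>\<partial>/\<partial>t\<close>.\<close>

abbreviation "D3_pts \<equiv> (ball 0 1 \<times> UNIV :: (complex \<times> real) set)"

lemma open_D3_pts: "open D3_pts" by (simp add: open_Times)

lemma chart_at_D3: "p \<in> D3_pts \<Longrightarrow> chart_at D3 p = (D3_pts, \<lambda>x. x)"
  unfolding chart_at_def D3_def by (rule some_equality) auto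

lemma chart_inv_D3: "y \<in> D3_pts \<Longrightarrow> chart_inv (D3_pts, \<lambda>x. x) y = y"
  unfolding chart_inv_def by (simp add: inv_into_f_f[of "\<lambda>x. x", simplified] del: mem_Times_iff)

lemma mderiv_D3: assumes "p \<in> D3_pts" "(g has_derivative g') (at p)" shows "mderiv D3 g p v = g' v"
proof -
  have "((g \<circ> chart_inv (D3_pts, \<lambda>x. x)) has_derivative g') (at p)"
    by (rule has_derivative_transform_within_open[OF assms(2) open_D3_pts assms(1)]) (simp add: chart_inv_D3 del: mem_Times_iff)
  then show ?thesis unfolding mderiv_def chart_at_D3[OF assms(1)] by (simp add: frechet_derivative_at[symmetric])
qed

lemma const_ext_D3: assumes "p \<in> D3_pts" "q \<in> D3_pts" shows "const_ext D3 p u q = u"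
proof -
  have "((\<lambda>x. x) \<circ> chart_inv (D3_pts, \<lambda>x. x) has_derivative (\<lambda>x. x)) (at q)"
    by (rule has_derivative_transform_within_open[OF has_derivative_ident open_D3_pts assms(2)]) (simp add: chart_inv_D3 del: mem_Times_iff)
  then show ?thesis unfolding const_ext_def chart_at_D3[OF assms(1)] chart_at_D3[OF assms(2)] by (simp add: frechet_derivative_at[symmetric])
qed

lemma mderiv_D3_eq: assumes "p \<in> D3_pts" "(h has_derivative g') (at p)" "\<And>q. q \<in> D3_pts \<Longrightarrow> g q = h q" shows "mderiv D3 g p v = g' v"
  by (rule mderiv_D3[OF assms(1)], rule has_derivative_transform_within_open[OF assms(2) open_D3_pts assms(1)]) (simp add: assms(3) del: mem_Times_iff)

lemma lie_bracket_const_ext_D3: assumes "p \<in> D3_pts" shows "lie_bracket D3 (const_ext D3 p u) (const_ext D3 p v) p = 0"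
proof -
  have a: "mderiv D3 (\<lambda>q. q) q w = w" if "q \<in> D3_pts" for q w
    by (rule mderiv_D3[OF that has_derivative_ident])
  have b: "mderiv D3 (\<lambda>q. mderiv D3 (\<lambda>q. q) q (const_ext D3 p x q)) p w = 0" for x w
    by (rule mderiv_D3_eq[OF assms has_derivative_const[of x]]) (simp add: a const_ext_D3[OF assms] del: mem_Times_iff)
  show ?thesis unfolding lie_bracket_def chart_at_D3[OF assms] by (simp add: Let_def b)
qed

lemma alphaB_deriv: assumes "cmod z < 1"
  shows "((\<lambda>q. alphaB (fst q) w) has_derivative (\<lambda>h. 4 * Im (cnj (fst h) * w) / (1 - (cmod z)\<^sup>2) +
     4 * Im (cnj z * w) * (2 * (z \<bullet> fst h)) / (1 - (cmod z)\<^sup>2)\<^sup>2)) (at (z,t))"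
proof -
  have n: "1 - z \<bullet> z \<noteq> 0" using assms by (simp add: dot_square_norm abs_square_eq_1)
  have n2: "((\<lambda>q. 4 * Im (cnj (fst q) * w)) has_derivative (\<lambda>h. 4 * Im (cnj (fst h) * w))) (at (z,t))"
    by (auto intro!: derivative_eq_intros)
  have n3: "((\<lambda>q. 1 - fst q \<bullet> fst q) has_derivative (\<lambda>h. - (2 * (z \<bullet> fst h)))) (at (z,t))"
    by (auto intro!: derivative_eq_intros simp: inner_commute)
  have key: "(a * d + b * c) / (d * d) = a / d + b * c / d\<^sup>2" if "d \<noteq> 0" for a b c d :: real
    using that by (simp add: field_simps power2_eq_square)
  show ?thesis unfolding alphaB_def power2_norm_eq_inner
    by (rule has_derivative_eq_rhs, rule has_derivative_divide'[OF n2 n3])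
      (use n in \<open>simp_all add: key\<close>)
qed

lemma dtheta_D3: assumes "cmod z < 1"
  shows "dform D3 (theta D3) (z,t) u v = 4 * ((\<i> * fst u) \<bullet> fst v) / (1 - (cmod z)\<^sup>2)\<^sup>2"
proof -
  have p: "(z,t) \<in> D3_pts" using assms by simp
  have l: "theta D3 q 0 = 0" for q by (simp add: D3_def alphaB_def)
  have e: "mderiv D3 (\<lambda>q. theta D3 q (const_ext D3 (z,t) x q)) (z,t) y =
     4 * Im (cnj (fst y) * fst x) / (1 - (cmod z)\<^sup>2) +
     4 * Im (cnj z * fst x) * (2 * (z \<bullet> fst y)) / (1 - (cmod z)\<^sup>2)\<^sup>2" for x y
    apply (rule mderiv_D3_eq[OF p, where h = "\<lambda>q. snd x + alphaB (fst q) (fst x)"])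
     apply (rule has_derivative_eq_rhs)
      apply (rule has_derivative_add[OF has_derivative_const alphaB_deriv[OF assms]])
     apply simp
    by (subst const_ext_D3[OF p], assumption) (simp add: D3_def)
  have n: "1 - (cmod z)\<^sup>2 \<noteq> 0" using assms by (simp add: abs_square_eq_1)
  have key: "(A / d + B / d\<^sup>2 - (A' / d + B' / d\<^sup>2) - 0) / 2 = C / d\<^sup>2"
    if "d \<noteq> 0" "A * d + B - A' * d - B' = 2 * C" for A B A' B' C d :: real
    using that by (simp add: divide_simps power2_eq_square)
  show ?thesis
    unfolding dform_def dform_field_def lie_bracket_const_ext_D3[OF p] l e const_ext_D3[OF p p]
    apply (rule key[OF n]) unfolding cmod_power2 by (simp add: inner_complex_def) algebra
qed

lemma alphaB_add: "alphaB z (a + b) = alphaB z a + alphaB z b"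
    by (simp add: alphaB_def algebra_simps add_divide_distrib diff_divide_distrib)

lemma alphaB_scaleR: "alphaB z (r *\<^sub>R a) = r * alphaB z a"
    by (simp add: alphaB_def algebra_simps add_divide_distrib diff_divide_distrib)

lemma JH_D3: "JH D3 (z,t) (hlift z w) = hlift z (\<i> * w)"
proof -
  have half: "alphaB z w' = 2 * alphaB z (w' /\<^sub>R 2)" for w' by (simp add: alphaB_scaleR)
  have T: "T10 D3 (z,t) = {(hlift z w, - hlift z (\<i> * w)) | w. True}" by (simp add: D3_def)
  have i: "(\<i> * w) /\<^sub>R 2 = \<i> * (w /\<^sub>R 2)" by simp
  have h2: "alphaB z (\<i> * w) = 2 * alphaB z (\<i> * (w /\<^sub>R 2))" using half[of "\<i> * w"] i by simp
  show ?thesis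
  unfolding JH_def
  proof (rule the_equality)
    show "\<exists>Z\<in>T10 D3 (z, t). (hlift z w, 0) = Z + vconj Z \<and> (hlift z (\<i> * w), 0) = cscale \<i> (Z - vconj Z)"
      apply (rule bexI[of _ "(hlift z (w /\<^sub>R 2), - hlift z (\<i> * (w /\<^sub>R 2)))"])
      using half[of w] h2 apply (simp add: vconj_def cscale_def hlift_def prod_eq_iff complex_eq_iff)
      unfolding T by blast
    fix w' assume "\<exists>Z\<in>T10 D3 (z, t). (hlift z w, 0) = Z + vconj Z \<and> (w', 0) = cscale \<i> (Z - vconj Z)"
    then obtain y where y: "hlift z w = hlift z y + hlift z y" "w' = hlift z (\<i> * y) + hlift z (\<i> * y)"
    proof (elim bexE)
      fix Z assume Z: "Z \<in> T10 D3 (z,t)" "(hlift z w, 0) = Z + vconj Z \<and> (w', 0) = cscale \<i> (Z - vconj Z)"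
      then obtain y where "Z = (hlift z y, - hlift z (\<i> * y))" unfolding T by auto
      with Z(2) have "hlift z w = hlift z y + hlift z y" "w' = hlift z (\<i> * y) + hlift z (\<i> * y)"
        by (auto simp: vconj_def cscale_def )
      then show thesis using that by blast
    qed
    then have "w = y + y" by (simp add: hlift_def)
    then have "\<i> * w = \<i> * y + \<i> * y" by (simp add: algebra_simps)
    then show "w' = hlift z (\<i> * w)" using y(2) by (simp only: hlift_def alphaB_add) simp
  qed
qed

lemma levi_D3: "cmod z < 1 \<Longrightarrow> levi D3 (z,t) (hlift z v) (hlift z w) = poincare_metric z v w"
  unfolding levi_def JH_D3 dtheta_D3 by (simp add: hlift_def poincare_metric_def inner_complex_def)

lemma Hbundle_D3: "Hbundle D3 (z,t) = {v. theta D3 (z,t) v = 0}"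
proof -
  have "v \<in> Hbundle D3 (z,t)" if "theta D3 (z,t) v = 0" for v
  proof -
    have "v = fst ((hlift z (fst v), - hlift z (\<i> * fst v)) + vconj (hlift z 0, - hlift z (\<i> * 0)))"
      using that by (simp add: D3_def hlift_def vconj_def prod_eq_iff alphaB_def)
    moreover have "(hlift z w, - hlift z (\<i> * w)) \<in> T10 D3 (z,t)" for w by (auto simp: D3_def)
    ultimately show ?thesis unfolding Hbundle_def T01_def by blast
  qed
  moreover have "theta D3 (z,t) v = 0" if "v \<in> Hbundle D3 (z,t)" for v
    using that by (auto simp: Hbundle_def T01_def D3_def vconj_def hlift_def alphaB_add)
  ultimately show ?thesis by auto
qed

lemma reeb_D3: "cmod z < 1 \<Longrightarrow> reeb D3 (z,t) = (0,1)"
  unfolding reeb_def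
proof (rule the_equality)
  assume z: "cmod z < 1"
  show "theta D3 (z, t) (0, 1) = 1 \<and> (\<forall>w. dform D3 (theta D3) (z, t) (0, 1) w = 0)"
    unfolding dtheta_D3[OF z] by (simp add: D3_def alphaB_def)
  fix v assume v: "theta D3 (z, t) v = 1 \<and> (\<forall>w. dform D3 (theta D3) (z, t) v w = 0)"
  from v have "4 * ((\<i> * fst v) \<bullet> fst (\<i> * fst v, 0::real)) / (1 - (cmod z)\<^sup>2)\<^sup>2 = 0"
    using dtheta_D3[OF z] by metis
  then have "fst v = 0" using z by (simp add: abs_square_eq_1)
  then show "v = (0,1)" using v by (simp add: D3_def alphaB_def prod_eq_iff)
qed


section \<open>CR Kobayashi pseudo-distance\<close>

definition cr_K_chain :: "('a, 'e::euclidean_space, 'r) ph_data_scheme \<Rightarrow> real \<Rightarrow> 'a \<Rightarrow> 'a \<Rightarrow>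
    nat \<Rightarrow> (nat \<Rightarrow> 'a) \<Rightarrow> (nat \<Rightarrow> complex \<times> real) \<Rightarrow> (nat \<Rightarrow> complex \<times> real) \<Rightarrow>
    (nat \<Rightarrow> complex \<times> real \<Rightarrow> 'a) \<Rightarrow> bool" where
  "cr_K_chain M \<Lambda> p q k pt a b f \<longleftrightarrow> 1 \<le> k \<and> pt 0 = p \<and> pt k = q \<and> (\<forall>i\<le>k. pt i \<in> points M) \<and>
     (\<forall>i\<in>{1..k}. a i \<in> points D3 \<and> b i \<in> points D3 \<and> cr_map D3 M (f i) \<and>
        bounded_gen_dilatation D3 M (f i) \<Lambda> \<and> f i (a i) = pt (i - 1) \<and> f i (b i) = pt i)"

definition chain_joinable :: "('a, 'e::euclidean_space, 'r) ph_data_scheme \<Rightarrow> real \<Rightarrow> bool" where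
  "chain_joinable M \<Lambda> \<longleftrightarrow>
     (\<forall>p\<in>points M. \<forall>q\<in>points M. \<exists>k pt a b f. cr_K_chain M \<Lambda> p q k pt a b f)"

definition cr_kobayashi_dist :: "('a, 'e::euclidean_space, 'r) ph_data_scheme \<Rightarrow> real \<Rightarrow>
    'a \<Rightarrow> 'a \<Rightarrow> real" where
  "cr_kobayashi_dist M \<Lambda> p q =
     Inf {\<Sum>i=1..k. cc_dist D3 (a i) (b i) | k pt a b f. cr_K_chain M \<Lambda> p q k pt a b f}"

definition cr_kobayashi_hyperbolic :: "('a, 'e::euclidean_space, 'r) ph_data_scheme \<Rightarrow> real \<Rightarrow>
    bool" where
  "cr_kobayashi_hyperbolic M \<Lambda> \<longleftrightarrow> chain_joinable M \<Lambda> \<and>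
     (\<forall>p\<in>points M. \<forall>q\<in>points M. p \<noteq> q \<longrightarrow> cr_kobayashi_dist M \<Lambda> p q > 0)"

end

theory Submission
  imports Defs
begin

text \<open>Let \<open>f\<close> be a CR map from \<open>D3\<close> to \<open>M\<close>.  It maps \<open>H\<close> to \<open>H\<close>, so it pulls \<open>\<theta>\<close> back to a
  multiple \<open>u\<close> of the contact form of \<open>D3\<close>, and \<open>u\<close> is the value of \<open>\<theta>\<close> on \<open>df \<xi>\<close>.  Taking
  exterior derivatives, \<open>f\<close> multiplies the Levi form by \<open>u\<close> as well (\<open>cr_map_pullback_theta\<close>,
  \<open>cr_map_levi\<close>).  Thus \<open>u\<close> is the square of the stretching of \<open>f\<close> on \<open>H\<close>, while
  \<open>\<bar>df \<xi>\<bar>\<^sup>2\<close> is at least \<open>u\<^sup>2\<close>.  The dilatation condition bounds \<open>\<bar>df \<xi>\<bar>\<^sup>2\<close> by \<open>\<Lambda>\<^sup>2\<close> times the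
  trace \<open>2 u\<close> over \<open>H\<close>.  So \<open>u\<^sup>2 \<le> 2 \<Lambda>\<^sup>2 u\<close>, which is a Schwarz lemma: every
  admissible map stretches horizontal vectors at most by the factor \<open>\<surd>(2 \<Lambda>\<^sup>2)\<close>
  (\<open>conformal_factor_bound\<close>).

  The rest of the argument compares lengths.  Near a point \<open>p\<close> the Levi form dominates a Euclidean
  norm in a chart (\<open>levi_lower_bound\<close>).  Hence a bump function \<open>\<rho>\<close> around \<open>p\<close> that vanishes at
  \<open>q\<close> varies along \<open>f\<close> at most \<open>K\<close> times as fast as horizontal length in \<open>D3\<close>, with \<open>K\<close>
  independent of \<open>f\<close> (\<open>separating_function\<close>).  Integrating over horizontal curves, which are only
  Lipschitz, gives \<open>\<bar>\<rho> (f y) - \<rho> (f x)\<bar> \<le> K * cc_dist D3 x y\<close> (\<open>cc_dist_variation\<close>).  Adding this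
  up over a chain from \<open>p\<close> to \<open>q\<close> bounds its length from below by \<open>\<bar>\<rho> q - \<rho> p\<bar> / K\<close>.\<close>

section \<open>Closure properties of smooth maps\<close>

lemma Ck_on_subset: "Ck_on n f S \<Longrightarrow> T \<subseteq> S \<Longrightarrow> Ck_on n f T"
  by (induction n arbitrary: f) (auto intro: continuous_on_subset)

lemma Ck_on_SucD: "Ck_on (Suc n) f S \<Longrightarrow> Ck_on n f S"
proof (induction n arbitrary: f)
  case 0
  then show ?case
    by (auto intro!: differentiable_imp_continuous_on differentiable_at_imp_differentiable_on)
next
  case (Suc n)
  show ?case unfolding Ck_on.simps(2)[of n f S]
    using Suc.prems unfolding Ck_on.simps(2)[of "Suc n" f S] by (blast intro: Suc.IH)
qed

lemma Ck_on_cong: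
  assumes "open S" "Ck_on n f S" "\<And>x. x \<in> S \<Longrightarrow> f x = g x"
  shows "Ck_on n g S"
  using assms(2,3)
proof (induction n arbitrary: f g)
  case 0
  then show ?case by (simp cong: continuous_on_cong)
next
  case (Suc n)
  have f: "f differentiable (at x)" if "x \<in> S" for x using Suc.prems(1) that by simp
  have g: "g differentiable (at x)" if x: "x \<in> S" for x
  proof -
    obtain D where "(f has_derivative D) (at x)" using f[OF x] unfolding differentiable_def by blast
    from has_derivative_transform_within_open[OF this assms(1) x Suc.prems(2)]
    show ?thesis unfolding differentiable_def by blast
  qed
  have e: "frechet_derivative f (at x) v = frechet_derivative g (at x) v" if x: "x \<in> S" for x v
    by (rule fun_cong[OF frechet_derivative_transform_within_open[OF f[OF x] assms(1) x Suc.prems(2)]])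
  have "Ck_on n (\<lambda>x. frechet_derivative g (at x) v) S" for v
    by (rule Suc.IH[OF _ e]) (use Suc.prems(1) in auto)
  then show ?case using g by simp
qed

text \<open>The closure properties are proved by induction on the order; this is the form in which the
  induction step needs a derivative that is given by a formula.\<close>

lemma Ck_on_SucI:
  assumes "open S" "\<And>x. x \<in> S \<Longrightarrow> (f has_derivative f' x) (at x)"
    "\<And>v. Ck_on n (\<lambda>x. f' x v) S"
  shows "Ck_on (Suc n) f S"
  unfolding Ck_on.simps
proof (intro conjI ballI allI)
  show "f differentiable (at x)" if "x \<in> S" for x
    using assms(2)[OF that] by (auto simp: differentiable_def)
  have e: "f' x v = frechet_derivative f (at x) v" if "x \<in> S" for x v
    by (rule fun_cong[OF frechet_derivative_at[OF assms(2)[OF that]]])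
  show "Ck_on n (\<lambda>x. frechet_derivative f (at x) v) S" for v
    using Ck_on_cong[OF assms(1) assms(3)[of v], of "\<lambda>x. frechet_derivative f (at x) v"] e by blast
qed

lemma Ck_on_Suc_has_derivative:
  "Ck_on (Suc n) f S \<Longrightarrow> x \<in> S \<Longrightarrow> (f has_derivative frechet_derivative f (at x)) (at x)"
  by (rule iffD1[OF frechet_derivative_works]) simp

lemma Ck_on_const: "open S \<Longrightarrow> Ck_on n (\<lambda>x. c) S"
  by (induction n arbitrary: c) simp_all

lemma Ck_on_add:
  assumes "open S"
  shows "Ck_on n f S \<Longrightarrow> Ck_on n g S \<Longrightarrow> Ck_on n (\<lambda>x. f x + g x) S"
proof (induction n arbitrary: f g)
  case 0
  then show ?case by (simp add: continuous_on_add)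
next
  case (Suc n)
  have d: "((\<lambda>x. f x + g x) has_derivative
      (\<lambda>v. frechet_derivative f (at x) v + frechet_derivative g (at x) v)) (at x)" if "x \<in> S" for x
    using Suc.prems that by (intro has_derivative_add Ck_on_Suc_has_derivative)
  show ?case
  proof (rule Ck_on_SucI[OF assms d])
    show "Ck_on n (\<lambda>x. frechet_derivative f (at x) v + frechet_derivative g (at x) v) S" for v
      by (rule Suc.IH) (use Suc.prems in auto)
  qed
qed

lemma Ck_on_sum:
  assumes "open S" "\<And>i. i \<in> I \<Longrightarrow> Ck_on n (f i) S"
  shows "Ck_on n (\<lambda>x. \<Sum>i\<in>I. f i x) S"
  using assms(2)
  by (induction I rule: infinite_finite_induct) (auto intro: Ck_on_add Ck_on_const assms(1))

lemma Ck_on_scaleR: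
  assumes "open S"
  shows "Ck_on n h S \<Longrightarrow> Ck_on n f S \<Longrightarrow> Ck_on n (\<lambda>x. h x *\<^sub>R f x) S"
proof (induction n arbitrary: f h)
  case 0
  then show ?case by (simp add: continuous_on_scaleR)
next
  case (Suc n)
  note s = Ck_on_SucD[OF Suc.prems(1)] Ck_on_SucD[OF Suc.prems(2)]
  have d: "((\<lambda>x. h x *\<^sub>R f x) has_derivative
      (\<lambda>v. h x *\<^sub>R frechet_derivative f (at x) v + frechet_derivative h (at x) v *\<^sub>R f x)) (at x)"
    if "x \<in> S" for x
    using Suc.prems that by (intro has_derivative_scaleR Ck_on_Suc_has_derivative)
  show ?case
  proof (rule Ck_on_SucI[OF assms d])
    show "Ck_on n (\<lambda>x. h x *\<^sub>R frechet_derivative f (at x) v + frechet_derivative h (at x) v *\<^sub>R f x) S" for v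
      by (intro Ck_on_add[OF assms] Suc.IH s) (use Suc.prems in auto)
  qed
qed

lemma Ck_on_inner_const:
  assumes "open S"
  shows "Ck_on n f S \<Longrightarrow> Ck_on n (\<lambda>x. f x \<bullet> b) S"
proof (induction n arbitrary: f)
  case 0
  then show ?case by (simp add: continuous_on_inner)
next
  case (Suc n)
  have d: "((\<lambda>x. f x \<bullet> b) has_derivative (\<lambda>v. frechet_derivative f (at x) v \<bullet> b)) (at x)"
    if "x \<in> S" for x
    using Suc.prems that by (intro has_derivative_inner_left Ck_on_Suc_has_derivative)
  show ?case
  proof (rule Ck_on_SucI[OF assms d])
    show "Ck_on n (\<lambda>x. frechet_derivative f (at x) v \<bullet> b) S" for v
      by (rule Suc.IH) (use Suc.prems in auto)
  qed
qed

lemma linear_basis_expand: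
  fixes f :: "'e::euclidean_space \<Rightarrow> 'f::real_vector"
  assumes "linear f"
  shows "f v = (\<Sum>b\<in>Basis. (v \<bullet> b) *\<^sub>R f b)"
proof -
  have "f v = f (\<Sum>b\<in>Basis. (v \<bullet> b) *\<^sub>R b)" by (simp add: euclidean_representation)
  then show ?thesis by (simp add: linear_sum[OF assms] linear_cmul[OF assms])
qed

lemma Ck_on_compose:
  fixes f :: "'d::real_normed_vector \<Rightarrow> 'e::euclidean_space"
    and g :: "'e \<Rightarrow> 'f::real_normed_vector"
  assumes "open S" "open T"
  shows "Ck_on n f S \<Longrightarrow> Ck_on n g T \<Longrightarrow> f ` S \<subseteq> T \<Longrightarrow> Ck_on n (\<lambda>x. g (f x)) S"
proof (induction n arbitrary: f g)
  case 0
  then show ?case using continuous_on_compose2[of T g S f] by simp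
next
  case (Suc n)
  have df: "(f has_derivative frechet_derivative f (at x)) (at x)" if "x \<in> S" for x
    by (rule Ck_on_Suc_has_derivative[OF Suc.prems(1) that])
  have dg: "(g has_derivative frechet_derivative g (at (f x))) (at (f x))" if "x \<in> S" for x
    by (rule Ck_on_Suc_has_derivative[OF Suc.prems(2)]) (use that Suc.prems(3) in auto)
  have d: "((\<lambda>x. g (f x)) has_derivative
      (\<lambda>v. \<Sum>b\<in>Basis. (frechet_derivative f (at x) v \<bullet> b) *\<^sub>R frechet_derivative g (at (f x)) b)) (at x)"
    if x: "x \<in> S" for x
    using has_derivative_compose[OF df[OF x] dg[OF x]]
    by (subst (asm) linear_basis_expand[OF has_derivative_linear[OF dg[OF x]]])
  show ?case
  proof (rule Ck_on_SucI[OF assms(1) d])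
    fix v
    show "Ck_on n (\<lambda>x. \<Sum>b\<in>Basis. (frechet_derivative f (at x) v \<bullet> b) *\<^sub>R
        frechet_derivative g (at (f x)) b) S"
    proof (intro Ck_on_sum Ck_on_scaleR Ck_on_inner_const assms(1))
      fix b :: 'e
      show "Ck_on n (\<lambda>x. frechet_derivative f (at x) v) S" using Suc.prems by simp
      show "Ck_on n (\<lambda>x. frechet_derivative g (at (f x)) b) S"
        by (rule Suc.IH[OF Ck_on_SucD[OF Suc.prems(1)] _ Suc.prems(3), of "\<lambda>y. frechet_derivative g (at y) b"])
          (use Suc.prems in simp)
    qed
  qed
qed

lemma smooth_on_compose:
  fixes f :: "'d::real_normed_vector \<Rightarrow> 'e::euclidean_space"
    and g :: "'e \<Rightarrow> 'f::real_normed_vector"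
  assumes "open S" "open T" "smooth_on f S" "smooth_on g T" "f ` S \<subseteq> T"
  shows "smooth_on (\<lambda>x. g (f x)) S"
  using assms Ck_on_compose unfolding smooth_on_def by blast

lemma smooth_on_cong:
  assumes "open S" "smooth_on f S" "\<And>x. x \<in> S \<Longrightarrow> f x = g x"
  shows "smooth_on g S"
  using assms Ck_on_cong unfolding smooth_on_def by blast

lemma smooth_on_subset: "smooth_on f S \<Longrightarrow> T \<subseteq> S \<Longrightarrow> smooth_on f T"
  using Ck_on_subset unfolding smooth_on_def by blast

lemma smooth_on_frechet_derivative: "smooth_on f S \<Longrightarrow> smooth_on (\<lambda>x. frechet_derivative f (at x) v) S"
  unfolding smooth_on_def using Ck_on.simps(2) by blast

lemma smooth_on_has_derivative:
  assumes "smooth_on f S" "x \<in> S"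
  shows "(f has_derivative frechet_derivative f (at x)) (at x)"
  using assms Ck_on_Suc_has_derivative unfolding smooth_on_def by blast

lemma smooth_on_continuous_on: "smooth_on f S \<Longrightarrow> continuous_on S f"
  unfolding smooth_on_def using Ck_on.simps(1) by blast

section \<open>Symmetry of second derivatives\<close>

text \<open>The mean value theorem along \<open>v\<close> and then along \<open>w\<close>.  The second difference on the left is
  symmetric in \<open>v\<close> and \<open>w\<close>, so the two orders give equal values of the two mixed derivatives at
  nearby points.\<close>

lemma second_difference_mvt:
  fixes F :: "'e::real_normed_vector \<Rightarrow> real"
  assumes d1: "\<And>s t. 0 \<le> s \<Longrightarrow> s \<le> h \<Longrightarrow> 0 \<le> t \<Longrightarrow> t \<le> h \<Longrightarrow>
      (F has_derivative F' (x + s *\<^sub>R v + t *\<^sub>R w)) (at (x + s *\<^sub>R v + t *\<^sub>R w))"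
    and d2: "\<And>s t. 0 \<le> s \<Longrightarrow> s \<le> h \<Longrightarrow> 0 \<le> t \<Longrightarrow> t \<le> h \<Longrightarrow>
      ((\<lambda>y. F' y v) has_derivative F'' (x + s *\<^sub>R v + t *\<^sub>R w)) (at (x + s *\<^sub>R v + t *\<^sub>R w))"
    and h: "0 < h"
  obtains s t where "0 < s" "s < h" "0 < t" "t < h"
    "F (x + h *\<^sub>R v + h *\<^sub>R w) - F (x + h *\<^sub>R v) - F (x + h *\<^sub>R w) + F x
       = h * (h * F'' (x + s *\<^sub>R v + t *\<^sub>R w) w)"
proof -
  \<comment> \<open>The term \<open>0 *\<^sub>R w\<close> makes the two endpoints instances of one formula.\<close>
  define \<phi> where "\<phi> s = F (x + s *\<^sub>R v + h *\<^sub>R w) - F (x + s *\<^sub>R v + 0 *\<^sub>R w)" for s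
  have line: "((\<lambda>s. F (x + s *\<^sub>R v + t *\<^sub>R w)) has_real_derivative F' (x + s *\<^sub>R v + t *\<^sub>R w) v) (at s)"
    if "0 \<le> s" "s \<le> h" "0 \<le> t" "t \<le> h" for s t
  proof -
    have "((\<lambda>s. x + s *\<^sub>R v + t *\<^sub>R w) has_derivative (\<lambda>r. r *\<^sub>R v)) (at s)"
      by (auto intro!: derivative_eq_intros)
    from has_derivative_compose[OF this d1[OF that]]
    have "((\<lambda>s. F (x + s *\<^sub>R v + t *\<^sub>R w)) has_derivative (\<lambda>r. F' (x + s *\<^sub>R v + t *\<^sub>R w) (r *\<^sub>R v))) (at s)" .
    moreover have "F' (x + s *\<^sub>R v + t *\<^sub>R w) (r *\<^sub>R v) = F' (x + s *\<^sub>R v + t *\<^sub>R w) v * r" for r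
      using linear_cmul[OF has_derivative_linear[OF d1[OF that]], of r v] by simp
    ultimately show ?thesis unfolding has_field_derivative_def by (simp add: mult_commute_abs)
  qed
  have line2: "((\<lambda>t. F' (x + s *\<^sub>R v + t *\<^sub>R w) v) has_real_derivative F'' (x + s *\<^sub>R v + t *\<^sub>R w) w) (at t)"
    if "0 \<le> s" "s \<le> h" "0 \<le> t" "t \<le> h" for s t
  proof -
    have "((\<lambda>t. x + s *\<^sub>R v + t *\<^sub>R w) has_derivative (\<lambda>r. r *\<^sub>R w)) (at t)"
      by (auto intro!: derivative_eq_intros)
    from has_derivative_compose[OF this d2[OF that]]
    have "((\<lambda>t. F' (x + s *\<^sub>R v + t *\<^sub>R w) v) has_derivative (\<lambda>r. F'' (x + s *\<^sub>R v + t *\<^sub>R w) (r *\<^sub>R w))) (at t)" .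
    moreover have "F'' (x + s *\<^sub>R v + t *\<^sub>R w) (r *\<^sub>R w) = F'' (x + s *\<^sub>R v + t *\<^sub>R w) w * r" for r
      using linear_cmul[OF has_derivative_linear[OF d2[OF that]], of r w] by simp
    ultimately show ?thesis unfolding has_field_derivative_def by (simp add: mult_commute_abs)
  qed
  have "\<exists>s>0. s < h \<and> \<phi> h - \<phi> 0 = (h - 0) * (F' (x + s *\<^sub>R v + h *\<^sub>R w) v - F' (x + s *\<^sub>R v + 0 *\<^sub>R w) v)"
    unfolding \<phi>_def by (rule MVT2[OF h]) (intro DERIV_diff line; use h in simp)
  then obtain s where s: "0 < s" "s < h"
    "\<phi> h - \<phi> 0 = h * (F' (x + s *\<^sub>R v + h *\<^sub>R w) v - F' (x + s *\<^sub>R v + 0 *\<^sub>R w) v)" by auto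
  have "\<exists>t>0. t < h \<and> F' (x + s *\<^sub>R v + h *\<^sub>R w) v - F' (x + s *\<^sub>R v + 0 *\<^sub>R w) v
      = (h - 0) * F'' (x + s *\<^sub>R v + t *\<^sub>R w) w"
    by (rule MVT2[OF h line2]) (use s in auto)
  then obtain t where t: "0 < t" "t < h" "F' (x + s *\<^sub>R v + h *\<^sub>R w) v - F' (x + s *\<^sub>R v + 0 *\<^sub>R w) v
      = h * F'' (x + s *\<^sub>R v + t *\<^sub>R w) w" by auto
  show thesis
    by (rule that[OF s(1,2) t(1,2)]) (use s(3)[unfolded t(3)] in \<open>simp add: \<phi>_def\<close>)
qed

lemma second_derivative_symmetric_real:
  fixes F :: "'e::real_normed_vector \<Rightarrow> real"
  assumes S: "open S" "x \<in> S" and F: "Ck_on 2 F S"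
  shows "frechet_derivative (\<lambda>y. frechet_derivative F (at y) v) (at x) w =
    frechet_derivative (\<lambda>y. frechet_derivative F (at y) w) (at x) v"
proof -
  let ?F' = "\<lambda>y. frechet_derivative F (at y)"
  let ?F2 = "\<lambda>v y. frechet_derivative (\<lambda>y. ?F' y v) (at y)"
  have F: "Ck_on (Suc (Suc 0)) F S" using F by (simp add: numeral_2_eq_2)
  have d1: "(F has_derivative ?F' y) (at y)" if "y \<in> S" for y
    using Ck_on_Suc_has_derivative[OF F that] .
  have d2: "((\<lambda>y. ?F' y u) has_derivative ?F2 u y) (at y)" if "y \<in> S" for y u
    by (rule Ck_on_Suc_has_derivative[where n=0, OF _ that]) (use F in simp)
  have c: "continuous_on S (\<lambda>y. ?F2 u y u')" for u u' using F by simp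
  have "\<bar>?F2 v x w - ?F2 w x v\<bar> \<le> e" if e: "0 < e" for e :: real
  proof -
    have ev: "\<exists>d>0. \<forall>y. dist y x < d \<longrightarrow> y \<in> S \<and> dist (?F2 u y u') (?F2 u x u') < e / 2" for u u'
    proof -
      have "isCont (\<lambda>y. ?F2 u y u') x" using c S by (simp add: continuous_on_eq_continuous_at)
      then obtain d1 where "d1 > 0" "\<forall>y. dist y x < d1 \<longrightarrow> dist (?F2 u y u') (?F2 u x u') < e / 2"
        unfolding continuous_at_eps_delta using e by (metis half_gt_zero)
      moreover obtain d2 where "d2 > 0" "\<forall>y. dist y x < d2 \<longrightarrow> y \<in> S"
        using S unfolding open_dist by blast
      ultimately show ?thesis by (intro exI[of _ "min d1 d2"]) auto
    qed
    obtain da where da: "da > 0" "\<And>y. dist y x < da \<Longrightarrow> y \<in> S \<and> dist (?F2 v y w) (?F2 v x w) < e / 2"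
      using ev[of v w] by blast
    obtain db where db: "db > 0" "\<And>y. dist y x < db \<Longrightarrow> dist (?F2 w y v) (?F2 w x v) < e / 2"
      using ev[of w v] by blast
    define h where "h = min da db / (2 * (norm v + norm w + 1))"
    have pos: "norm v + norm w + 1 > 0" by (smt (verit) norm_ge_zero)
    have h: "h > 0" unfolding h_def using da(1) db(1) pos by simp
    have hl: "h * (norm v + norm w) < min da db"
    proof -
      have "h * (norm v + norm w) < h * (2 * (norm v + norm w + 1))"
        using h by (intro mult_strict_left_mono) (smt (verit) norm_ge_zero)+
      also have "\<dots> = min da db" unfolding h_def using pos by simp
      finally show ?thesis .
    qed
    have near: "dist (x + s *\<^sub>R a + t *\<^sub>R b) x < da \<and> dist (x + s *\<^sub>R a + t *\<^sub>R b) x < db"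
      if "0 \<le> s" "s \<le> h" "0 \<le> t" "t \<le> h" "norm a + norm b = norm v + norm w" for s t a b
    proof -
      have "dist (x + s *\<^sub>R a + t *\<^sub>R b) x \<le> s * norm a + t * norm b"
        using norm_triangle_ineq[of "s *\<^sub>R a" "t *\<^sub>R b"] that by (simp add: dist_norm add.assoc)
      also have "\<dots> \<le> h * norm a + h * norm b" using that by (intro add_mono mult_right_mono) auto
      also have "\<dots> = h * (norm v + norm w)" using that by (simp add: distrib_left[symmetric])
      finally show ?thesis using hl by auto
    qed
    obtain s t where st: "0 < s" "s < h" "0 < t" "t < h"
      "F (x + h *\<^sub>R v + h *\<^sub>R w) - F (x + h *\<^sub>R v) - F (x + h *\<^sub>R w) + F x
         = h * (h * ?F2 v (x + s *\<^sub>R v + t *\<^sub>R w) w)"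
      by (rule second_difference_mvt[where F=F and F'="?F'" and F''="?F2 v" and x=x and v=v and w=w and h=h])
        (use near da h d1 d2 in auto)
    obtain s' t' where st': "0 < s'" "s' < h" "0 < t'" "t' < h"
      "F (x + h *\<^sub>R w + h *\<^sub>R v) - F (x + h *\<^sub>R w) - F (x + h *\<^sub>R v) + F x
         = h * (h * ?F2 w (x + s' *\<^sub>R w + t' *\<^sub>R v) v)"
      by (rule second_difference_mvt[where F=F and F'="?F'" and F''="?F2 w" and x=x and v=w and w=v and h=h])
        (use near da h d1 d2 in auto)
    have "h * (h * ?F2 v (x + s *\<^sub>R v + t *\<^sub>R w) w) = h * (h * ?F2 w (x + s' *\<^sub>R w + t' *\<^sub>R v) v)"
      unfolding st(5)[symmetric] st'(5)[symmetric] by (simp add: algebra_simps)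
    then have "?F2 v (x + s *\<^sub>R v + t *\<^sub>R w) w = ?F2 w (x + s' *\<^sub>R w + t' *\<^sub>R v) v" using h by simp
    moreover have "dist (?F2 v (x + s *\<^sub>R v + t *\<^sub>R w) w) (?F2 v x w) < e / 2"
      using da(2) near[of s t v w] st by auto
    moreover have "dist (?F2 w (x + s' *\<^sub>R w + t' *\<^sub>R v) v) (?F2 w x v) < e / 2"
      using db(2) near[of s' t' w v] st' by auto
    ultimately show ?thesis unfolding dist_real_def by linarith
  qed
  then have "\<bar>?F2 v x w - ?F2 w x v\<bar> \<le> 0" by (rule field_le_epsilon) simp
  then show ?thesis by simp
qed

lemma second_derivative_symmetric:
  fixes F :: "'e::real_normed_vector \<Rightarrow> 'f::euclidean_space"
  assumes S: "open S" "x \<in> S" and F: "smooth_on F S"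
  shows "frechet_derivative (\<lambda>y. frechet_derivative F (at y) v) (at x) w =
    frechet_derivative (\<lambda>y. frechet_derivative F (at y) w) (at x) v"
proof (rule euclidean_eqI)
  fix b :: 'f
  have c: "frechet_derivative (\<lambda>y. f y \<bullet> b) (at y) u = frechet_derivative f (at y) u \<bullet> b"
    if "smooth_on f S" "y \<in> S" for f y u
    using frechet_derivative_at[OF has_derivative_inner_left[OF smooth_on_has_derivative[OF that]], of b] by metis
  have t: "frechet_derivative (\<lambda>y. frechet_derivative (\<lambda>y. F y \<bullet> b) (at y) u) (at x) u' =
    frechet_derivative (\<lambda>y. frechet_derivative F (at y) u) (at x) u' \<bullet> b" for u u'
  proof -
    have sm: "smooth_on (\<lambda>y. frechet_derivative F (at y) u) S" by (rule smooth_on_frechet_derivative[OF F])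
    have "frechet_derivative (\<lambda>y. frechet_derivative F (at y) u \<bullet> b) (at x) =
       frechet_derivative (\<lambda>y. frechet_derivative (\<lambda>y. F y \<bullet> b) (at y) u) (at x)"
      by (rule frechet_derivative_transform_within_open[OF _ S])
        (use has_derivative_inner_left[OF smooth_on_has_derivative[OF sm S(2)]] c[OF F]
         in \<open>auto simp: differentiable_def\<close>)
    then show ?thesis using c[OF sm S(2)] by metis
  qed
  have "Ck_on 2 (\<lambda>y. F y \<bullet> b) S" using F unfolding smooth_on_def by (auto intro: Ck_on_inner_const[OF S(1)])
  from second_derivative_symmetric_real[OF S this, of v w]
  show "frechet_derivative (\<lambda>y. frechet_derivative F (at y) v) (at x) w \<bullet> b =
    frechet_derivative (\<lambda>y. frechet_derivative F (at y) w) (at x) v \<bullet> b" unfolding t .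
qed

section \<open>Tangent maps into a manifold and naturality of the exterior derivative\<close>

lemma frechet_derivative_eq: "(f has_derivative f') (at x) \<Longrightarrow> frechet_derivative f (at x) v = f' v"
  using frechet_derivative_at by metis

text \<open>Parametrisations (inverse charts) and the maps out of \<open>D3\<close> are both smooth maps from an
  open subset of a vector space into the manifold.\<close>

definition smooth_into :: "('a, 'e::euclidean_space, 'r) manifold_data_scheme \<Rightarrow>
    'v::euclidean_space set \<Rightarrow> ('v \<Rightarrow> 'a) \<Rightarrow> bool" where
  "smooth_into M S g \<longleftrightarrow> open S \<and> g ` S \<subseteq> points M \<and>
     (\<forall>c\<in>atlas M. open {x\<in>S. g x \<in> chart_dom c} \<and>
        smooth_on (chart_map c \<circ> g) {x\<in>S. g x \<in> chart_dom c})"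

text \<open>As everywhere, the tangent vector at \<open>g x\<close> is expressed in the preferred chart there.\<close>

definition tangent_map :: "('a, 'e::euclidean_space, 'r) manifold_data_scheme \<Rightarrow>
    ('v::euclidean_space \<Rightarrow> 'a) \<Rightarrow> 'v \<Rightarrow> 'v \<Rightarrow> 'e" where
  "tangent_map M g x w = frechet_derivative (chart_map (chart_at M (g x)) \<circ> g) (at x) w"

definition pullback :: "('a, 'e::euclidean_space, 'r) manifold_data_scheme \<Rightarrow>
    ('a \<Rightarrow> 'e \<Rightarrow> real) \<Rightarrow> ('v::euclidean_space \<Rightarrow> 'a) \<Rightarrow> 'v \<Rightarrow> 'v \<Rightarrow> real" where
  "pullback M \<alpha> g x w = \<alpha> (g x) (tangent_map M g x w)"

locale atlas_manifold =
  fixes M :: "('a, 'e::euclidean_space, 'r) manifold_data_scheme"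
  assumes atlas: "smooth_atlas (mtop M) (atlas M)"
begin

lemma is_chart: "c \<in> atlas M \<Longrightarrow> is_chart (mtop M) c"
  using atlas by (simp add: smooth_atlas_def)

lemma chart_dom_openin: "c \<in> atlas M \<Longrightarrow> openin (mtop M) (chart_dom c)"
  using is_chart by (auto simp: is_chart_def)

lemma chart_dom_subset: "c \<in> atlas M \<Longrightarrow> chart_dom c \<subseteq> points M"
  by (rule openin_subset[OF chart_dom_openin])

lemma chart_in_points: "c \<in> atlas M \<Longrightarrow> q \<in> chart_dom c \<Longrightarrow> q \<in> points M"
  using chart_dom_subset[of c] by blast

lemma chart_homeo: "c \<in> atlas M \<Longrightarrow>
   homeomorphic_map (subtopology (mtop M) (chart_dom c)) (top_of_set (chart_map c ` chart_dom c)) (chart_map c)"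
  using is_chart by (auto simp: is_chart_def)

lemma chart_inj: "c \<in> atlas M \<Longrightarrow> inj_on (chart_map c) (chart_dom c)"
  using homeomorphic_imp_injective_map[OF chart_homeo] chart_dom_subset
  by (simp add: Int_absorb1)

lemma chart_inv_map [simp]: "c \<in> atlas M \<Longrightarrow> x \<in> chart_dom c \<Longrightarrow> chart_inv c (chart_map c x) = x"
  unfolding chart_inv_def by (rule inv_into_f_f[OF chart_inj])

lemma open_chart_image:
  assumes "c \<in> atlas M" "openin (mtop M) U"
  shows "open (chart_map c ` (U \<inter> chart_dom c))"
proof -
  have "openin (subtopology (mtop M) (chart_dom c)) (U \<inter> chart_dom c)"
    using assms(2) by (auto simp: openin_subtopology)
  then have "openin (top_of_set (chart_map c ` chart_dom c)) (chart_map c ` (U \<inter> chart_dom c))"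
    using homeomorphic_imp_open_map[OF chart_homeo[OF assms(1)]] by (auto simp: open_map_def)
  moreover have "open (chart_map c ` chart_dom c)" using is_chart[OF assms(1)] by (simp add: is_chart_def)
  ultimately show ?thesis using openin_open_trans by blast
qed

lemma open_chart_range: "c \<in> atlas M \<Longrightarrow> open (chart_map c ` chart_dom c)"
  using is_chart by (simp add: is_chart_def)

lemma chart_inv_in: "c \<in> atlas M \<Longrightarrow> y \<in> chart_map c ` chart_dom c \<Longrightarrow> chart_inv c y \<in> chart_dom c"
  by auto

lemma chart_at_atlas: "p \<in> points M \<Longrightarrow> chart_at M p \<in> atlas M"
  and chart_at_dom: "p \<in> points M \<Longrightarrow> p \<in> chart_dom (chart_at M p)"
proof -
  assume "p \<in> points M"
  then have "p \<in> (\<Union>c\<in>atlas M. chart_dom c)" using atlas by (simp add: smooth_atlas_def)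
  then have "\<exists>c. c \<in> atlas M \<and> p \<in> chart_dom c" by blast
  from someI_ex[OF this] show "chart_at M p \<in> atlas M" "p \<in> chart_dom (chart_at M p)"
    unfolding chart_at_def by blast+
qed

lemma transition_smooth: "c \<in> atlas M \<Longrightarrow> c' \<in> atlas M \<Longrightarrow>
   smooth_on (chart_map c' \<circ> chart_inv c) (chart_map c ` (chart_dom c \<inter> chart_dom c'))"
  using atlas by (auto simp: smooth_atlas_def)

lemma open_overlap: "c \<in> atlas M \<Longrightarrow> c' \<in> atlas M \<Longrightarrow> open (chart_map c ` (chart_dom c \<inter> chart_dom c'))"
  using open_chart_image[of c "chart_dom c'"] chart_dom_openin by (simp add: Int_commute)

lemma transition_has_derivative:
  assumes "c \<in> atlas M" "c' \<in> atlas M" "x \<in> chart_dom c" "x \<in> chart_dom c'"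
  shows "(chart_map c' \<circ> chart_inv c has_derivative
     frechet_derivative (chart_map c' \<circ> chart_inv c) (at (chart_map c x))) (at (chart_map c x))"
  by (rule smooth_on_has_derivative[OF transition_smooth]) (use assms in auto)

lemma chart_inv_smooth_into: "c \<in> atlas M \<Longrightarrow> smooth_into M (chart_map c ` chart_dom c) (chart_inv c)"
proof -
  assume c: "c \<in> atlas M"
  have "{x \<in> chart_map c ` chart_dom c. chart_inv c x \<in> chart_dom c'} =
     chart_map c ` (chart_dom c \<inter> chart_dom c')" for c' :: "('a,'e) chart"
    using c by auto
  moreover have "chart_inv c ` chart_map c ` chart_dom c \<subseteq> points M" using c chart_dom_subset[OF c] by auto
  ultimately show ?thesis unfolding smooth_into_def
    using open_chart_range[OF c] open_overlap[OF c] transition_smooth[OF c] by simp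
qed

lemma smooth_into_has_derivative:
  assumes "smooth_into M S g" "x \<in> S" "c \<in> atlas M" "g x \<in> chart_dom c"
  shows "(chart_map c \<circ> g has_derivative frechet_derivative (chart_map c \<circ> g) (at x)) (at x)"
  using assms by (intro smooth_on_has_derivative[of _ "{x\<in>S. g x \<in> chart_dom c}"]) (auto simp: smooth_into_def)

lemma smooth_into_points: "smooth_into M S g \<Longrightarrow> x \<in> S \<Longrightarrow> g x \<in> points M"
  by (auto simp: smooth_into_def)

lemma linear_tangent_map:
  assumes "smooth_into M S g" "x \<in> S"
  shows "linear (tangent_map M g x)"
  using has_derivative_linear[OF smooth_into_has_derivative[OF assms chart_at_atlas chart_at_dom]]
    smooth_into_points[OF assms] unfolding tangent_map_def by presburger

text \<open>Near \<open>x\<close> the map \<open>g\<close> factors through any chart \<open>c\<close> at \<open>g x\<close>, so the chain rule of vector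
  spaces applies to \<open>G \<circ> chart_inv c\<close> and \<open>chart_map c \<circ> g\<close>.\<close>

lemma chain_rule:
  fixes G :: "'a \<Rightarrow> 'f::real_normed_vector"
  assumes g: "smooth_into M S g" "x \<in> S"
    and G: "(G \<circ> chart_inv c has_derivative G') (at (chart_map c (g x)))"
    and c: "c \<in> atlas M" "g x \<in> chart_dom c"
  shows "(G \<circ> g has_derivative (\<lambda>w. G' (frechet_derivative (chart_map c \<circ> g) (at x) w))) (at x)"
proof -
  have op: "open {x\<in>S. g x \<in> chart_dom c}" using g c by (simp add: smooth_into_def)
  have "((\<lambda>x. (G \<circ> chart_inv c) ((chart_map c \<circ> g) x)) has_derivative
     (\<lambda>w. G' (frechet_derivative (chart_map c \<circ> g) (at x) w))) (at x)"
    using has_derivative_compose[OF smooth_into_has_derivative[OF g c]] G by (simp add: o_def)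
  then show ?thesis
    by (rule has_derivative_transform_within_open[OF _ op]) (use g c in auto)
qed

text \<open>Thus \<open>mderiv M (chart_map c)\<close> changes coordinates from the preferred chart to \<open>c\<close>; the next two
  lemmas show that the tangent map of \<open>chart_inv c\<close> is its inverse.\<close>

lemma chart_chain_rule:
  assumes g: "smooth_into M S g" "x \<in> S" and c: "c \<in> atlas M" "g x \<in> chart_dom c"
  shows "frechet_derivative (chart_map c \<circ> g) (at x) w = mderiv M (chart_map c) (g x) (tangent_map M g x w)"
proof -
  have p: "g x \<in> points M" by (rule smooth_into_points[OF g])
  note q = chart_at_atlas[OF p] chart_at_dom[OF p]
  have "(chart_map c \<circ> g has_derivative (\<lambda>w. frechet_derivative (chart_map c \<circ> chart_inv (chart_at M (g x)))
      (at (chart_map (chart_at M (g x)) (g x))) (frechet_derivative (chart_map (chart_at M (g x)) \<circ> g) (at x) w))) (at x)"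
    by (rule chain_rule[OF g transition_has_derivative[OF q(1) c(1) q(2) c(2)] q])
  from frechet_derivative_eq[OF this] show ?thesis unfolding mderiv_def tangent_map_def .
qed

lemma chart_mderiv_tangent_map:
  assumes c: "c \<in> atlas M" and y: "y \<in> chart_map c ` chart_dom c"
  shows "mderiv M (chart_map c) (chart_inv c y) (tangent_map M (chart_inv c) y w) = w"
proof -
  have "frechet_derivative (chart_map c \<circ> chart_inv c) (at y) w = w"
  proof -
    have "((chart_map c \<circ> chart_inv c) has_derivative (\<lambda>w. w)) (at y)"
      by (rule has_derivative_transform_within_open[OF has_derivative_ident open_chart_range[OF c] y]) (use c in auto)
    then show ?thesis by (rule frechet_derivative_eq)
  qed
  then show ?thesis
    using chart_chain_rule[OF chart_inv_smooth_into[OF c] y c chart_inv_in[OF c y], of w] by simp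
qed

lemma tangent_map_chart_mderiv:
  assumes c: "c \<in> atlas M" and q: "q \<in> chart_dom c"
  shows "tangent_map M (chart_inv c) (chart_map c q) (mderiv M (chart_map c) q v) = v"
proof -
  let ?d = "chart_at M q"
  have p: "q \<in> points M" by (rule chart_in_points[OF c q])
  note d = chart_at_atlas[OF p] chart_at_dom[OF p]
  have y: "chart_map ?d q \<in> chart_map ?d ` chart_dom ?d" using d by simp
  have "(chart_map ?d \<circ> chart_inv ?d has_derivative (\<lambda>w. frechet_derivative (chart_map ?d \<circ> chart_inv c) (at (chart_map c q))
      (frechet_derivative (chart_map c \<circ> chart_inv ?d) (at (chart_map ?d q)) w))) (at (chart_map ?d q))"
    using chain_rule[OF chart_inv_smooth_into[OF d(1)] y, of "chart_map ?d" c] c q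
      transition_has_derivative[OF c d(1) q d(2)] unfolding chart_inv_map[OF d] by blast
  moreover have "(chart_map ?d \<circ> chart_inv ?d has_derivative (\<lambda>w. w)) (at (chart_map ?d q))"
    by (rule has_derivative_transform_within_open[OF has_derivative_ident open_chart_range[OF d(1)] y]) (use d in auto)
  ultimately have "(\<lambda>w. frechet_derivative (chart_map ?d \<circ> chart_inv c) (at (chart_map c q))
      (frechet_derivative (chart_map c \<circ> chart_inv ?d) (at (chart_map ?d q)) w)) = (\<lambda>w. w)"
    by (rule has_derivative_unique)
  from fun_cong[OF this, of v] show ?thesis unfolding tangent_map_def mderiv_def chart_inv_map[OF c q] .
qed

lemma linear_chart_mderiv:
  assumes "c \<in> atlas M" "q \<in> chart_dom c"
  shows "linear (mderiv M (chart_map c) q)"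
proof -
  have p: "q \<in> points M" by (rule chart_in_points[OF assms])
  show ?thesis unfolding mderiv_def
    using has_derivative_linear[OF transition_has_derivative[OF chart_at_atlas[OF p] assms(1) chart_at_dom[OF p] assms(2)]] .
qed

lemma pullback_chart:
  assumes g: "smooth_into M S g" "x \<in> S" and c: "c \<in> atlas M" "g x \<in> chart_dom c"
  shows "pullback M \<alpha> g x w =
    pullback M \<alpha> (chart_inv c) (chart_map c (g x)) (frechet_derivative (chart_map c \<circ> g) (at x) w)"
  unfolding pullback_def chart_chain_rule[OF g c] using tangent_map_chart_mderiv[OF c] c by simp

text \<open>The coordinate fields of a chart are the test fields that turn the smoothness of a form into
  smoothness of its coefficients.\<close>

lemma smooth_field_chart_const:
  assumes c: "c \<in> atlas M"
  shows "smooth_field_on M (chart_dom c) (\<lambda>q. tangent_map M (chart_inv c) (chart_map c q) v)"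
  unfolding smooth_field_on_def smooth_fun_on_def
proof (intro ballI)
  fix c' c'' assume c': "c' \<in> atlas M" and c'': "c'' \<in> atlas M"
  let ?U = "chart_dom c \<inter> chart_dom c' \<inter> chart_dom c''"
  have U: "openin (mtop M) (chart_dom c \<inter> chart_dom c')" using chart_dom_openin[OF c] chart_dom_openin[OF c'] by (rule openin_Int)
  have op: "open (chart_map c'' ` ?U)" by (rule open_chart_image[OF c'' U])
  have "smooth_on (\<lambda>y. frechet_derivative (chart_map c' \<circ> chart_inv c) (at ((chart_map c \<circ> chart_inv c'') y)) v) (chart_map c'' ` ?U)"
  proof (rule smooth_on_compose[OF op open_overlap[OF c c'], where f="chart_map c \<circ> chart_inv c''"
        and g="\<lambda>y. frechet_derivative (chart_map c' \<circ> chart_inv c) (at y) v"])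
    show "smooth_on (chart_map c \<circ> chart_inv c'') (chart_map c'' ` ?U)"
      by (rule smooth_on_subset[OF transition_smooth[OF c'' c]]) auto
    show "smooth_on (\<lambda>y. frechet_derivative (chart_map c' \<circ> chart_inv c) (at y) v) (chart_map c ` (chart_dom c \<inter> chart_dom c'))"
      by (rule smooth_on_frechet_derivative[OF transition_smooth[OF c c']])
    show "(chart_map c \<circ> chart_inv c'') ` (chart_map c'' ` ?U) \<subseteq> chart_map c ` (chart_dom c \<inter> chart_dom c')"
      using c'' by auto
  qed
  then show "smooth_on ((\<lambda>q. mderiv M (chart_map c') q (tangent_map M (chart_inv c) (chart_map c q) v)) \<circ> chart_inv c'')
        (chart_map c'' ` ?U)"
    by (rule smooth_on_cong[OF op])
      (use c c'' in \<open>auto simp: chart_chain_rule[OF chart_inv_smooth_into[OF c] _ c']\<close>)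
qed

end

locale manifold_with_form = atlas_manifold M
  for M :: "('a, 'e::euclidean_space, 'r) manifold_data_scheme" +
  fixes \<alpha> :: "'a \<Rightarrow> 'e \<Rightarrow> real"
  assumes form: "smooth_form M \<alpha>"
begin

lemma linear_form: "p \<in> points M \<Longrightarrow> linear (\<alpha> p)"
  using form by (simp add: smooth_form_def)

lemma linear_pullback: "smooth_into M S g \<Longrightarrow> x \<in> S \<Longrightarrow> linear (pullback M \<alpha> g x)"
  unfolding pullback_def
  using linear_compose[OF linear_tangent_map linear_form[OF smooth_into_points]] by (simp add: o_def)

lemma smooth_pullback_chart:
  assumes c: "c \<in> atlas M"
  shows "smooth_on (\<lambda>y. pullback M \<alpha> (chart_inv c) y v) (chart_map c ` chart_dom c)"
proof -
  have "smooth_fun_on M (chart_dom c) (\<lambda>q. \<alpha> q (tangent_map M (chart_inv c) (chart_map c q) v))"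
    using form chart_dom_openin[OF c] smooth_field_chart_const[OF c] by (simp add: smooth_form_def)
  then have "smooth_on ((\<lambda>q. \<alpha> q (tangent_map M (chart_inv c) (chart_map c q) v)) \<circ> chart_inv c) (chart_map c ` chart_dom c)"
    using c unfolding smooth_fun_on_def by fastforce
  then show ?thesis
    by (rule smooth_on_cong[OF open_chart_range[OF c]]) (use c in \<open>auto simp: pullback_def\<close>)
qed

lemma pullback_chart_has_derivative:
  assumes c: "c \<in> atlas M" and y: "y \<in> chart_map c ` chart_dom c"
  shows "((\<lambda>y. pullback M \<alpha> (chart_inv c) y v) has_derivative
    frechet_derivative (\<lambda>y. pullback M \<alpha> (chart_inv c) y v) (at y)) (at y)"
  by (rule smooth_on_has_derivative[OF smooth_pullback_chart[OF c] y])

lemma pullback_chart_derivative_expand: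
  assumes c: "c \<in> atlas M" and y: "y \<in> chart_map c ` chart_dom c"
  shows "frechet_derivative (\<lambda>y. pullback M \<alpha> (chart_inv c) y v) (at y) w =
    (\<Sum>b\<in>Basis. (v \<bullet> b) * frechet_derivative (\<lambda>y. pullback M \<alpha> (chart_inv c) y b) (at y) w)"
proof -
  have "((\<lambda>y. \<Sum>b\<in>Basis. (v \<bullet> b) * pullback M \<alpha> (chart_inv c) y b) has_derivative
     (\<lambda>w. \<Sum>b\<in>Basis. (v \<bullet> b) * frechet_derivative (\<lambda>y. pullback M \<alpha> (chart_inv c) y b) (at y) w)) (at y)"
    by (intro has_derivative_sum has_derivative_mult_right pullback_chart_has_derivative[OF c y])
  then have "((\<lambda>y. pullback M \<alpha> (chart_inv c) y v) has_derivative
     (\<lambda>w. \<Sum>b\<in>Basis. (v \<bullet> b) * frechet_derivative (\<lambda>y. pullback M \<alpha> (chart_inv c) y b) (at y) w)) (at y)"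
    by (rule has_derivative_transform_within_open[OF _ open_chart_range[OF c] y])
      (subst linear_basis_expand[OF linear_pullback[OF chart_inv_smooth_into[OF c]]], auto)
  then show ?thesis by (rule frechet_derivative_eq)
qed

text \<open>In the preferred chart at \<open>q\<close> the constant extensions commute, so the bracket term of the
  exterior derivative vanishes and only the derivatives of the coefficients remain.\<close>

lemma dform_preferred_chart:
  assumes q: "q \<in> points M"
  shows "dform M \<alpha> q u v =
    (frechet_derivative (\<lambda>y. pullback M \<alpha> (chart_inv (chart_at M q)) y v) (at (chart_map (chart_at M q) q)) u
     - frechet_derivative (\<lambda>y. pullback M \<alpha> (chart_inv (chart_at M q)) y u) (at (chart_map (chart_at M q) q)) v) / 2"
proof -
  let ?c = "chart_at M q"
  have c: "?c \<in> atlas M" "q \<in> chart_dom ?c" by (rule chart_at_atlas[OF q], rule chart_at_dom[OF q])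
  have y: "chart_map ?c q \<in> chart_map ?c ` chart_dom ?c" using c by simp
  have ce: "const_ext M q w r = tangent_map M (chart_inv ?c) (chart_map ?c r) w" if "r \<in> chart_dom ?c" for r w
    unfolding const_ext_def tangent_map_def using that c by simp
  have 1: "mderiv M (\<lambda>r. \<alpha> r (const_ext M q w r)) q w' =
      frechet_derivative (\<lambda>y. pullback M \<alpha> (chart_inv ?c) y w) (at (chart_map ?c q)) w'" for w w'
  proof -
    have "((\<lambda>r. \<alpha> r (const_ext M q w r)) \<circ> chart_inv ?c has_derivative
      frechet_derivative (\<lambda>y. pullback M \<alpha> (chart_inv ?c) y w) (at (chart_map ?c q))) (at (chart_map ?c q))"
      by (rule has_derivative_transform_within_open[OF pullback_chart_has_derivative[OF c(1) y] open_chart_range[OF c(1)] y])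
        (use c ce in \<open>auto simp: pullback_def\<close>)
    then show ?thesis unfolding mderiv_def by (rule frechet_derivative_eq)
  qed
  have id: "mderiv M (chart_map ?c) r (const_ext M q w r) = w" if "r \<in> chart_dom ?c" for r w
    using chart_mderiv_tangent_map[OF c(1), of "chart_map ?c r" w] that unfolding ce[OF that] chart_inv_map[OF c(1) that] by simp
  have 2: "mderiv M (\<lambda>r. mderiv M (chart_map ?c) r (const_ext M q w r)) q w' = 0" for w w'
  proof -
    have "((\<lambda>r. mderiv M (chart_map ?c) r (const_ext M q w r)) \<circ> chart_inv ?c has_derivative (\<lambda>x. 0)) (at (chart_map ?c q))"
      by (rule has_derivative_transform_within_open[OF has_derivative_const[of w] open_chart_range[OF c(1)] y])
        (use c id in auto)
    then show ?thesis unfolding mderiv_def[of M "\<lambda>r. mderiv M (chart_map ?c) r (const_ext M q w r)"]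
      by (rule frechet_derivative_eq)
  qed
  have 3: "const_ext M q w q = w" for w
  proof -
    have "frechet_derivative (chart_map ?c \<circ> chart_inv ?c) (at (chart_map ?c q)) w = w"
      using chart_mderiv_tangent_map[OF c(1) y, of w] chart_chain_rule[OF chart_inv_smooth_into[OF c(1)] y c(1), of w] c by simp
    then show ?thesis by (simp add: const_ext_def)
  qed
  show ?thesis unfolding dform_def dform_field_def lie_bracket_def Let_def 1 2 3
    using linear_0[OF linear_form[OF q]] by simp
qed

text \<open>In a chart the pullback is a sum of products of the coefficients of \<open>\<alpha>\<close> along \<open>F\<close> with first
  derivatives of \<open>F\<close>.  The first summand below contains the second derivative of \<open>F\<close>, the other
  one the derivative of the coefficients.\<close>

lemma pullback_has_derivative:
  assumes g: "smooth_into M S g" and x: "x \<in> S" and c: "c \<in> atlas M" "g x \<in> chart_dom c"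
  defines "F \<equiv> chart_map c \<circ> g"
  shows "((\<lambda>x. pullback M \<alpha> g x w) has_derivative
     (\<lambda>v. pullback M \<alpha> (chart_inv c) (F x) (frechet_derivative (\<lambda>x. frechet_derivative F (at x) w) (at x) v) +
       frechet_derivative (\<lambda>y. pullback M \<alpha> (chart_inv c) y (frechet_derivative F (at x) w)) (at (F x))
         (frechet_derivative F (at x) v))) (at x)"
proof -
  let ?S = "{x\<in>S. g x \<in> chart_dom c}"
  let ?P = "pullback M \<alpha> (chart_inv c)"
  have op: "open ?S" and F: "smooth_on F ?S" using g c by (auto simp: smooth_into_def F_def)
  have xS: "x \<in> ?S" using x c by simp
  have y: "F z \<in> chart_map c ` chart_dom c" if "z \<in> ?S" for z using that unfolding F_def by auto
  have eq: "pullback M \<alpha> g z w = (\<Sum>b\<in>Basis. (frechet_derivative F (at z) w \<bullet> b) * ?P (F z) b)" if z: "z \<in> ?S" for z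
  proof -
    have "pullback M \<alpha> g z w = ?P (F z) (frechet_derivative F (at z) w)"
      using pullback_chart[OF g _ c(1)] z unfolding F_def by simp
    then show ?thesis
      using linear_basis_expand[OF linear_pullback[OF chart_inv_smooth_into[OF c(1)] y[OF z]], of "frechet_derivative F (at z) w"]
      by simp
  qed
  have dF: "(F has_derivative frechet_derivative F (at x)) (at x)" by (rule smooth_on_has_derivative[OF F xS])
  have d2F: "((\<lambda>x. frechet_derivative F (at x) w) has_derivative
      frechet_derivative (\<lambda>x. frechet_derivative F (at x) w) (at x)) (at x)"
    by (rule smooth_on_has_derivative[OF smooth_on_frechet_derivative[OF F] xS])
  have dP: "((\<lambda>z. ?P (F z) b) has_derivative (\<lambda>v. frechet_derivative (\<lambda>y. ?P y b) (at (F x)) (frechet_derivative F (at x) v))) (at x)" for b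
    by (rule has_derivative_compose[OF dF pullback_chart_has_derivative[OF c(1) y[OF xS]]])
  have "((\<lambda>z. \<Sum>b\<in>Basis. (frechet_derivative F (at z) w \<bullet> b) * ?P (F z) b) has_derivative
      (\<lambda>v. \<Sum>b\<in>Basis. (frechet_derivative F (at x) w \<bullet> b) * frechet_derivative (\<lambda>y. ?P y b) (at (F x)) (frechet_derivative F (at x) v)
         + (frechet_derivative (\<lambda>x. frechet_derivative F (at x) w) (at x) v \<bullet> b) * ?P (F x) b)) (at x)"
    by (intro has_derivative_sum has_derivative_mult has_derivative_inner_left d2F dP)
  then have "((\<lambda>x. pullback M \<alpha> g x w) has_derivative
      (\<lambda>v. \<Sum>b\<in>Basis. (frechet_derivative F (at x) w \<bullet> b) * frechet_derivative (\<lambda>y. ?P y b) (at (F x)) (frechet_derivative F (at x) v)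
         + (frechet_derivative (\<lambda>x. frechet_derivative F (at x) w) (at x) v \<bullet> b) * ?P (F x) b)) (at x)"
    by (rule has_derivative_transform_within_open[OF _ op xS]) (use eq in auto)
  moreover have "?P (F x) (frechet_derivative (\<lambda>x. frechet_derivative F (at x) w) (at x) v) +
       frechet_derivative (\<lambda>y. ?P y (frechet_derivative F (at x) w)) (at (F x)) (frechet_derivative F (at x) v) =
     (\<Sum>b\<in>Basis. (frechet_derivative F (at x) w \<bullet> b) * frechet_derivative (\<lambda>y. ?P y b) (at (F x)) (frechet_derivative F (at x) v)
         + (frechet_derivative (\<lambda>x. frechet_derivative F (at x) w) (at x) v \<bullet> b) * ?P (F x) b)" for v
    using linear_basis_expand[OF linear_pullback[OF chart_inv_smooth_into[OF c(1)] y[OF xS]],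
          of "frechet_derivative (\<lambda>x. frechet_derivative F (at x) w) (at x) v"]
    unfolding pullback_chart_derivative_expand[OF c(1) y[OF xS], of "frechet_derivative F (at x) w"]
    by (simp add: sum.distrib)
  ultimately show ?thesis by presburger
qed

text \<open>Naturality \<open>d (g\<^sup>* \<alpha>) = g\<^sup>* d\<alpha>\<close>: the terms with second derivatives of \<open>g\<close> cancel by
  symmetry.\<close>

lemma dform_tangent_map:
  assumes g: "smooth_into M S g" and x: "x \<in> S"
  shows "dform M \<alpha> (g x) (tangent_map M g x v) (tangent_map M g x w) =
    (frechet_derivative (\<lambda>x. pullback M \<alpha> g x w) (at x) v - frechet_derivative (\<lambda>x. pullback M \<alpha> g x v) (at x) w) / 2"
proof -
  let ?c = "chart_at M (g x)"
  define F where "F = chart_map ?c \<circ> g"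
  have p: "g x \<in> points M" by (rule smooth_into_points[OF g x])
  note c = chart_at_atlas[OF p] chart_at_dom[OF p]
  let ?S = "{x\<in>S. g x \<in> chart_dom ?c}"
  have op: "open ?S" and F: "smooth_on F ?S" using g c by (auto simp: smooth_into_def F_def)
  have xS: "x \<in> ?S" using x c by simp
  have d: "frechet_derivative (\<lambda>x. pullback M \<alpha> g x w) (at x) v =
     pullback M \<alpha> (chart_inv ?c) (F x) (frechet_derivative (\<lambda>x. frechet_derivative F (at x) w) (at x) v) +
       frechet_derivative (\<lambda>y. pullback M \<alpha> (chart_inv ?c) y (frechet_derivative F (at x) w)) (at (F x))
         (frechet_derivative F (at x) v)" for v w
    using frechet_derivative_eq[OF pullback_has_derivative[OF g x c, of w], of v] unfolding F_def .
  have t: "tangent_map M g x u = frechet_derivative F (at x) u" for u by (simp add: tangent_map_def F_def)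
  have y: "chart_map ?c (g x) = F x" by (simp add: F_def)
  show ?thesis unfolding dform_preferred_chart[OF p] d t y
    using second_derivative_symmetric[OF op xS F, of v w] by simp
qed

text \<open>Naturality for \<open>g = chart_inv c\<close>.  All points of the chart are treated with the same functions
  here, while the definition uses a different chart at each point; bilinearity and
  continuity of \<open>d\<alpha>\<close> are read off from this formula.\<close>

lemma dform_chart:
  assumes c: "c \<in> atlas M" and q: "q \<in> chart_dom c"
  shows "dform M \<alpha> q u v =
    (\<Sum>b\<in>Basis. \<Sum>b'\<in>Basis. ((mderiv M (chart_map c) q v \<bullet> b) * (mderiv M (chart_map c) q u \<bullet> b') -
        (mderiv M (chart_map c) q u \<bullet> b) * (mderiv M (chart_map c) q v \<bullet> b')) *
      frechet_derivative (\<lambda>y. pullback M \<alpha> (chart_inv c) y b) (at (chart_map c q)) b') / 2"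
proof -
  have y: "chart_map c q \<in> chart_map c ` chart_dom c" using q by simp
  have e: "frechet_derivative (\<lambda>y. pullback M \<alpha> (chart_inv c) y v) (at (chart_map c q)) w =
    (\<Sum>b\<in>Basis. \<Sum>b'\<in>Basis. (v \<bullet> b) * (w \<bullet> b') * frechet_derivative (\<lambda>y. pullback M \<alpha> (chart_inv c) y b) (at (chart_map c q)) b')" for v w
  proof -
    have "frechet_derivative (\<lambda>y. pullback M \<alpha> (chart_inv c) y b) (at (chart_map c q)) w =
      (\<Sum>b'\<in>Basis. (w \<bullet> b') * frechet_derivative (\<lambda>y. pullback M \<alpha> (chart_inv c) y b) (at (chart_map c q)) b')" for b
      using linear_basis_expand[OF has_derivative_linear[OF pullback_chart_has_derivative[OF c y]], of b w] by simp
    then show ?thesis unfolding pullback_chart_derivative_expand[OF c y, of v w]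
      by (simp add: sum_distrib_left mult.assoc)
  qed
  let ?u = "mderiv M (chart_map c) q u" and ?v = "mderiv M (chart_map c) q v"
  show ?thesis
    using dform_tangent_map[OF chart_inv_smooth_into[OF c] y, of ?u ?v]
    unfolding e[of ?u ?v] e[of ?v ?u] tangent_map_chart_mderiv[OF c q] chart_inv_map[OF c q]
    by (simp add: sum_subtractf left_diff_distrib)
qed

lemma linear_dform_left: "q \<in> points M \<Longrightarrow> linear (\<lambda>u. dform M \<alpha> q u v)"
  and linear_dform_right: "q \<in> points M \<Longrightarrow> linear (\<lambda>v. dform M \<alpha> q u v)"
proof -
  assume q: "q \<in> points M"
  note c = chart_at_atlas[OF q] chart_at_dom[OF q]
  note l = linear_add[OF linear_chart_mderiv[OF c]] linear_cmul[OF linear_chart_mderiv[OF c]]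
  have sum2: "(\<Sum>b\<in>Basis. \<Sum>b'\<in>Basis. A b b' * K b b') / 2 + (\<Sum>b\<in>Basis. \<Sum>b'\<in>Basis. B b b' * K b b') / 2 =
     (\<Sum>b\<in>Basis. \<Sum>b'\<in>Basis. (A b b' + B b b') * K b b') / 2" for A B K :: "'e \<Rightarrow> 'e \<Rightarrow> real"
    by (simp add: distrib_right sum.distrib add_divide_distrib)
  have scale2: "r * ((\<Sum>b\<in>Basis. \<Sum>b'\<in>Basis. A b b' * K b b') / 2) =
     (\<Sum>b\<in>Basis. \<Sum>b'\<in>Basis. (r * A b b') * K b b') / 2" for r and A K :: "'e \<Rightarrow> 'e \<Rightarrow> real"
    by (simp add: sum_distrib_left mult.assoc)
  show "linear (\<lambda>u. dform M \<alpha> q u v)"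
    by (rule linearI; unfold dform_chart[OF c] l real_scaleR_def sum2 scale2) (simp_all add: inner_add_left algebra_simps)
  show "linear (\<lambda>v. dform M \<alpha> q u v)"
    by (rule linearI; unfold dform_chart[OF c] l real_scaleR_def sum2 scale2) (simp_all add: inner_add_left algebra_simps)
qed

lemma dform_skew: "q \<in> points M \<Longrightarrow> dform M \<alpha> q u v = - dform M \<alpha> q v u"
  by (simp add: dform_preferred_chart minus_divide_left)

end

section \<open>Linear algebra of a pseudo-Hermitian manifold\<close>

lemma cscale_add_left: "cscale (a + b) z = cscale a z + cscale b z"
  by (simp add: cscale_def prod_eq_iff algebra_simps)

lemma cscale_cscale: "cscale a (cscale b z) = cscale (a * b) z"
  by (simp add: cscale_def prod_eq_iff algebra_simps)

lemma cscale_add_right: "cscale a (z + w) = cscale a z + cscale a w"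
  by (simp add: cscale_def prod_eq_iff algebra_simps)

lemma cscale_zero [simp]: "cscale a 0 = 0" "cscale 0 z = 0"
  by (simp_all add: cscale_def zero_prod_def)

lemma cscale_sum: "cscale a (\<Sum>i\<in>I. f i) = (\<Sum>i\<in>I. cscale a (f i))"
  by (induction I rule: infinite_finite_induct) (simp_all add: cscale_add_right)

locale pseudo_hermitian_manifold =
  fixes M :: "('a, 'e::euclidean_space) ph_data" and m :: nat
  assumes ph: "pseudo_hermitian m M"

sublocale pseudo_hermitian_manifold \<subseteq> manifold_with_form M "theta M"
  using ph by unfold_locales (auto simp: pseudo_hermitian_def smooth_manifold_def)

context pseudo_hermitian_manifold
begin

lemma T10_subbundle: "complex_subbundle m M (T10 M)"
  and T10_Int_T01: "p \<in> points M \<Longrightarrow> T10 M p \<inter> T01 M p = {0}"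
  using ph by (auto simp: pseudo_hermitian_def cr_structure_def)

lemma kernel_theta: "p \<in> points M \<Longrightarrow> theta M p v = 0 \<longleftrightarrow> v \<in> Hbundle M p"
  and theta_nonzero: "p \<in> points M \<Longrightarrow> \<exists>v. theta M p v \<noteq> 0"
  and levi_pos: "p \<in> points M \<Longrightarrow> v \<in> Hbundle M p \<Longrightarrow> v \<noteq> 0 \<Longrightarrow> levi M p v v > 0"
  using ph by (auto simp: pseudo_hermitian_def)

lemma T10_span:
  assumes "p \<in> points M"
  obtains Z where "T10 M p = {\<Sum>i<m. cscale (c i) (Z i) | c :: nat \<Rightarrow> complex. True}"
  using T10_subbundle assms unfolding complex_subbundle_def by meson

lemma T10_add:
  assumes p: "p \<in> points M" and "Z \<in> T10 M p" "W \<in> T10 M p"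
  shows "Z + W \<in> T10 M p"
proof -
  obtain F where F: "T10 M p = {\<Sum>i<m. cscale (c i) (F i) | c :: nat \<Rightarrow> complex. True}"
    by (rule T10_span[OF p])
  obtain c d where "Z = (\<Sum>i<m. cscale (c i) (F i))" "W = (\<Sum>i<m. cscale (d i) (F i))"
    using assms unfolding F by auto
  then have "Z + W = (\<Sum>i<m. cscale (c i + d i) (F i))" by (simp add: cscale_add_left sum.distrib)
  then show ?thesis unfolding F by (intro CollectI exI[of _ "\<lambda>i. c i + d i"]) simp
qed

lemma T10_cscale:
  assumes p: "p \<in> points M" and "Z \<in> T10 M p"
  shows "cscale a Z \<in> T10 M p"
proof -
  obtain F where F: "T10 M p = {\<Sum>i<m. cscale (c i) (F i) | c :: nat \<Rightarrow> complex. True}"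
    by (rule T10_span[OF p])
  obtain c where "Z = (\<Sum>i<m. cscale (c i) (F i))"
    using assms unfolding F by auto
  then have "cscale a Z = (\<Sum>i<m. cscale (a * c i) (F i))" by (simp add: cscale_sum cscale_cscale)
  then show ?thesis unfolding F by (intro CollectI exI[of _ "\<lambda>i. a * c i"]) simp
qed

text \<open>The difference of two vectors with the same real part is purely imaginary, hence the negative
  of its own conjugate, and therefore lies in \<open>T10 \<inter> T01\<close>.\<close>

lemma T10_fst_unique:
  assumes p: "p \<in> points M" and Z: "Z \<in> T10 M p" "W \<in> T10 M p" "fst Z = fst W"
  shows "Z = W"
proof -
  have "Z + cscale (-1) W \<in> T10 M p" "cscale (-1) (Z + cscale (-1) W) \<in> T10 M p"
    using Z p by (intro T10_add T10_cscale; simp)+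
  moreover have "Z + cscale (-1) W = (0, snd Z - snd W)" "cscale (-1) (Z + cscale (-1) W) = (0, - (snd Z - snd W))"
    using Z(3) by (simp_all add: cscale_def prod_eq_iff)
  ultimately have "(0, snd Z - snd W) \<in> T10 M p" "(0, - (snd Z - snd W)) \<in> T10 M p" by simp_all
  then have "(0, snd Z - snd W) \<in> T10 M p \<inter> T01 M p"
    unfolding T01_def by (auto simp: vconj_def intro!: image_eqI[of _ _ "(0, - (snd Z - snd W))"])
  then show ?thesis unfolding T10_Int_T01[OF p] using Z(3) by (simp add: prod_eq_iff)
qed

lemma Hbundle_eq: "p \<in> points M \<Longrightarrow> Hbundle M p = fst ` T10 M p"
proof (intro equalityI subsetI)
  fix v assume p: "p \<in> points M" and "v \<in> Hbundle M p"
  then obtain Z W where "v = fst (Z + vconj W)" "Z \<in> T10 M p" "W \<in> T10 M p"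
    unfolding Hbundle_def T01_def by blast
  then show "v \<in> fst ` T10 M p" using T10_add[OF p, of Z W] by (auto simp: vconj_def intro: image_eqI[of _ _ "Z + W"])
next
  fix v assume p: "p \<in> points M" and "v \<in> fst ` T10 M p"
  then obtain Z where Z: "Z \<in> T10 M p" "v = fst Z" by auto
  have "cscale 0 Z \<in> T10 M p" by (rule T10_cscale[OF p Z(1)])
  then have "vconj 0 \<in> T01 M p" unfolding T01_def by auto
  then show "v \<in> Hbundle M p" unfolding Hbundle_def using Z
    by (intro CollectI exI[of _ Z] exI[of _ "vconj 0"]) (simp add: vconj_def)
qed

lemma JH_fst:
  assumes p: "p \<in> points M" and Z: "Z \<in> T10 M p"
  shows "JH M p (fst Z) = - snd Z"
  unfolding JH_def
proof (rule the_equality)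
  have "cscale (1/2) Z \<in> T10 M p" by (rule T10_cscale[OF p Z])
  moreover have "cscale (1/2) Z = (fst Z /\<^sub>R 2, snd Z /\<^sub>R 2)" by (simp add: cscale_def)
  ultimately show "\<exists>Z'\<in>T10 M p. (fst Z, 0) = Z' + vconj Z' \<and> (- snd Z, 0) = cscale \<i> (Z' - vconj Z')"
    by (intro bexI[of _ "(fst Z /\<^sub>R 2, snd Z /\<^sub>R 2)"])
      (simp_all add: vconj_def cscale_def flip: scaleR_add_left)
  fix w assume "\<exists>Z'\<in>T10 M p. (fst Z, 0) = Z' + vconj Z' \<and> (w, 0) = cscale \<i> (Z' - vconj Z')"
  then obtain Z' where Z': "Z' \<in> T10 M p" "(fst Z, 0) = Z' + vconj Z'" "(w, 0) = cscale \<i> (Z' - vconj Z')" by blast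
  have "Z = cscale 2 Z'"
    by (rule T10_fst_unique[OF p Z T10_cscale[OF p Z'(1)]])
      (use Z'(2) in \<open>simp add: vconj_def cscale_def prod_eq_iff scaleR_2\<close>)
  then show "w = - snd Z" using Z'(3) by (simp add: vconj_def cscale_def prod_eq_iff scaleR_2)
qed

lemma JH_in_Hbundle:
  assumes p: "p \<in> points M" and v: "v \<in> Hbundle M p"
  shows "JH M p v \<in> Hbundle M p"
proof -
  obtain Z where Z: "Z \<in> T10 M p" "v = fst Z" using v unfolding Hbundle_eq[OF p] by auto
  have "cscale \<i> Z \<in> T10 M p" by (rule T10_cscale[OF p Z(1)])
  moreover have "fst (cscale \<i> Z) = JH M p v" using JH_fst[OF p Z(1)] Z(2) by (simp add: cscale_def)
  ultimately show ?thesis unfolding Hbundle_eq[OF p] by (metis imageI)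
qed

lemma levi_nonneg:
  assumes p: "p \<in> points M" and v: "v \<in> Hbundle M p"
  shows "levi M p v v \<ge> 0"
proof (cases "v = 0")
  case True
  then show ?thesis unfolding levi_def using linear_0[OF linear_dform_left[OF p]] by simp
next
  case False
  then show ?thesis using levi_pos[OF p v] by simp
qed

text \<open>Existence of the Reeb vector: with \<open>T\<close> the skew-symmetric map of \<open>d\<theta>\<close> and \<open>\<tau>\<close> the
  vector of \<open>\<theta>\<close>, the map \<open>v \<mapsto> T v + \<theta>(v) \<tau>\<close> is injective because \<open>d\<theta>\<close> is nondegenerate on \<open>H\<close>,
  hence it hits \<open>\<tau>\<close>.  Pairing the equation with \<open>v\<close> leaves \<open>\<theta>(v) = 0\<close> or \<open>\<theta>(v) = 1\<close>, and the
  former would make \<open>\<tau>\<close> zero.\<close>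

lemma reeb_exists:
  assumes p: "p \<in> points M"
  obtains v where "theta M p v = 1" "\<And>w. dform M (theta M) p v w = 0"
proof -
  let ?d = "dform M (theta M) p"
  define T where "T v = (\<Sum>b\<in>Basis. ?d v b *\<^sub>R b)" for v
  define \<tau> where "\<tau> = (\<Sum>b\<in>Basis. theta M p b *\<^sub>R b)"
  note ll = linear_dform_left[OF p] linear_dform_right[OF p]
  have T: "T v \<bullet> w = ?d v w" for v w
    using linear_basis_expand[OF ll(2), of v w] unfolding T_def by (simp add: inner_sum_left inner_commute[of w] mult.commute)
  have \<tau>: "\<tau> \<bullet> v = theta M p v" for v
    using linear_basis_expand[OF linear_form[OF p], of v] unfolding \<tau>_def
    by (simp add: inner_sum_left inner_commute[of v] mult.commute)
  have dvv: "?d v v = 0" for v using dform_skew[OF p, of v v] by simp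
  have nondeg: "v = 0" if "v \<in> Hbundle M p" "?d v (JH M p v) = 0" for v
    using levi_pos[OF p that(1)] that(2) unfolding levi_def by force
  define S where "S v = T v + theta M p v *\<^sub>R \<tau>" for v
  have "linear S"
    unfolding S_def T_def using linear_add[OF ll(1)] linear_cmul[OF ll(1)] linear_add[OF linear_form[OF p]] linear_cmul[OF linear_form[OF p]]
    by (intro linearI) (simp_all add: scaleR_add_left sum.distrib scaleR_sum_right algebra_simps)
  moreover have "inj S"
  proof (subst linear_injective_0[OF \<open>linear S\<close>], intro allI impI)
    fix v assume v: "S v = 0"
    then have "S v \<bullet> v = 0" by simp
    then have th: "theta M p v = 0" by (simp add: S_def inner_add_left T \<tau> dvv)
    then have "v \<in> Hbundle M p" using kernel_theta[OF p] by simp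
    moreover have "?d v (JH M p v) = 0" using v th T[of v "JH M p v"] by (simp add: S_def)
    ultimately show "v = 0" by (rule nondeg)
  qed
  ultimately have "surj S" using linear_injective_imp_surjective by blast
  then obtain v where v: "S v = \<tau>" by (metis surjD)
  have "theta M p v * theta M p v = theta M p v"
    using arg_cong[OF v, of "\<lambda>x. x \<bullet> v"] by (simp add: S_def inner_add_left T \<tau> dvv)
  then have "theta M p v = 0 \<or> theta M p v = 1" by simp
  moreover have "theta M p v \<noteq> 0"
  proof
    assume th: "theta M p v = 0"
    then have H: "v \<in> Hbundle M p" using kernel_theta[OF p] by simp
    have "?d v (JH M p v) = theta M p (JH M p v)" using v th T[of v] \<tau> by (simp add: S_def)
    also have "\<dots> = 0" using kernel_theta[OF p] JH_in_Hbundle[OF p H] by simp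
    finally have "v = 0" by (rule nondeg[OF H])
    then have "\<tau> = 0" using v th linear_0[OF ll(1)] by (simp add: S_def T_def)
    then show False using theta_nonzero[OF p] \<tau> by auto
  qed
  ultimately have 1: "theta M p v = 1" by simp
  then have "T v = 0" using v by (simp add: S_def)
  then have "?d v w = 0" for w using T[of v w] by simp
  with 1 show thesis by (rule that)
qed

lemma theta_reeb:
  assumes p: "p \<in> points M"
  shows "theta M p (reeb M p) = 1"
proof -
  let ?P = "\<lambda>v. theta M p v = 1 \<and> (\<forall>w. dform M (theta M) p v w = 0)"
  have "\<exists>!v. ?P v"
  proof (rule ex_ex1I)
    show "\<exists>v. ?P v" using reeb_exists[OF p] by metis
    fix v w assume v: "?P v" and w: "?P w"
    have "v - w \<in> Hbundle M p" using v w linear_diff[OF linear_form[OF p]] kernel_theta[OF p] by (metis diff_self)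
    moreover have "levi M p (v - w) (v - w) = 0"
      unfolding levi_def using v w linear_diff[OF linear_dform_left[OF p]] by simp
    ultimately show "v = w" using levi_pos[OF p] by force
  qed
  from theI'[OF this] show ?thesis unfolding reeb_def by blast
qed

lemma projH_in: "p \<in> points M \<Longrightarrow> projH M p v \<in> Hbundle M p"
  unfolding projH_def
  by (subst kernel_theta[symmetric]) (simp_all add: linear_diff[OF linear_form] linear_cmul[OF linear_form] theta_reeb)

lemma linear_webster_left:
  assumes p: "p \<in> points M"
  shows "linear (\<lambda>u. webster M p u v)"
proof (rule linearI)
  note l = linear_add[OF linear_form[OF p]] linear_cmul[OF linear_form[OF p]]
    linear_add[OF linear_dform_left[OF p]] linear_cmul[OF linear_dform_left[OF p]]
  have "projH M p (u + u') = projH M p u + projH M p u'" for u u'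
    by (simp add: projH_def l algebra_simps)
  then show "webster M p (u + u') v = webster M p u v + webster M p u' v" for u u'
    by (simp add: webster_def levi_def l algebra_simps)
  have "projH M p (r *\<^sub>R u) = r *\<^sub>R projH M p u" for r u
    by (simp add: projH_def l algebra_simps)
  then show "webster M p (r *\<^sub>R u) v = r *\<^sub>R webster M p u v" for r u
    by (simp add: webster_def levi_def l algebra_simps)
qed

lemma webster_ge_theta: "p \<in> points M \<Longrightarrow> (theta M p u)\<^sup>2 \<le> webster M p u u"
  unfolding webster_def using levi_nonneg[OF _ projH_in] by (simp add: power2_eq_square)

lemma webster_nonneg: "p \<in> points M \<Longrightarrow> 0 \<le> webster M p u u"
  using webster_ge_theta[of p u] by (meson order_trans zero_le_power2)

lemma webster_Hbundle: "p \<in> points M \<Longrightarrow> u \<in> Hbundle M p \<Longrightarrow> webster M p u u = levi M p u u"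
  by (simp add: webster_def projH_def iffD2[OF kernel_theta])

end

section \<open>A local lower bound for the Levi form\<close>

text \<open>The coefficients with respect to a frame of \<open>m\<close> fields are functions on \<open>nat\<close>, since \<open>m\<close> is a
  number and not a type; their unit sphere is a closed subset of a product of discs.\<close>

lemma compact_coefficient_sphere:
  "compact {\<kappa> :: nat \<Rightarrow> complex. (\<forall>i\<ge>m. \<kappa> i = 0) \<and> (\<Sum>i<m. (cmod (\<kappa> i))\<^sup>2) = 1}" (is "compact ?S")
proof -
  let ?P = "PiE UNIV (\<lambda>i::nat. cball (0::complex) 1)"
  have "compactin (product_topology (\<lambda>i::nat. (euclidean :: complex topology)) UNIV) ?P"
    unfolding compactin_PiE by simp
  then have P: "compact ?P" by (simp add: euclidean_product_topology)
  have c: "continuous_on UNIV (\<lambda>\<kappa> :: nat \<Rightarrow> complex. \<kappa> i)" for i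
    by (rule continuous_on_product_coordinates)
  have "closed ((\<Inter>i\<in>{m..}. {\<kappa> :: nat \<Rightarrow> complex. \<kappa> i = 0}) \<inter> {\<kappa>. (\<Sum>i<m. (cmod (\<kappa> i))\<^sup>2) = 1})"
    by (intro closed_Int closed_INT ballI closed_Collect_eq continuous_intros c)
  moreover have "?S = ?P \<inter> ((\<Inter>i\<in>{m..}. {\<kappa> :: nat \<Rightarrow> complex. \<kappa> i = 0}) \<inter> {\<kappa>. (\<Sum>i<m. (cmod (\<kappa> i))\<^sup>2) = 1})"
  proof -
    have "cmod (\<kappa> i) \<le> 1" if "\<forall>i\<ge>m. \<kappa> i = 0" "(\<Sum>i<m. (cmod (\<kappa> i))\<^sup>2) = 1" for \<kappa> :: "nat \<Rightarrow> complex" and i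
    proof (cases "i < m")
      case True
      then have "(cmod (\<kappa> i))\<^sup>2 \<le> (\<Sum>i<m. (cmod (\<kappa> i))\<^sup>2)" by (intro member_le_sum) auto
      then show ?thesis using that(2) by (simp add: power_le_one_iff abs_square_le_1[of "cmod (\<kappa> i)", simplified])
    qed (use that in auto)
    then show ?thesis by auto
  qed
  ultimately show ?thesis by (simp only: compact_Int_closed[OF P])
qed

context pseudo_hermitian_manifold
begin

text \<open>Near a point the horizontal vectors are \<open>Re (\<Sum> \<kappa>\<^sub>i Z\<^sub>i)\<close> for a smooth frame \<open>Z\<close>, and in a chart
  both the vector and its Levi form depend continuously on the base point and on \<open>\<kappa>\<close>; compactness
  of a ball times the unit sphere of coefficients gives the bound.\<close>

lemma levi_lower_bound:
  assumes p: "p \<in> points M" and c: "c \<in> atlas M" "p \<in> chart_dom c"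
  obtains r C where "r > 0" "C \<ge> 0" "cball (chart_map c p) r \<subseteq> chart_map c ` chart_dom c"
    "\<And>q v. q \<in> chart_dom c \<Longrightarrow> chart_map c q \<in> cball (chart_map c p) r \<Longrightarrow> v \<in> Hbundle M q \<Longrightarrow>
       norm (mderiv M (chart_map c) q v) \<le> C * sqrt (levi M q v v)"
proof -
  have "\<forall>p\<in>points M. \<exists>U Z. openin (mtop M) U \<and> p \<in> U \<and>
     (\<forall>i<m. smooth_cfield_on M U (Z i)) \<and>
     (\<forall>q\<in>U. T10 M q = {\<Sum>i<m. cscale (c i) (Z i q) | c :: nat \<Rightarrow> complex. True} \<and>
        (\<forall>c :: nat \<Rightarrow> complex. (\<Sum>i<m. cscale (c i) (Z i q)) = 0 \<longrightarrow> (\<forall>i<m. c i = 0)))"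
    using T10_subbundle unfolding complex_subbundle_def .
  from bspec[OF this p] obtain U Z where UZ: "openin (mtop M) U \<and> p \<in> U \<and>
     (\<forall>i<m. smooth_cfield_on M U (Z i)) \<and>
     (\<forall>q\<in>U. T10 M q = {\<Sum>i<m. cscale (c i) (Z i q) | c :: nat \<Rightarrow> complex. True} \<and>
        (\<forall>c :: nat \<Rightarrow> complex. (\<Sum>i<m. cscale (c i) (Z i q)) = 0 \<longrightarrow> (\<forall>i<m. c i = 0)))"
    by (elim exE)
  then have U: "openin (mtop M) U" "p \<in> U" by simp_all
  have Zs: "smooth_cfield_on M U (Z i)" if "i < m" for i using UZ that by simp
  have ZT: "T10 M q = {\<Sum>i<m. cscale (\<kappa> i) (Z i q) | \<kappa> :: nat \<Rightarrow> complex. True}" if "q \<in> U" for q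
    using UZ that by simp
  have Zind: "\<kappa> i = 0" if "q \<in> U" "(\<Sum>i<m. cscale (\<kappa> i) (Z i q)) = 0" "i < m" for q \<kappa> i
    using UZ that by simp
  have m: "1 \<le> m" using ph by (simp add: pseudo_hermitian_def)
  let ?inv = "chart_inv c"
  define W where "W = chart_map c ` (U \<inter> chart_dom c)"
  have W: "open W" unfolding W_def by (rule open_chart_image[OF c(1) U(1)])
  have Wd: "W \<subseteq> chart_map c ` chart_dom c" unfolding W_def by auto
  have W_inv: "?inv y \<in> U" "?inv y \<in> chart_dom c" "chart_map c (?inv y) = y" if "y \<in> W" for y
    using that c unfolding W_def by auto
  have "chart_map c p \<in> W" unfolding W_def using U c by auto
  then obtain r where r: "r > 0" "cball (chart_map c p) r \<subseteq> W" using W open_contains_cball by blast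
  let ?B = "cball (chart_map c p) r"
  define X where "X i y = mderiv M (chart_map c) (?inv y) (fst (Z i (?inv y)))" for i y
  define Y where "Y i y = mderiv M (chart_map c) (?inv y) (snd (Z i (?inv y)))" for i y
  define A where "A b b' y = frechet_derivative (\<lambda>y. pullback M (theta M) ?inv y b) (at y) b'" for b b' y
  have field: "continuous_on W (\<lambda>y. mderiv M (chart_map c) (?inv y) (F (?inv y)))" if "smooth_field_on M U F" for F
  proof -
    have "smooth_on ((\<lambda>q. mderiv M (chart_map c) q (F q)) \<circ> ?inv) (chart_map c ` ((U \<inter> chart_dom c) \<inter> chart_dom c))"
      using that c(1) unfolding smooth_field_on_def smooth_fun_on_def by blast
    from smooth_on_continuous_on[OF this] show ?thesis unfolding W_def by (simp add: o_def Int_assoc)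
  qed
  have cX: "continuous_on ?B (X i)" if "i < m" for i
    using continuous_on_subset[OF field[of "fst \<circ> Z i"] r(2)] Zs[OF that]
    unfolding X_def[abs_def] smooth_cfield_on_def by (simp add: o_def)
  have cY: "continuous_on ?B (Y i)" if "i < m" for i
    using continuous_on_subset[OF field[of "snd \<circ> Z i"] r(2)] Zs[OF that]
    unfolding Y_def[abs_def] smooth_cfield_on_def by (simp add: o_def)
  have cA: "continuous_on ?B (A b b')" for b b'
    unfolding A_def[abs_def]
    by (rule continuous_on_subset[OF smooth_on_continuous_on[OF smooth_on_frechet_derivative[OF smooth_pullback_chart[OF c(1)]]]
        subset_trans[OF r(2) Wd]])
  define V where "V y \<kappa> = (\<Sum>i<m. Re (\<kappa> i) *\<^sub>R X i y - Im (\<kappa> i) *\<^sub>R Y i y)" for y and \<kappa> :: "nat \<Rightarrow> complex"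
  define N where "N y \<kappa> = (\<Sum>i<m. Im (\<kappa> i) *\<^sub>R X i y + Re (\<kappa> i) *\<^sub>R Y i y)" for y and \<kappa> :: "nat \<Rightarrow> complex"
  define Q where "Q y \<kappa> = - ((\<Sum>b\<in>Basis. \<Sum>b'\<in>Basis. ((N y \<kappa> \<bullet> b) * (V y \<kappa> \<bullet> b') - (V y \<kappa> \<bullet> b) * (N y \<kappa> \<bullet> b')) * A b b' y) / 2)"
    for y and \<kappa> :: "nat \<Rightarrow> complex"
  let ?Z = "\<lambda>\<kappa> y. \<Sum>i<m. cscale (\<kappa> i) (Z i (?inv y))"
  have lin: "linear (mderiv M (chart_map c) (?inv y))" if "y \<in> W" for y
    by (rule linear_chart_mderiv[OF c(1) W_inv(2)[OF that]])
  have V: "mderiv M (chart_map c) (?inv y) (fst (?Z \<kappa> y)) = V y \<kappa>" if "y \<in> W" for y \<kappa>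
    unfolding V_def X_def Y_def
    by (simp add: fst_sum cscale_def linear_sum[OF lin[OF that]] linear_diff[OF lin[OF that]] linear_cmul[OF lin[OF that]])
  have N: "mderiv M (chart_map c) (?inv y) (snd (?Z \<kappa> y)) = N y \<kappa>" if "y \<in> W" for y \<kappa>
    unfolding N_def X_def Y_def
    by (simp add: snd_sum cscale_def linear_sum[OF lin[OF that]] linear_add[OF lin[OF that]] linear_cmul[OF lin[OF that]])
  have ZT': "?Z \<kappa> y \<in> T10 M (?inv y)" if "y \<in> W" for y \<kappa>
    unfolding ZT[OF W_inv(1)[OF that]] by blast
  have pts: "?inv y \<in> points M" if "y \<in> W" for y
    by (rule chart_in_points[OF c(1) W_inv(2)[OF that]])
  have Q: "levi M (?inv y) (fst (?Z \<kappa> y)) (fst (?Z \<kappa> y)) = Q y \<kappa>" if y: "y \<in> W" for y \<kappa>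
  proof -
    \<comment> \<open>For \<open>Z\<close> in \<open>T10\<close> one has \<open>J (Re Z) = - Im Z\<close>.\<close>
    have "levi M (?inv y) (fst (?Z \<kappa> y)) (fst (?Z \<kappa> y)) = - dform M (theta M) (?inv y) (fst (?Z \<kappa> y)) (snd (?Z \<kappa> y))"
      unfolding levi_def JH_fst[OF pts[OF y] ZT'[OF y]] by (rule linear_neg[OF linear_dform_right[OF pts[OF y]]])
    then show ?thesis
      unfolding dform_chart[OF c(1) W_inv(2)[OF y]] V[OF y] N[OF y] W_inv(3)[OF y] Q_def A_def .
  qed
  define S where "S = {\<kappa> :: nat \<Rightarrow> complex. (\<forall>i\<ge>m. \<kappa> i = 0) \<and> (\<Sum>i<m. (cmod (\<kappa> i))\<^sup>2) = 1}"
  have K: "compact (?B \<times> S)" unfolding S_def by (intro compact_Times compact_cball compact_coefficient_sphere)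
  have "(\<lambda>i. if i = 0 then 1 else 0) \<in> S"
    unfolding S_def using m by (auto simp: if_distrib[of cmod] if_distrib[of "\<lambda>x. x\<^sup>2"] cong: if_cong)
  then have ne: "?B \<times> S \<noteq> {}" using r(1) by auto
  have c\<kappa>: "continuous_on (?B \<times> S) (\<lambda>z. snd z i)" for i
    by (rule continuous_on_compose2[OF continuous_on_product_coordinates continuous_on_snd[OF continuous_on_id]]) auto
  have c1: "continuous_on (?B \<times> S) (\<lambda>z. f (fst z))" if "continuous_on ?B f" for f :: "'e \<Rightarrow> 'g::topological_space"
    by (rule continuous_on_compose2[OF that continuous_on_fst[OF continuous_on_id]]) auto
  have cV: "continuous_on (?B \<times> S) (\<lambda>z. V (fst z) (snd z))"
    unfolding V_def by (intro continuous_intros c\<kappa> c1 cX cY) auto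
  have cN: "continuous_on (?B \<times> S) (\<lambda>z. N (fst z) (snd z))"
    unfolding N_def by (intro continuous_intros c\<kappa> c1 cX cY) auto
  have cQ: "continuous_on (?B \<times> S) (\<lambda>z. Q (fst z) (snd z))"
    unfolding Q_def by (intro continuous_intros cV cN c1 cA) auto
  obtain z0 where z0: "z0 \<in> ?B \<times> S" "\<And>z. z \<in> ?B \<times> S \<Longrightarrow> Q (fst z0) (snd z0) \<le> Q (fst z) (snd z)"
    using continuous_attains_inf[OF K ne cQ] by blast
  obtain z1 where z1: "z1 \<in> ?B \<times> S" "\<And>z. z \<in> ?B \<times> S \<Longrightarrow> norm (V (fst z) (snd z)) \<le> norm (V (fst z1) (snd z1))"
    using continuous_attains_sup[OF K ne continuous_on_norm[OF cV]] by blast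
  let ?\<delta> = "Q (fst z0) (snd z0)" and ?K = "norm (V (fst z1) (snd z1))"
  have \<delta>: "?\<delta> > 0"
  proof -
    have y: "fst z0 \<in> W" using z0(1) r(2) by (auto simp: mem_Times_iff)
    have \<kappa>: "snd z0 \<in> S" using z0(1) by (simp add: mem_Times_iff)
    have nz: "fst (?Z (snd z0) (fst z0)) \<noteq> 0"
    proof
      assume "fst (?Z (snd z0) (fst z0)) = 0"
      moreover have "0 \<in> T10 M (?inv (fst z0))" using T10_cscale[OF pts[OF y] ZT'[OF y], of 0] by simp
      ultimately have "?Z (snd z0) (fst z0) = 0"
        using T10_fst_unique[OF pts[OF y] ZT'[OF y]] by simp
      then have "snd z0 i = 0" if "i < m" for i using Zind[OF W_inv(1)[OF y]] that by blast
      then have "(\<Sum>i<m. (cmod (snd z0 i))\<^sup>2) = 0" by simp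
      then show False using \<kappa> by (simp add: S_def)
    qed
    have H: "fst (?Z (snd z0) (fst z0)) \<in> Hbundle M (?inv (fst z0))"
      unfolding Hbundle_eq[OF pts[OF y]] by (rule imageI[OF ZT'[OF y]])
    show ?thesis using levi_pos[OF pts[OF y] H nz] unfolding Q[OF y] .
  qed
  have main: "norm (mderiv M (chart_map c) q v) \<le> ?K / sqrt ?\<delta> * sqrt (levi M q v v)"
    if q: "q \<in> chart_dom c" "chart_map c q \<in> ?B" and v: "v \<in> Hbundle M q" for q v
  proof -
    let ?y = "chart_map c q"
    have y: "?y \<in> W" using q r(2) by auto
    have iq: "?inv ?y = q" using q c by simp
    have "v \<in> fst ` T10 M q" using v Hbundle_eq[OF pts[OF y]] iq by simp
    then obtain Z' where Z': "v = fst Z'" "Z' \<in> T10 M q" by (elim imageE)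
    from Z'(2) obtain \<kappa>' where "Z' = ?Z \<kappa>' ?y"
      unfolding ZT[OF W_inv(1)[OF y], unfolded iq] iq by (elim CollectE exE conjE)
    with Z'(1) have \<kappa>': "v = fst (?Z \<kappa>' ?y)" by (simp only:)
    define \<kappa> where "\<kappa> i = (if i < m then \<kappa>' i else 0)" for i
    have "?Z \<kappa>' ?y = ?Z \<kappa> ?y" unfolding \<kappa>_def by (intro sum.cong) auto
    with \<kappa>' have \<kappa>: "v = fst (?Z \<kappa> ?y)" by simp
    have mv: "mderiv M (chart_map c) q v = V ?y \<kappa>" using V[OF y, of \<kappa>] unfolding \<kappa> iq .
    have lv: "levi M q v v = Q ?y \<kappa>" using Q[OF y, of \<kappa>] unfolding \<kappa> iq .
    define n where "n = sqrt (\<Sum>i<m. (cmod (\<kappa> i))\<^sup>2)"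
    show ?thesis
    proof (cases "n = 0")
      case True
      then have "\<kappa> i = 0" for i
        by (cases "i < m") (auto simp: n_def sum_nonneg_eq_0_iff \<kappa>_def)
      then have "V ?y \<kappa> = 0" unfolding V_def by simp
      then show ?thesis using \<delta> levi_nonneg[OF pts[OF y]] v unfolding mv iq by simp
    next
      case False
      then have n: "n > 0" unfolding n_def using real_sqrt_ge_zero[OF sum_nonneg[of "{..<m}" "\<lambda>i. (cmod (\<kappa> i))\<^sup>2"]] by simp
      define \<mu> where "\<mu> i = \<kappa> i / complex_of_real n" for i
      have \<kappa>\<mu>: "Re (\<kappa> i) = n * Re (\<mu> i)" "Im (\<kappa> i) = n * Im (\<mu> i)" for i
        using n by (simp_all add: \<mu>_def)
      have "(\<Sum>i<m. (cmod (\<mu> i))\<^sup>2) = (\<Sum>i<m. (cmod (\<kappa> i))\<^sup>2) / n\<^sup>2"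
        using n by (simp add: \<mu>_def norm_divide power_divide sum_divide_distrib)
      also have "n\<^sup>2 = (\<Sum>i<m. (cmod (\<kappa> i))\<^sup>2)" unfolding n_def by (simp add: sum_nonneg)
      finally have "(\<Sum>i<m. (cmod (\<mu> i))\<^sup>2) = 1"
        using n by (simp add: n_def)
      then have \<mu>: "(?y, \<mu>) \<in> ?B \<times> S" using q by (auto simp: S_def \<mu>_def \<kappa>_def)
      have V\<mu>: "V ?y \<kappa> = n *\<^sub>R V ?y \<mu>" "N ?y \<kappa> = n *\<^sub>R N ?y \<mu>"
        unfolding V_def N_def \<kappa>\<mu> by (simp_all add: scaleR_sum_right scaleR_diff_right scaleR_add_right)
      have Q\<mu>: "Q ?y \<kappa> = n\<^sup>2 * Q ?y \<mu>"
        unfolding Q_def V\<mu> by (simp add: sum_distrib_left power2_eq_square algebra_simps)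
      have "norm (V ?y \<kappa>) \<le> n * ?K" using n z1(2)[OF \<mu>] by (simp add: V\<mu>)
      also have "\<dots> = ?K / sqrt ?\<delta> * (n * sqrt ?\<delta>)" using \<delta> by simp
      also have "\<dots> \<le> ?K / sqrt ?\<delta> * (n * sqrt (Q ?y \<mu>))"
        using n z0(2)[OF \<mu>] \<delta> by (intro mult_left_mono) auto
      also have "n * sqrt (Q ?y \<mu>) = sqrt (Q ?y \<kappa>)" unfolding Q\<mu> using n by (simp add: real_sqrt_mult)
      finally show ?thesis unfolding mv lv .
    qed
  qed
  show thesis
    by (rule that[OF r(1) _ _ main]) (use r(2) Wd \<delta> in auto)
qed

end

section \<open>Dilatation bounds the conformal factor\<close>

text \<open>Here \<open>L\<close> is an isometry from the metric of the domain to the standard inner product, so the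
  vectors \<open>x b\<close> are one more orthonormal basis besides the eigenbasis.  The form \<open>h (B v) (B v)\<close> is
  diagonal in the eigenbasis with entries \<open>lam\<close>: its value on a unit vector is at most the largest
  eigenvalue, and its trace in any orthonormal basis is the sum of all eigenvalues.\<close>

lemma dilatation_trace_bound:
  fixes L :: "'d::euclidean_space \<Rightarrow> 'd" and B :: "'d \<Rightarrow> 'f::euclidean_space"
  assumes dil: "gen_dilatation_le (\<lambda>u v. L u \<bullet> L v) h B \<Lambda>"
    and L: "linear L" "\<And>b. L (x b) = b"
    and B: "linear B" and h: "\<And>v. linear (\<lambda>u. h u v)" "\<And>u. h u u \<ge> 0"
    and w: "norm (L w) = 1"
  shows "h (B w) (B w) \<le> \<Lambda>\<^sup>2 * ((\<Sum>b\<in>Basis. h (B (x b)) (B (x b))) - h (B w) (B w))"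
proof -
  let ?n = "DIM('d)"
  obtain Bt e lam where "(\<forall>v w. L (Bt w) \<bullet> L v = h w (B v)) \<and>
     (\<forall>i<?n. \<forall>j<?n. L (e i) \<bullet> L (e j) = (if i = j then 1 else 0)) \<and>
     (\<forall>i<?n. Bt (B (e i)) = lam i *\<^sub>R e i) \<and>
     (\<forall>i j. i \<le> j \<and> j < ?n \<longrightarrow> lam j \<le> lam i) \<and>
     lam 0 \<le> \<Lambda>\<^sup>2 * (\<Sum>k=1..<?n. lam k)"
    using dil unfolding gen_dilatation_le_def by (elim exE)
  then have adj: "\<And>v w. L (Bt w) \<bullet> L v = h w (B v)"
    and e: "\<And>i j. i < ?n \<Longrightarrow> j < ?n \<Longrightarrow> L (e i) \<bullet> L (e j) = (if i = j then 1 else 0)"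
    and eig: "\<And>i. i < ?n \<Longrightarrow> Bt (B (e i)) = lam i *\<^sub>R e i"
    and mono: "\<And>i j. i \<le> j \<Longrightarrow> j < ?n \<Longrightarrow> lam j \<le> lam i"
    and bound: "lam 0 \<le> \<Lambda>\<^sup>2 * (\<Sum>k=1..<?n. lam k)"
    by simp_all
  have injL: "inj L" using L by (metis linear_surjective_imp_injective surjI)
  let ?E = "(\<lambda>i. L (e i)) ` {..<?n}"
  have inj: "inj_on (\<lambda>i. L (e i)) {..<?n}"
    using e by (intro inj_onI) (metis lessThan_iff zero_neq_one)
  have orth: "pairwise orthogonal ?E"
    unfolding pairwise_def orthogonal_def using e by auto
  have nrm: "\<And>v. v \<in> ?E \<Longrightarrow> norm v = 1" using e by (auto simp: norm_eq_1)
  have "0 \<notin> ?E" using nrm norm_zero zero_neq_one by metis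
  then have "independent ?E" by (rule pairwise_orthogonal_independent[OF orth])
  moreover have "card ?E = ?n" using card_image[OF inj] by simp
  ultimately have span: "span ?E = UNIV"
    using card_eq_dim[of ?E UNIV] by auto
  have expand: "(\<Sum>i<?n. (L (e i) \<bullet> v) *\<^sub>R L (e i)) = v" for v
    using orthonormal_basis_expand[of ?E v] orth nrm span
    by (simp add: sum.reindex[OF inj] inner_commute)
  have parseval: "(\<Sum>i<?n. (L (e i) \<bullet> v)\<^sup>2) = v \<bullet> v" for v
    using arg_cong[OF expand[of v], of "\<lambda>u. u \<bullet> v"] by (simp add: inner_sum_left power2_eq_square)
  have diag: "h (B v) (B v) = (\<Sum>i<?n. lam i * (L (e i) \<bullet> L v)\<^sup>2)" for v
  proof -
    have "L (\<Sum>i<?n. (L (e i) \<bullet> L v) *\<^sub>R e i) = L v"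
      using expand[of "L v"] by (simp add: linear_sum[OF L(1)] linear_cmul[OF L(1)])
    then have v: "v = (\<Sum>i<?n. (L (e i) \<bullet> L v) *\<^sub>R e i)" using injL by (simp add: inj_eq)
    have he: "h (B (e i)) (B v) = lam i * (L (e i) \<bullet> L v)" if "i < ?n" for i
      unfolding adj[symmetric] eig[OF that] linear_cmul[OF L(1)] by simp
    have "B v = (\<Sum>i<?n. (L (e i) \<bullet> L v) *\<^sub>R B (e i))"
      using arg_cong[OF v, of B] by (simp add: linear_sum[OF B] linear_cmul[OF B])
    then have "h (B v) y = (\<Sum>i<?n. (L (e i) \<bullet> L v) * h (B (e i)) y)" for y
      by (simp add: linear_sum[OF h(1)] linear_cmul[OF h(1)])
    then have "h (B v) (B v) = (\<Sum>i<?n. (L (e i) \<bullet> L v) * h (B (e i)) (B v))" .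
    also have "\<dots> = (\<Sum>i<?n. lam i * (L (e i) \<bullet> L v)\<^sup>2)"
      by (intro sum.cong) (simp_all add: he power2_eq_square)
    finally show ?thesis .
  qed
  have "h (B w) (B w) \<le> (\<Sum>i<?n. lam 0 * (L (e i) \<bullet> L w)\<^sup>2)"
    unfolding diag by (intro sum_mono mult_right_mono mono) auto
  also have "\<dots> = lam 0" unfolding sum_distrib_left[symmetric] parseval using w by (simp add: norm_eq_1)
  finally have le: "h (B w) (B w) \<le> lam 0" .
  have "(\<Sum>b\<in>Basis. h (B (x b)) (B (x b))) = (\<Sum>i<?n. \<Sum>b\<in>Basis. lam i * (L (e i) \<bullet> b)\<^sup>2)"
    unfolding diag L(2) by (rule sum.swap)
  also have "\<dots> = (\<Sum>i<?n. lam i)"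
  proof (rule sum.cong[OF refl])
    fix i assume "i \<in> {..<?n}"
    then have "(\<Sum>b\<in>Basis. (L (e i) \<bullet> b)\<^sup>2) = 1"
      using e[of i i] euclidean_inner[of "L (e i)" "L (e i)"] by (simp add: power2_eq_square)
    then show "(\<Sum>b\<in>Basis. lam i * (L (e i) \<bullet> b)\<^sup>2) = lam i" by (simp flip: sum_distrib_left)
  qed
  also have "\<dots> = lam 0 + (\<Sum>k=1..<?n. lam k)"
    using sum.atLeast_Suc_lessThan[of 0 ?n lam] by (simp add: lessThan_atLeast0)
  finally have "(\<Sum>k=1..<?n. lam k) = (\<Sum>b\<in>Basis. h (B (x b)) (B (x b))) - lam 0" by simp
  then have "lam 0 \<le> \<Lambda>\<^sup>2 * ((\<Sum>b\<in>Basis. h (B (x b)) (B (x b))) - lam 0)" using bound by simp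
  also have "\<dots> \<le> \<Lambda>\<^sup>2 * ((\<Sum>b\<in>Basis. h (B (x b)) (B (x b))) - h (B w) (B w))"
    using le by (intro mult_left_mono) auto
  finally show ?thesis using le by linarith
qed

lemma points_D3 [simp]: "points D3 = D3_pts"
  by (simp add: D3_def)

lemma theta_D3: "theta D3 x v = snd v + alphaB (fst x) (fst v)"
  by (simp add: D3_def)

lemma hlift_in_Hbundle: "hlift z w \<in> Hbundle D3 (z,t)"
  by (simp add: Hbundle_D3 theta_D3 hlift_def)

lemma projH_D3: "cmod z < 1 \<Longrightarrow> projH D3 (z,t) v = hlift z (fst v)"
  by (simp add: projH_def reeb_D3 theta_D3 hlift_def prod_eq_iff)

lemma webster_D3: "cmod z < 1 \<Longrightarrow>
  webster D3 (z,t) u v = poincare_metric z (fst u) (fst v) + theta D3 (z,t) u * theta D3 (z,t) v"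
  by (simp add: webster_def projH_D3 levi_D3)

context pseudo_hermitian_manifold
begin

lemma cr_map_smooth_into: "cr_map D3 M f \<Longrightarrow> smooth_into M D3_pts f"
proof -
  assume "cr_map D3 M f"
  then have f: "continuous_map (mtop D3) (mtop M) f"
    and s: "\<And>c. c \<in> atlas M \<Longrightarrow> smooth_fun_on D3 {x \<in> points D3. f x \<in> chart_dom c} (chart_map c \<circ> f)"
    by (simp_all add: cr_map_def smooth_map_def)
  have "f ` D3_pts \<subseteq> points M" using continuous_map_image_subset_topspace[OF f] by simp
  moreover have op: "open {x\<in>D3_pts. f x \<in> chart_dom c}" if c: "c \<in> atlas M" for c
  proof -
    have "openin (mtop D3) {x \<in> topspace (mtop D3). f x \<in> chart_dom c}"
      using f chart_dom_openin[OF c] by (simp add: continuous_map_def)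
    then have "openin (top_of_set D3_pts) {x\<in>D3_pts. f x \<in> chart_dom c}" by (simp add: D3_def)
    then show ?thesis using open_D3_pts openin_open_trans by blast
  qed
  moreover have "smooth_on (chart_map c \<circ> f) {x\<in>D3_pts. f x \<in> chart_dom c}" if c: "c \<in> atlas M" for c
  proof -
    have "(D3_pts, \<lambda>x. x) \<in> atlas D3" by (simp add: D3_def)
    with s[OF c] have "smooth_on ((chart_map c \<circ> f) \<circ> chart_inv (D3_pts, \<lambda>x. x))
        (chart_map (D3_pts, \<lambda>x. x) ` ({x\<in>D3_pts. f x \<in> chart_dom c} \<inter> chart_dom (D3_pts, \<lambda>x. x)))"
      unfolding smooth_fun_on_def by fastforce
    moreover have "chart_map (D3_pts, \<lambda>x. x) ` ({x\<in>D3_pts. f x \<in> chart_dom c} \<inter> chart_dom (D3_pts, \<lambda>x. x))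
        = {x\<in>D3_pts. f x \<in> chart_dom c}" by auto
    ultimately have "smooth_on ((chart_map c \<circ> f) \<circ> chart_inv (D3_pts, \<lambda>x. x)) {x\<in>D3_pts. f x \<in> chart_dom c}"
      by simp
    then show ?thesis
      by (rule smooth_on_cong[OF op[OF c]]) (simp add: chart_inv_D3 del: mem_Times_iff)
  qed
  ultimately show ?thesis unfolding smooth_into_def using open_D3_pts by blast
qed

lemma mdiff_D3:
  assumes "smooth_into M D3_pts f" "x \<in> D3_pts"
  shows "mdiff D3 M f x v = tangent_map M f x v"
  unfolding mdiff_def tangent_map_def
  using smooth_into_points[OF assms]
  by (intro mderiv_D3[OF assms(2)] smooth_into_has_derivative[OF assms] chart_at_atlas chart_at_dom)

lemma cr_map_tangent_map:
  assumes f: "cr_map D3 M f" and x: "x \<in> D3_pts" and u: "u \<in> Hbundle D3 x"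
  shows "tangent_map M f x u \<in> Hbundle M (f x)"
    and "tangent_map M f x (JH D3 x u) = JH M (f x) (tangent_map M f x u)"
proof -
  have "\<forall>p\<in>D3_pts. \<forall>u\<in>Hbundle D3 p. mdiff D3 M f p u \<in> Hbundle M (f p) \<and>
      mdiff D3 M f p (JH D3 p u) = JH M (f p) (mdiff D3 M f p u)"
    using f unfolding cr_map_def points_D3 by blast
  from bspec[OF bspec[OF this x] u]
  show "tangent_map M f x u \<in> Hbundle M (f x)"
    "tangent_map M f x (JH D3 x u) = JH M (f x) (tangent_map M f x u)"
    unfolding mdiff_D3[OF cr_map_smooth_into[OF f] x] by blast+
qed

text \<open>The horizontal part \<open>w - \<theta>(w) \<xi>\<close> of \<open>w\<close> is mapped to a horizontal vector, so only the Reeb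
  component contributes.\<close>

lemma cr_map_pullback_theta:
  assumes f: "cr_map D3 M f" and x: "x \<in> D3_pts"
  shows "pullback M (theta M) f x w = pullback M (theta M) f x (0,1) * theta D3 x w"
proof -
  note s = cr_map_smooth_into[OF f]
  let ?h = "w - theta D3 x w *\<^sub>R (0,1)"
  have "theta D3 x ?h = 0" by (simp add: theta_D3)
  then have "?h \<in> Hbundle D3 x" using Hbundle_D3[of "fst x" "snd x"] by simp
  then have "tangent_map M f x ?h \<in> Hbundle M (f x)" by (rule cr_map_tangent_map[OF f x])
  then have "pullback M (theta M) f x ?h = 0"
    unfolding pullback_def using kernel_theta[OF smooth_into_points[OF s x]] by simp
  then show ?thesis
    by (simp only: linear_diff[OF linear_pullback[OF s x]] linear_cmul[OF linear_pullback[OF s x]]) simp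
qed

text \<open>By naturality the left side is \<open>d (u \<theta>) = du \<and> \<theta> + u d\<theta>\<close>, and the first term vanishes on \<open>H\<close>.\<close>

lemma cr_map_pullback_dtheta:
  assumes f: "cr_map D3 M f" and x: "x \<in> D3_pts" and v: "v \<in> Hbundle D3 x" and w: "w \<in> Hbundle D3 x"
  shows "dform M (theta M) (f x) (tangent_map M f x v) (tangent_map M f x w) =
    pullback M (theta M) f x (0,1) * dform D3 (theta D3) x v w"
proof -
  note s = cr_map_smooth_into[OF f]
  obtain z t where xz: "x = (z,t)" by (cases x)
  have z: "cmod z < 1" using x xz by simp
  define u where "u x = pullback M (theta M) f x (0,1)" for x
  have p: "f x \<in> points M" by (rule smooth_into_points[OF s x])
  obtain u' where u': "(u has_derivative u') (at x)"
    using pullback_has_derivative[OF s x chart_at_atlas[OF p] chart_at_dom[OF p], of "(0,1)"] unfolding u_def by blast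
  have D: "frechet_derivative (\<lambda>x. pullback M (theta M) f x b) (at x) a =
     u x * (4 * Im (cnj (fst a) * fst b) / (1 - (cmod z)\<^sup>2) + 4 * Im (cnj z * fst b) * (2 * (z \<bullet> fst a)) / (1 - (cmod z)\<^sup>2)\<^sup>2)"
    if b: "b \<in> Hbundle D3 x" for a b
  proof -
    have th: "snd b + alphaB (fst x) (fst b) = 0" using b Hbundle_D3[of z t] unfolding xz by (simp add: theta_D3)
    have "((\<lambda>x. u x * (snd b + alphaB (fst x) (fst b))) has_derivative
      (\<lambda>a. u x * (4 * Im (cnj (fst a) * fst b) / (1 - (cmod z)\<^sup>2) + 4 * Im (cnj z * fst b) * (2 * (z \<bullet> fst a)) / (1 - (cmod z)\<^sup>2)\<^sup>2)
        + u' a * (snd b + alphaB (fst x) (fst b)))) (at x)"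
      by (rule has_derivative_mult[OF u'])
        (rule has_derivative_eq_rhs[OF has_derivative_add[OF has_derivative_const alphaB_deriv[OF z, of "fst b" t, folded xz]]], simp)
    then have "((\<lambda>x. pullback M (theta M) f x b) has_derivative
      (\<lambda>a. u x * (4 * Im (cnj (fst a) * fst b) / (1 - (cmod z)\<^sup>2) + 4 * Im (cnj z * fst b) * (2 * (z \<bullet> fst a)) / (1 - (cmod z)\<^sup>2)\<^sup>2)
        + u' a * (snd b + alphaB (fst x) (fst b)))) (at x)"
      by (rule has_derivative_transform_within_open[OF _ open_D3_pts x])
        (simp only: cr_map_pullback_theta[OF f, of _ b] u_def theta_D3)
    from frechet_derivative_eq[OF this] show ?thesis unfolding th by simp
  qed
  have n: "1 - (cmod z)\<^sup>2 \<noteq> 0" using z by (simp add: abs_square_eq_1)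
  have key: "(k * (A / d + B / d\<^sup>2) - k * (A' / d + B' / d\<^sup>2)) / 2 = k * (C / d\<^sup>2)"
    if "d \<noteq> 0" "A * d + B - A' * d - B' = 2 * C" for A B A' B' C d k :: real
  proof -
    have "A / d + B / d\<^sup>2 - (A' / d + B' / d\<^sup>2) = 2 * (C / d\<^sup>2)"
      using that by (simp add: divide_simps power2_eq_square)
    then have "k * (A / d + B / d\<^sup>2) - k * (A' / d + B' / d\<^sup>2) = k * (2 * (C / d\<^sup>2))"
      by (simp only: right_diff_distrib[symmetric])
    then show ?thesis by simp
  qed
  show ?thesis
    unfolding dform_tangent_map[OF s x] D[OF v] D[OF w] u_def[symmetric]
    unfolding xz dtheta_D3[OF z]
    by (rule key[OF n]) (simp add: inner_complex_def cmod_power2, algebra)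
qed

lemma cr_map_levi:
  assumes f: "cr_map D3 M f" and z: "cmod z < 1"
  shows "levi M (f (z,t)) (tangent_map M f (z,t) (hlift z w)) (tangent_map M f (z,t) (hlift z w)) =
    pullback M (theta M) f (z,t) (0,1) * poincare_metric z w w"
proof -
  have x: "(z,t) \<in> D3_pts" using z by simp
  note s = cr_map_smooth_into[OF f]
  have "JH M (f (z,t)) (tangent_map M f (z,t) (hlift z w)) = tangent_map M f (z,t) (JH D3 (z,t) (hlift z w))"
    using cr_map_tangent_map(2)[OF f x hlift_in_Hbundle] by simp
  then show ?thesis
    unfolding levi_def JH_D3 using cr_map_pullback_dtheta[OF f x hlift_in_Hbundle[of z w] hlift_in_Hbundle[of z "\<i> * w"]]
      levi_D3[OF z, of t w w] by (simp add: levi_def JH_D3)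
qed

text \<open>The conformal factor \<open>u\<close> satisfies \<open>u\<^sup>2 \<le> \<bar>df \<xi>\<bar>\<^sup>2\<close>, and the dilatation bound controls
  \<open>\<bar>df \<xi>\<bar>\<^sup>2\<close> by \<open>\<Lambda>\<^sup>2\<close> times the trace over \<open>H\<close>, which is \<open>2 u\<close> since \<open>f\<close> multiplies the Levi form
  by \<open>u\<close>.\<close>

lemma conformal_factor_bound:
  assumes f: "cr_map D3 M f" and dil: "bounded_gen_dilatation D3 M f \<Lambda>" and z: "cmod z < 1"
  shows "pullback M (theta M) f (z,t) (0,1) \<le> 2 * \<Lambda>\<^sup>2"
proof -
  have x: "(z,t) \<in> D3_pts" using z by simp
  note s = cr_map_smooth_into[OF f]
  have p: "f (z,t) \<in> points M" by (rule smooth_into_points[OF s x])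
  let ?B = "tangent_map M f (z,t)" and ?h = "webster M (f (z,t))"
  define u where "u = pullback M (theta M) f (z,t) (0,1)"
  define d where "d = 1 - (cmod z)\<^sup>2"
  have d: "d > 0" using z unfolding d_def by (simp add: power_less_one_iff)
  \<comment> \<open>Orthonormal coordinates for the Webster metric of \<open>D3\<close>, and the basis that they belong to.\<close>
  define L where "L v = ((2 / d) *\<^sub>R fst v, theta D3 (z,t) v)" for v
  define e where "e b = hlift z ((d / 2) *\<^sub>R fst b) + (0, snd b)" for b :: "complex \<times> real"
  have L: "linear L"
    unfolding L_def by (rule linearI) (simp_all add: theta_D3 alphaB_add alphaB_scaleR algebra_simps)
  have Le: "L (e b) = b" for b
    using d by (simp add: L_def e_def hlift_def theta_D3 prod_eq_iff)
  have g: "webster D3 (z,t) = (\<lambda>u v. L u \<bullet> L v)"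
    by (intro ext) (simp add: webster_D3[OF z] L_def poincare_metric_def d_def power2_eq_square)
  have B: "mdiff D3 M f (z,t) = ?B" using mdiff_D3[OF s x] by blast
  have "gen_dilatation_le (webster D3 (z,t)) ?h (mdiff D3 M f (z,t)) \<Lambda>"
    using dil x unfolding bounded_gen_dilatation_def points_D3 by (rule bspec)
  then have dil': "gen_dilatation_le (\<lambda>u v. L u \<bullet> L v) ?h ?B \<Lambda>"
    unfolding g B .
  have hH: "?h (?B (hlift z w)) (?B (hlift z w)) = u * poincare_metric z w w" for w
    unfolding u_def webster_Hbundle[OF p cr_map_tangent_map(1)[OF f x hlift_in_Hbundle]] by (rule cr_map_levi[OF f z])
  have pm: "poincare_metric z ((d / 2) *\<^sub>R w) ((d / 2) *\<^sub>R w) = w \<bullet> w" for w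
    using d unfolding poincare_metric_def d_def[symmetric] by (simp add: power2_eq_square)
  have e3: "e (1,0) = hlift z ((d / 2) *\<^sub>R 1)" "e (\<i>,0) = hlift z ((d / 2) *\<^sub>R \<i>)" "e (0,1) = (0,1)"
    by (simp_all add: e_def hlift_def zero_prod_def[symmetric] alphaB_def)
  have basis: "(\<Sum>b\<in>Basis. F b) = F (1,0) + F (\<i>,0) + F (0,1)" for F :: "complex \<times> real \<Rightarrow> real"
    by (simp add: Basis_prod_def sum.union_disjoint Basis_complex_def image_Un disjoint_iff prod_eq_iff complex_eq_iff)
  have "?h (?B (0,1)) (?B (0,1)) \<le> \<Lambda>\<^sup>2 * ((\<Sum>b\<in>Basis. ?h (?B (e b)) (?B (e b))) - ?h (?B (0,1)) (?B (0,1)))"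
    by (rule dilatation_trace_bound[OF dil' L Le linear_tangent_map[OF s x] linear_webster_left[OF p] webster_nonneg[OF p]])
      (simp add: L_def theta_D3 alphaB_def)
  also have "(\<Sum>b\<in>Basis. ?h (?B (e b)) (?B (e b))) - ?h (?B (0,1)) (?B (0,1)) = 2 * u"
    unfolding basis e3 hH pm by (simp add: inner_complex_def)
  finally have "?h (?B (0,1)) (?B (0,1)) \<le> 2 * \<Lambda>\<^sup>2 * u" by simp
  moreover have "u\<^sup>2 \<le> ?h (?B (0,1)) (?B (0,1))"
    using webster_ge_theta[OF p, of "?B (0,1)"] by (simp add: u_def pullback_def)
  ultimately have uu: "u * u \<le> 2 * \<Lambda>\<^sup>2 * u" by (simp add: power2_eq_square)
  show ?thesis
  proof (cases "u > 0")
    case True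
    then show ?thesis using uu mult_le_cancel_right_pos[OF True] unfolding u_def by blast
  next
    case False
    then show ?thesis unfolding u_def[symmetric] by (meson linorder_not_le order_trans mult_nonneg_nonneg zero_le_numeral zero_le_power2)
  qed
qed

end

section \<open>A function separating two points\<close>

lemma positive_part_square_derivative:
  "((\<lambda>s::real. (max 0 s)\<^sup>2) has_real_derivative 2 * max 0 s) (at s)"
proof (cases s "0::real" rule: linorder_cases)
  case less
  have "((\<lambda>s::real. 0) has_real_derivative 2 * max 0 s) (at s)" using less by simp
  then show ?thesis
    by (rule has_field_derivative_transform_within_open[of _ _ _ "{..<0}"]) (use less in auto)
next
  case greater
  have "((\<lambda>s::real. s\<^sup>2) has_real_derivative 2 * max 0 s) (at s)"
    using greater by (auto intro!: derivative_eq_intros)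
  then show ?thesis
    by (rule has_field_derivative_transform_within_open[of _ _ _ "{0<..}"]) (use greater in auto)
next
  case equal
  have "((\<lambda>h::real. (max 0 h)\<^sup>2 / h) \<longlongrightarrow> 0) (at 0)"
  proof (rule Lim_null_comparison)
    show "\<forall>\<^sub>F h::real in at 0. norm ((max 0 h)\<^sup>2 / h) \<le> \<bar>h\<bar>"
      by (rule always_eventually) (auto simp: max_def power2_eq_square)
    show "((\<lambda>h::real. \<bar>h\<bar>) \<longlongrightarrow> 0) (at 0)" by (rule tendsto_rabs_zero) simp
  qed
  then show ?thesis using equal by (simp add: has_field_derivative_iff)
qed

context pseudo_hermitian_manifold
begin

lemma closedin_compact_in_chart:
  assumes c: "c \<in> atlas M" and B: "compact B" "B \<subseteq> chart_map c ` chart_dom c"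
  shows "closedin (mtop M) {q \<in> chart_dom c. chart_map c q \<in> B}"
proof -
  let ?K = "{q \<in> chart_dom c. chart_map c q \<in> B}"
  have "chart_map c ` ?K = B" using B(2) by auto
  moreover have "compactin (top_of_set (chart_map c ` chart_dom c)) B"
    using B by (simp add: compactin_subtopology)
  moreover have "?K \<subseteq> topspace (subtopology (mtop M) (chart_dom c))"
    using chart_dom_subset[OF c] by auto
  ultimately have "compactin (subtopology (mtop M) (chart_dom c)) ?K"
    using homeomorphic_map_compactness_eq[OF chart_homeo[OF c], of ?K] by simp
  then have "compactin (mtop M) ?K" by (simp add: compactin_subtopology)
  moreover have "Hausdorff_space (mtop M)" using ph by (simp add: pseudo_hermitian_def smooth_manifold_def)
  ultimately show ?thesis by (rule compactin_imp_closedin[rotated])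
qed

text \<open>A \<open>C\<^sup>1\<close> bump around \<open>p\<close>.  Along a CR map of bounded dilatation its horizontal derivative is
  bounded by the metric of the disc, uniformly in the map: the horizontal vectors of \<open>D3\<close> are
  stretched by at most \<open>\<surd>(2 \<Lambda>\<^sup>2)\<close> in the Levi metric, which dominates the chart norm near \<open>p\<close>.\<close>

lemma separating_function:
  assumes p: "p \<in> points M" and q: "q \<in> points M" and pq: "p \<noteq> q"
  obtains \<rho> :: "'a \<Rightarrow> real" and K where "\<rho> p \<noteq> \<rho> q" "K \<ge> 0"
    "\<And>f. cr_map D3 M f \<Longrightarrow> bounded_gen_dilatation D3 M f \<Lambda> \<Longrightarrow>
      \<exists>D. (\<forall>x\<in>D3_pts. ((\<lambda>x. \<rho> (f x)) has_derivative D x) (at x)) \<and>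
        (\<forall>w. continuous_on D3_pts (\<lambda>x. D x w)) \<and>
        (\<forall>z t w. cmod z < 1 \<longrightarrow> \<bar>D (z,t) (hlift z w)\<bar> \<le> K * sqrt (poincare_metric z w w))"
proof -
  let ?c = "chart_at M p"
  note c = chart_at_atlas[OF p] chart_at_dom[OF p]
  let ?\<phi> = "chart_map ?c" and ?U = "chart_dom ?c"
  obtain r0 C where r0: "r0 > 0" "C \<ge> 0" "cball (?\<phi> p) r0 \<subseteq> ?\<phi> ` ?U"
    "\<And>q v. q \<in> ?U \<Longrightarrow> ?\<phi> q \<in> cball (?\<phi> p) r0 \<Longrightarrow> v \<in> Hbundle M q \<Longrightarrow>
       norm (mderiv M ?\<phi> q v) \<le> C * sqrt (levi M q v v)"
    using levi_lower_bound[OF p c] by blast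
  \<comment> \<open>Shrink the ball so that \<open>q\<close> is not in its interior.\<close>
  define r where "r = (if q \<in> ?U then min r0 (dist (?\<phi> p) (?\<phi> q)) else r0)"
  have r: "r > 0" "r \<le> r0" using r0(1) pq inj_onD[OF chart_inj[OF c(1)] _ c(2)] by (auto simp: r_def)
  define y0 where "y0 = ?\<phi> p"
  define \<sigma> where "\<sigma> y = (max 0 (r\<^sup>2 - (y - y0) \<bullet> (y - y0)))\<^sup>2" for y
  define \<rho> where "\<rho> x = (if x \<in> ?U then \<sigma> (?\<phi> x) else 0)" for x
  have outside: "max 0 (r\<^sup>2 - (y - y0) \<bullet> (y - y0)) = 0" if "r \<le> dist y0 y" for y
  proof -
    have "r\<^sup>2 \<le> (dist y0 y)\<^sup>2" using that r by (intro power_mono) auto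
    then show ?thesis by (simp add: dist_norm dot_square_norm norm_minus_commute)
  qed
  have "\<rho> p = r ^ 4" using c r by (simp add: \<rho>_def \<sigma>_def y0_def)
  moreover have "\<rho> q = 0" using outside[of "?\<phi> q"] by (auto simp: \<rho>_def \<sigma>_def r_def y0_def)
  ultimately have \<rho>pq: "\<rho> p \<noteq> \<rho> q" using r by simp
  let ?\<sigma>' = "\<lambda>y v. - (4 * max 0 (r\<^sup>2 - (y - y0) \<bullet> (y - y0)) * ((y - y0) \<bullet> v))"
  have \<sigma>': "(\<sigma> has_derivative ?\<sigma>' y) (at y)" for y
  proof -
    have "((\<lambda>y. r\<^sup>2 - (y - y0) \<bullet> (y - y0)) has_derivative (\<lambda>v. - (2 * ((y - y0) \<bullet> v)))) (at y)"
      by (auto intro!: derivative_eq_intros simp: inner_commute)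
    from has_derivative_compose[OF this positive_part_square_derivative[unfolded has_field_derivative_def]]
    show ?thesis unfolding \<sigma>_def[abs_def] by (rule has_derivative_eq_rhs) (simp add: fun_eq_iff)
  qed
  let ?B = "{x \<in> ?U. ?\<phi> x \<in> cball y0 r}"
  have B: "closedin (mtop M) ?B"
    by (rule closedin_compact_in_chart[OF c(1)]) (use r r0(3) y0_def in auto)
  define K where "K = 4 * r\<^sup>2 * r * C * sqrt (2 * \<Lambda>\<^sup>2)"
  have K: "K \<ge> 0" using r r0 by (simp add: K_def)
  show thesis
  proof (rule that[OF \<rho>pq K])
    fix f assume f: "cr_map D3 M f" and dil: "bounded_gen_dilatation D3 M f \<Lambda>"
    note s = cr_map_smooth_into[OF f]
    define F where "F = ?\<phi> \<circ> f"
    let ?S = "{x\<in>D3_pts. f x \<in> ?U}" and ?T = "{x\<in>D3_pts. f x \<notin> ?B}"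
    have S: "open ?S" "smooth_on F ?S" using s c by (auto simp: smooth_into_def F_def)
    have T: "open ?T"
    proof -
      have "continuous_map (mtop D3) (mtop M) f" using f by (simp add: cr_map_def smooth_map_def)
      moreover have "openin (mtop M) (points M - ?B)" using B by blast
      ultimately have "openin (mtop D3) {x \<in> topspace (mtop D3). f x \<in> points M - ?B}"
        unfolding continuous_map_def by blast
      moreover have "{x \<in> topspace (mtop D3). f x \<in> points M - ?B} = ?T"
        using smooth_into_points[OF s] by auto
      ultimately have "openin (mtop D3) ?T" by (simp only:)
      then show ?thesis using open_D3_pts openin_open_trans by (auto simp: D3_def)
    qed
    \<comment> \<open>Outside the closed ball \<open>\<rho>\<close> is zero, and this region is open because \<open>M\<close> is Hausdorff.\<close>
    have ST: "D3_pts = ?S \<union> ?T" by blast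
    define D where "D x v = (if x \<in> ?S then ?\<sigma>' (F x) (frechet_derivative F (at x) v) else 0)" for x v
    have D0: "D x = (\<lambda>v. 0)" "\<rho> (f x) = 0" if x: "x \<in> ?T" for x
    proof -
      have "max 0 (r\<^sup>2 - (F x - y0) \<bullet> (F x - y0)) = 0" if "f x \<in> ?U"
        by (rule outside) (use that x in \<open>simp add: F_def\<close>)
      then show "D x = (\<lambda>v. 0)" "\<rho> (f x) = 0" by (auto simp: D_def \<rho>_def \<sigma>_def F_def fun_eq_iff)
    qed
    have deriv: "((\<lambda>x. \<rho> (f x)) has_derivative D x) (at x)" if x: "x \<in> D3_pts" for x
    proof (cases "x \<in> ?S")
      case True
      have "((\<lambda>x. \<sigma> (F x)) has_derivative D x) (at x)"
        using has_derivative_compose[OF smooth_on_has_derivative[OF S(2) True] \<sigma>'] True unfolding D_def by simp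
      then show ?thesis
        by (rule has_derivative_transform_within_open[OF _ S(1) True]) (auto simp: \<rho>_def F_def)
    next
      case False
      then have xT: "x \<in> ?T" using x by blast
      show ?thesis unfolding D0(1)[OF xT]
        by (rule has_derivative_transform_within_open[OF has_derivative_const[of 0] T xT]) (use D0(2) in auto)
    qed
    have cont: "continuous_on D3_pts (\<lambda>x. D x w)" for w
    proof (subst ST, rule continuous_on_open_Un[OF S(1) T])
      have "continuous_on ?S (\<lambda>x. ?\<sigma>' (F x) (frechet_derivative F (at x) w))"
        using smooth_on_continuous_on[OF S(2)] smooth_on_continuous_on[OF smooth_on_frechet_derivative[OF S(2), of w]]
        by (intro continuous_intros)
      then show "continuous_on ?S (\<lambda>x. D x w)" by (rule continuous_on_eq) (simp add: D_def)
      show "continuous_on ?T (\<lambda>x. D x w)"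
        by (rule continuous_on_eq[OF continuous_on_const[of _ 0]]) (simp add: D0(1))
    qed
    have bound: "\<bar>D (z,t) (hlift z w)\<bar> \<le> K * sqrt (poincare_metric z w w)" if z: "cmod z < 1" for z t w
    proof -
      let ?x = "(z,t)"
      have x: "?x \<in> D3_pts" using z by simp
      have P: "poincare_metric z w w \<ge> 0" by (simp add: poincare_metric_def)
      show ?thesis
      proof (cases "?x \<in> ?T")
        case True
        then show ?thesis using K P D0(1)[OF True] by simp
      next
        case False
        then have fx: "f ?x \<in> ?U" "dist y0 (F ?x) \<le> r" using x by (auto simp: F_def)
        let ?v = "tangent_map M f ?x (hlift z w)"
        have dF: "frechet_derivative F (at ?x) (hlift z w) = mderiv M ?\<phi> (f ?x) ?v"
          unfolding F_def by (rule chart_chain_rule[OF s x c(1) fx(1)])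
        have "norm (mderiv M ?\<phi> (f ?x) ?v) \<le> C * sqrt (levi M (f ?x) ?v ?v)"
          by (rule r0(4)[OF fx(1)]) (use fx(2) r cr_map_tangent_map(1)[OF f x hlift_in_Hbundle] in \<open>auto simp: F_def y0_def\<close>)
        also have "\<dots> \<le> C * sqrt (2 * \<Lambda>\<^sup>2 * poincare_metric z w w)"
          unfolding cr_map_levi[OF f z]
          by (intro mult_left_mono real_sqrt_le_mono mult_right_mono conformal_factor_bound[OF f dil z] P r0(2))
        finally have n1: "norm (frechet_derivative F (at ?x) (hlift z w)) \<le> C * sqrt (2 * \<Lambda>\<^sup>2 * poincare_metric z w w)"
          unfolding dF .
        have n2: "norm (F ?x - y0) \<le> r" using fx(2) by (simp add: dist_norm norm_minus_commute)
        have n3: "max 0 (r\<^sup>2 - (F ?x - y0) \<bullet> (F ?x - y0)) \<le> r\<^sup>2" by simp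
        have "\<bar>D ?x (hlift z w)\<bar> = 4 * max 0 (r\<^sup>2 - (F ?x - y0) \<bullet> (F ?x - y0)) * \<bar>(F ?x - y0) \<bullet> frechet_derivative F (at ?x) (hlift z w)\<bar>"
          using fx x by (simp add: D_def abs_mult)
        also have "\<dots> \<le> 4 * r\<^sup>2 * (r * (C * sqrt (2 * \<Lambda>\<^sup>2 * poincare_metric z w w)))"
          using n1 n2 n3 r r0(2) P
          by (intro mult_mono order_trans[OF Cauchy_Schwarz_ineq2] mult_left_mono) auto
        also have "\<dots> = K * sqrt (poincare_metric z w w)" by (simp add: K_def real_sqrt_mult)
        finally show ?thesis .
      qed
    qed
    show "\<exists>D. (\<forall>x\<in>D3_pts. ((\<lambda>x. \<rho> (f x)) has_derivative D x) (at x)) \<and>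
        (\<forall>w. continuous_on D3_pts (\<lambda>x. D x w)) \<and>
        (\<forall>z t w. cmod z < 1 \<longrightarrow> \<bar>D (z,t) (hlift z w)\<bar> \<le> K * sqrt (poincare_metric z w w))"
      using deriv cont bound by blast
  qed
qed

end

section \<open>Lengths of horizontal curves\<close>

lemma difference_quotient_LIMSEQ:
  fixes f :: "real \<Rightarrow> 'f::real_normed_vector"
  assumes "(f has_vector_derivative D) (at t)"
  shows "(\<lambda>n. (f (t + inverse (Suc n)) - f t) /\<^sub>R inverse (real (Suc n))) \<longlonglongrightarrow> D"
proof -
  have lim: "((\<lambda>h. (f (t + h) - f t) /\<^sub>R h) \<longlongrightarrow> D) (at 0)"
  proof -
    have "((\<lambda>h. norm ((f (t + h) - f t) /\<^sub>R h - D)) \<longlongrightarrow> 0) (at 0)"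
    proof (rule Lim_transform_eventually)
      show "((\<lambda>h. norm (f (t + h) - f t - h *\<^sub>R D) / norm h) \<longlongrightarrow> 0) (at 0)"
        using assms unfolding has_vector_derivative_def has_derivative_at by blast
      show "\<forall>\<^sub>F h in at 0. norm (f (t + h) - f t - h *\<^sub>R D) / norm h = norm ((f (t + h) - f t) /\<^sub>R h - D)"
      proof (rule eventually_at_filter[THEN iffD2, OF always_eventually], intro allI impI)
        fix h :: real assume "h \<noteq> 0"
        then have "(f (t + h) - f t) /\<^sub>R h - D = (f (t + h) - f t - h *\<^sub>R D) /\<^sub>R h"
          by (simp add: scaleR_diff_right)
        then show "norm (f (t + h) - f t - h *\<^sub>R D) / norm h = norm ((f (t + h) - f t) /\<^sub>R h - D)"
          by (simp add: divide_inverse mult.commute)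
      qed
    qed
    then show ?thesis using Lim_null tendsto_norm_zero_iff by blast
  qed
  have "filterlim (\<lambda>n. inverse (real (Suc n))) (at 0) sequentially"
    unfolding filterlim_at using LIMSEQ_inverse_real_of_nat by auto
  from filterlim_compose[OF lim this] show ?thesis by simp
qed

text \<open>A curve on \<open>{a..b}\<close> has arbitrary values outside, so derivatives are only compared at interior
  points; the two endpoints form a null set.\<close>

lemma AE_lebesgue_Ioo:
  assumes "AE t in lebesgue. t \<in> {a..b::real} \<longrightarrow> P t" "\<And>t. a < t \<Longrightarrow> t < b \<Longrightarrow> P t \<Longrightarrow> Q t"
  shows "AE t in lebesgue. t \<in> {a..b} \<longrightarrow> Q t"
proof -
  have "AE t in lebesgue. t \<noteq> c" for c :: real
    using AE_completion[OF AE_lborel_singleton[of c]] .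
  from assms(1) this[of a] this[of b] show ?thesis
    by eventually_elim (use assms(2) in force)
qed

lemma clamp_lipschitz:
  fixes f :: "real \<Rightarrow> 'f::metric_space"
  assumes "L-lipschitz_on {a..b} f" "a \<le> b"
  shows "L-lipschitz_on UNIV (\<lambda>t. f (max a (min b t)))"
proof (rule lipschitz_onI)
  fix x y :: real
  have "dist (f (max a (min b x))) (f (max a (min b y))) \<le> L * dist (max a (min b x)) (max a (min b y))"
    using assms by (intro lipschitz_onD) auto
  also have "\<dots> \<le> L * dist x y"
    using lipschitz_on_nonneg[OF assms(1)] by (intro mult_left_mono) (auto simp: dist_real_def)
  finally show "dist (f (max a (min b x))) (f (max a (min b y))) \<le> L * dist x y" .
qed (rule lipschitz_on_nonneg[OF assms(1)])

text \<open>The mean of the difference quotients with step \<open>\<delta>\<close> is, by translation, the difference of the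
  averages of \<open>h\<close> over two intervals of length \<open>\<delta>\<close>.\<close>

lemma integral_difference_quotient:
  fixes H :: "real \<Rightarrow> real"
  assumes H: "L-lipschitz_on UNIV H" and const: "\<And>t. b \<le> t \<Longrightarrow> H t = H b" and ab: "a \<le> b" and \<delta>: "0 < \<delta>"
  shows "\<bar>integral {a..b} (\<lambda>t. (H (t + \<delta>) - H t) /\<^sub>R \<delta>) - (H b - H a)\<bar> \<le> L * \<delta>"
proof -
  have c: "continuous_on S H" for S using lipschitz_on_continuous_on[OF H] continuous_on_subset by blast
  have int: "H integrable_on {x..y}" for x y by (rule integrable_continuous_real[OF c])
  have sh: "(\<lambda>t. H (t + \<delta>)) integrable_on {a..b}"
    by (intro integrable_continuous_real continuous_on_compose2[OF c[of UNIV]] continuous_intros) auto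
  have 1: "integral {a..b} (\<lambda>t. H (t + \<delta>)) = integral {a + \<delta>..b + \<delta>} H"
    using integral_shift_Icc_real[of a b H \<delta>] by (simp add: o_def add.commute)
  have 2: "integral {a..a + \<delta>} H + integral {a + \<delta>..b + \<delta>} H = integral {a..b} H + integral {b..b + \<delta>} H"
    using Henstock_Kurzweil_Integration.integral_combine[OF _ _ int, of a "a + \<delta>" "b + \<delta>"]
      Henstock_Kurzweil_Integration.integral_combine[OF _ _ int, of a b "b + \<delta>"] ab \<delta> by simp
  have 3: "integral {b..b + \<delta>} H = \<delta> * H b"
  proof -
    have "integral {b..b + \<delta>} H = integral {b..b + \<delta>} (\<lambda>t. H b)"
      by (rule Henstock_Kurzweil_Integration.integral_cong) (rule const, simp)
    then show ?thesis using \<delta> by simp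
  qed
  have "norm (integral {a..a + \<delta>} (\<lambda>t. H t - H a)) \<le> (L * \<delta>) * (a + \<delta> - a)"
  proof (rule integral_bound)
    fix t assume t: "t \<in> {a..a + \<delta>}"
    have "norm (H t - H a) \<le> L * dist t a" using lipschitz_onD[OF H, of t a] by (simp add: dist_norm)
    also have "\<dots> \<le> L * \<delta>" using t lipschitz_on_nonneg[OF H] by (intro mult_left_mono) (auto simp: dist_real_def)
    finally show "norm (H t - H a) \<le> L * \<delta>" .
  qed (use \<delta> in \<open>auto intro!: continuous_intros c\<close>)
  moreover have "integral {a..a + \<delta>} (\<lambda>t. H t - H a) = integral {a..a + \<delta>} H - \<delta> * H a"
    using \<delta> Henstock_Kurzweil_Integration.integral_diff[OF int integrable_continuous_real[OF continuous_on_const], of a "a + \<delta>" "H a"]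
    by simp
  ultimately have 4: "\<bar>integral {a..a + \<delta>} H - \<delta> * H a\<bar> \<le> L * \<delta> * \<delta>" by simp
  have "integral {a..b} (\<lambda>t. (H (t + \<delta>) - H t) /\<^sub>R \<delta>) = (integral {a + \<delta>..b + \<delta>} H - integral {a..b} H) / \<delta>"
    by (simp add: Henstock_Kurzweil_Integration.integral_diff[OF sh int] 1 divide_inverse mult.commute)
  also have "\<dots> = (\<delta> * H b - integral {a..a + \<delta>} H) / \<delta>" using 2 3 by (intro arg_cong[of _ _ "\<lambda>x. x / \<delta>"]) linarith
  also have "\<dots> - (H b - H a) = - ((integral {a..a + \<delta>} H - \<delta> * H a) / \<delta>)"
    using \<delta> by (simp add: field_simps)
  finally have "\<bar>integral {a..b} (\<lambda>t. (H (t + \<delta>) - H t) /\<^sub>R \<delta>) - (H b - H a)\<bar> = \<bar>integral {a..a + \<delta>} H - \<delta> * H a\<bar> / \<delta>"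
    using \<delta> by simp
  also have "\<dots> \<le> L * \<delta>" using 4 \<delta> by (simp add: pos_divide_le_eq)
  finally show ?thesis .
qed

text \<open>The difference quotients of \<open>h\<close> are bounded by its Lipschitz constant, so dominated convergence
  makes \<open>h b - h a\<close> the integral of the almost everywhere derivative.\<close>

lemma lipschitz_variation_bound:
  fixes h v :: "real \<Rightarrow> real"
  assumes ab: "a \<le> b" and lip: "L-lipschitz_on {a..b} h"
    and der: "AE t in lebesgue. t \<in> {a..b} \<longrightarrow> (\<exists>d. (h has_real_derivative d) (at t) \<and> \<bar>d\<bar> \<le> v t)"
    and v: "set_integrable lebesgue {a..b} v"
  shows "\<bar>h b - h a\<bar> \<le> (LINT t:{a..b}|lebesgue. v t)"
proof -
  define H where "H t = h (max a (min b t))" for t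
  have H: "L-lipschitz_on UNIV H" unfolding H_def[abs_def] by (rule clamp_lipschitz[OF lip ab])
  define q where "q n t = (H (t + inverse (Suc n)) - H t) /\<^sub>R inverse (real (Suc n))" for n t
  have cH: "continuous_on S H" for S using lipschitz_on_continuous_on[OF H] continuous_on_subset by blast
  have cq: "continuous_on S (q n)" for n S
    unfolding q_def[abs_def] by (intro continuous_intros continuous_on_compose2[OF cH[of UNIV]]) auto
  have mq: "q n \<in> borel_measurable lebesgue" for n
    using borel_measurable_continuous_onI[OF cq] by (simp add: measurable_completion)
  have L: "L \<ge> 0" by (rule lipschitz_on_nonneg[OF lip])
  have bq: "\<bar>q n t\<bar> \<le> L" for n t
  proof -
    have "\<bar>H (t + inverse (Suc n)) - H t\<bar> \<le> L * inverse (real (Suc n))"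
      using lipschitz_onD[OF H, of "t + inverse (Suc n)" t] by (simp add: dist_real_def)
    then have "\<bar>H (t + inverse (Suc n)) - H t\<bar> * real (Suc n) \<le> L * inverse (real (Suc n)) * real (Suc n)"
      by (rule mult_right_mono) simp
    also have "\<dots> = L" by simp
    finally show ?thesis unfolding q_def by (simp add: abs_mult mult.commute del: of_nat_Suc)
  qed
  define d where "d t = lim (\<lambda>n. q n t)" for t
  have md: "d \<in> borel_measurable lebesgue" unfolding d_def[abs_def] by (intro borel_measurable_lim_metric mq)
  have lim: "AE t in lebesgue. t \<in> {a..b} \<longrightarrow> (\<lambda>n. q n t) \<longlonglongrightarrow> d t \<and> \<bar>d t\<bar> \<le> v t"
  proof (rule AE_lebesgue_Ioo[OF der])
    fix t assume t: "a < t" "t < b" and "\<exists>d. (h has_real_derivative d) (at t) \<and> \<bar>d\<bar> \<le> v t"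
    then obtain D where D: "(h has_real_derivative D) (at t)" "\<bar>D\<bar> \<le> v t" by blast
    have "(H has_real_derivative D) (at t)"
      by (rule has_field_derivative_transform_within_open[OF D(1), of "{a<..<b}"]) (use t in \<open>auto simp: H_def\<close>)
    then have "(\<lambda>n. q n t) \<longlonglongrightarrow> D"
      unfolding q_def by (rule difference_quotient_LIMSEQ[OF has_real_derivative_iff_has_vector_derivative[THEN iffD1]])
    moreover from this have "d t = D" unfolding d_def by (rule limI)
    ultimately show "(\<lambda>n. q n t) \<longlonglongrightarrow> d t \<and> \<bar>d t\<bar> \<le> v t" using D(2) by simp
  qed
  let ?i = "indicator {a..b} :: real \<Rightarrow> real"
  have conv: "(\<lambda>n. LINT t|lebesgue. ?i t *\<^sub>R q n t) \<longlonglongrightarrow> (LINT t|lebesgue. ?i t *\<^sub>R d t)"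
  proof (rule integral_dominated_convergence)
    show "(\<lambda>t. ?i t *\<^sub>R d t) \<in> borel_measurable lebesgue" by (intro borel_measurable_scaleR borel_measurable_indicator md) simp
    show "(\<lambda>t. ?i t *\<^sub>R q n t) \<in> borel_measurable lebesgue" for n
      by (intro borel_measurable_scaleR borel_measurable_indicator mq) simp
    show "integrable lebesgue (\<lambda>t. ?i t *\<^sub>R L)" by (intro integrableI_bounded_set_indicator[where B=L]) (use L in \<open>auto simp: emeasure_lborel_Icc_eq\<close>)
    show "AE t in lebesgue. (\<lambda>n. ?i t *\<^sub>R q n t) \<longlonglongrightarrow> ?i t *\<^sub>R d t"
      using lim by eventually_elim (auto split: split_indicator)
    show "AE t in lebesgue. norm (?i t *\<^sub>R q n t) \<le> ?i t *\<^sub>R L" for n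
      using bq by (auto split: split_indicator)
  qed
  have "(LINT t|lebesgue. ?i t *\<^sub>R q n t) = integral {a..b} (q n)" for n
    using set_lebesgue_integral_eq_integral(2)[OF absolutely_integrable_continuous_real[OF cq]]
    by (simp add: set_lebesgue_integral_def)
  moreover have "(\<lambda>n. integral {a..b} (q n)) \<longlonglongrightarrow> H b - H a"
  proof (rule LIM_zero_cancel, rule Lim_null_comparison)
    show "(\<lambda>n. L * inverse (real (Suc n))) \<longlonglongrightarrow> 0"
      using tendsto_mult_left[OF LIMSEQ_inverse_real_of_nat, of L] by simp
    show "\<forall>\<^sub>F n in sequentially. norm (integral {a..b} (q n) - (H b - H a)) \<le> L * inverse (real (Suc n))"
    proof (rule always_eventually, rule allI)
      fix n
      have "H t = H b" if "b \<le> t" for t using that ab by (simp add: H_def)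
      from integral_difference_quotient[OF H this ab, of "inverse (real (Suc n))"]
      show "norm (integral {a..b} (q n) - (H b - H a)) \<le> L * inverse (real (Suc n))" unfolding q_def[abs_def] by simp
    qed
  qed
  ultimately have "(LINT t|lebesgue. ?i t *\<^sub>R d t) = H b - H a" using conv LIMSEQ_unique by auto
  also have "\<dots> = h b - h a" using ab by (simp add: H_def)
  finally have eq: "(LINT t|lebesgue. ?i t *\<^sub>R d t) = h b - h a" .
  have le: "AE t in lebesgue. norm (?i t *\<^sub>R d t) \<le> ?i t *\<^sub>R v t"
    using lim by eventually_elim (auto split: split_indicator)
  have iv: "integrable lebesgue (\<lambda>t. ?i t *\<^sub>R v t)" using v by (simp add: set_integrable_def)
  have "\<bar>h b - h a\<bar> \<le> (LINT t|lebesgue. norm (?i t *\<^sub>R d t))" unfolding eq[symmetric] real_norm_def[symmetric] by (rule integral_norm_bound)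
  also have "\<dots> \<le> (LINT t|lebesgue. ?i t *\<^sub>R v t)"
  proof (rule integral_mono_AE[OF _ iv le])
    show "integrable lebesgue (\<lambda>t. norm (?i t *\<^sub>R d t))"
    proof (rule Bochner_Integration.integrable_bound[OF iv])
      show "(\<lambda>t. norm (?i t *\<^sub>R d t)) \<in> borel_measurable lebesgue"
        by (rule measurable_compose[OF _ borel_measurable_norm])
          (intro borel_measurable_scaleR borel_measurable_indicator md, simp)
      show "AE t in lebesgue. norm (norm (?i t *\<^sub>R d t)) \<le> norm (?i t *\<^sub>R v t)"
        using le by eventually_elim simp
    qed
  qed
  finally show ?thesis by (simp add: set_lebesgue_integral_def)
qed

lemma local_lipschitz_interval:
  fixes f :: "real \<Rightarrow> 'f::metric_space"
  assumes ab: "a \<le> b"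
    and loc: "\<And>t. t \<in> {a..b} \<Longrightarrow> \<exists>I C. open I \<and> t \<in> I \<and> C-lipschitz_on (I \<inter> {a..b}) f"
  obtains C where "C-lipschitz_on {a..b} f"
proof -
  have "\<exists>C. C-lipschitz_on ({a..b} \<inter> {a..b}) f"
    using ab
    \<comment> \<open>The intersection with \<open>{a..b}\<close> gives the predicate a meaning for the intervals around \<open>a\<close> and \<open>b\<close>.\<close>
  proof (induction a b rule: Bolzano[where P="\<lambda>x y. \<exists>C. C-lipschitz_on ({x..y} \<inter> {a..b}) f"])
    case (trans x y z)
    then obtain C C' where C: "C-lipschitz_on ({x..y} \<inter> {a..b}) f" "C'-lipschitz_on ({y..z} \<inter> {a..b}) f" by blast
    consider "y < a" | "b < y" | "y \<in> {a..b}" by fastforce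
    then show ?case
    proof cases
      case 1
      then have "{x..z} \<inter> {a..b} = {y..z} \<inter> {a..b}" using trans by auto
      then show ?thesis using C by auto
    next
      case 2
      then have "{x..z} \<inter> {a..b} = {x..y} \<inter> {a..b}" using trans by auto
      then show ?thesis using C by auto
    next
      case 3
      have e: "{u..w} \<inter> {a..b} = {max u a..min w b}" for u w by auto
      have "(max C C')-lipschitz_on {max x a..min z b} (\<lambda>t. if t \<le> y then f t else f t)"
        using C 3 trans unfolding e by (intro lipschitz_on_concat_max) (auto simp: max_def min_def split: if_splits)
      then show ?thesis unfolding e by auto
    qed
  next
    case (local x)
    then obtain I C where I: "open I" "x \<in> I" "C-lipschitz_on (I \<inter> {a..b}) f" using loc[of x] by auto
    then obtain d where d: "d > 0" "ball x d \<subseteq> I" using openE by blast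
    have "C-lipschitz_on ({u..w} \<inter> {a..b}) f" if "u \<le> x" "x \<le> w" "w - u < d" for u w
      by (rule lipschitz_on_subset[OF I(3)]) (use that d(2) in \<open>force simp: dist_real_def subset_iff\<close>)
    then show ?case using d(1) by blast
  qed
  then show thesis using that by auto
qed

lemma lipschitz_curve_D3:
  assumes "lipschitz_curve D3 a b \<gamma>" "a \<le> b"
  shows "\<gamma> ` {a..b} \<subseteq> D3_pts" and "\<exists>C. C-lipschitz_on {a..b} \<gamma>"
proof -
  show "\<gamma> ` {a..b} \<subseteq> D3_pts"
    using assms continuous_map_image_subset_topspace[of "top_of_set {a..b}" "mtop D3" \<gamma>]
    by (simp add: lipschitz_curve_def)
  have "\<exists>I C. open I \<and> t \<in> I \<and> C-lipschitz_on (I \<inter> {a..b}) \<gamma>" if "t \<in> {a..b}" for t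
    using assms(1) that unfolding lipschitz_curve_def by (fastforce simp: D3_def o_def)
  then show "\<exists>C. C-lipschitz_on {a..b} \<gamma>" using local_lipschitz_interval[OF assms(2)] by metis
qed

lemma velocity_D3:
  assumes "\<gamma> t \<in> D3_pts"
  shows "velocity D3 \<gamma> t = vector_derivative \<gamma> (at t)"
    and "chart_map (chart_at D3 (\<gamma> t)) \<circ> \<gamma> = \<gamma>"
  unfolding velocity_def chart_at_D3[OF assms] by (simp_all add: o_def)

lemma sqrt_poincare_metric: "cmod z < 1 \<Longrightarrow> sqrt (poincare_metric z w w) = 2 * cmod w / (1 - (cmod z)\<^sup>2)"
  by (simp add: poincare_metric_def dot_square_norm real_sqrt_divide real_sqrt_mult abs_square_le_1)

lemma levi_D3_horizontal:
  assumes "x \<in> D3_pts" "V \<in> Hbundle D3 x"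
  shows "V = hlift (fst x) (fst V)" "levi D3 x V V = poincare_metric (fst x) (fst V) (fst V)"
proof -
  have "theta D3 x V = 0" using assms(2) Hbundle_D3[of "fst x" "snd x"] by simp
  then show V: "V = hlift (fst x) (fst V)" by (simp add: theta_D3 hlift_def prod_eq_iff)
  have "cmod (fst x) < 1" using assms(1) by (simp add: mem_Times_iff)
  from levi_D3[OF this, of "snd x" "fst V" "fst V"]
  show "levi D3 x V V = poincare_metric (fst x) (fst V) (fst V)" by (simp flip: V)
qed

abbreviation speed_D3 :: "(real \<Rightarrow> complex \<times> real) \<Rightarrow> real \<Rightarrow> real" where
  "speed_D3 \<gamma> t \<equiv> sqrt (levi D3 (\<gamma> t) (velocity D3 \<gamma> t) (velocity D3 \<gamma> t))"

text \<open>The speed is measurable as an almost everywhere limit of difference quotients, and bounded by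
  the Lipschitz constant of the curve times the factor \<open>2 / (1 - \<bar>z\<bar>\<^sup>2)\<close>, which is bounded along the
  curve.  This is needed because a non-integrable speed would count as length \<open>0\<close>.\<close>

lemma speed_D3_integrable:
  assumes ab: "a \<le> b" and \<gamma>: "horizontal_curve D3 a b \<gamma>"
  shows "set_integrable lebesgue {a..b} (speed_D3 \<gamma>)"
proof -
  have lip: "lipschitz_curve D3 a b \<gamma>" using \<gamma> by (simp add: horizontal_curve_def)
  note pts = lipschitz_curve_D3(1)[OF lip ab]
  obtain C where C: "C-lipschitz_on {a..b} \<gamma>" using lipschitz_curve_D3(2)[OF lip ab] by blast
  define \<eta> where "\<eta> t = \<gamma> (max a (min b t))" for t
  have \<eta>: "C-lipschitz_on UNIV \<eta>" unfolding \<eta>_def[abs_def] by (rule clamp_lipschitz[OF C ab])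
  have c\<eta>: "continuous_on S \<eta>" for S using lipschitz_on_continuous_on[OF \<eta>] continuous_on_subset by blast
  have \<eta>pts: "\<eta> t \<in> D3_pts" for t using pts ab unfolding \<eta>_def by (auto simp: image_subset_iff)
  have pos: "1 - (cmod (fst (\<eta> t)))\<^sup>2 > 0" for t
    using \<eta>pts[of t] by (simp add: mem_Times_iff power_less_one_iff)
  define q where "q n t = (\<eta> (t + inverse (Suc n)) - \<eta> t) /\<^sub>R inverse (real (Suc n))" for n t
  have cq: "continuous_on UNIV (q n)" for n
    unfolding q_def[abs_def] by (intro continuous_intros continuous_on_compose2[OF c\<eta>[of UNIV]]) auto
  define w where "w t = 2 / (1 - (cmod (fst (\<eta> t)))\<^sup>2)" for t
  have cw: "continuous_on UNIV w"
    unfolding w_def[abs_def] using pos by (intro continuous_intros c\<eta>) (metis less_irrefl)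
  let ?s = "\<lambda>n t. w t * cmod (fst (q n t))"
  have cs: "continuous_on UNIV (?s n)" for n by (intro continuous_intros cq cw)
  have ms: "?s n \<in> borel_measurable lebesgue" for n
    using borel_measurable_continuous_onI[OF cs] by (simp add: measurable_completion)
  have bq: "cmod (fst (q n t)) \<le> C" for n t
  proof -
    have "norm (\<eta> (t + inverse (Suc n)) - \<eta> t) \<le> C * inverse (real (Suc n))"
      using lipschitz_onD[OF \<eta>, of "t + inverse (Suc n)" t] by (simp add: dist_norm)
    then have "norm (\<eta> (t + inverse (Suc n)) - \<eta> t) * real (Suc n) \<le> C * inverse (real (Suc n)) * real (Suc n)"
      by (rule mult_right_mono) simp
    also have "\<dots> = C" by simp
    finally have "norm (q n t) \<le> C" unfolding q_def by (simp add: mult.commute del: of_nat_Suc)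
    then show ?thesis using norm_fst_le[of "fst (q n t)" "snd (q n t)"] by simp
  qed
  obtain W where W: "\<And>t. t \<in> {a..b} \<Longrightarrow> w t \<le> W"
    using continuous_attains_sup[of "{a..b}" w] continuous_on_subset[OF cw] ab
    by (metis atLeastatMost_empty_iff compact_Icc not_le subset_UNIV)
  have ae: "AE t in lebesgue. t \<in> {a..b} \<longrightarrow> (chart_map (chart_at D3 (\<gamma> t)) \<circ> \<gamma>) differentiable (at t) \<and>
        velocity D3 \<gamma> t \<in> Hbundle D3 (\<gamma> t)"
    using \<gamma> by (simp add: horizontal_curve_def)
  have lim: "AE t in lebesgue. t \<in> {a..b} \<longrightarrow> (\<lambda>n. ?s n t) \<longlonglongrightarrow> speed_D3 \<gamma> t"
  proof (rule AE_lebesgue_Ioo[OF ae])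
    fix t assume t: "a < t" "t < b" and d: "(chart_map (chart_at D3 (\<gamma> t)) \<circ> \<gamma>) differentiable (at t) \<and>
        velocity D3 \<gamma> t \<in> Hbundle D3 (\<gamma> t)"
    have x: "\<gamma> t \<in> D3_pts" using pts t by (auto simp: image_subset_iff)
    let ?V = "velocity D3 \<gamma> t"
    have V: "(\<gamma> has_vector_derivative ?V) (at t)"
      using d unfolding velocity_D3[of \<gamma> t, OF x] by (simp add: vector_derivative_works)
    have "(\<eta> has_vector_derivative ?V) (at t)"
      by (rule has_vector_derivative_transform_within_open[OF V, of "{a<..<b}"]) (use t in \<open>auto simp: \<eta>_def\<close>)
    then have "(\<lambda>n. q n t) \<longlonglongrightarrow> ?V" unfolding q_def by (rule difference_quotient_LIMSEQ)
    then have "(\<lambda>n. ?s n t) \<longlonglongrightarrow> w t * cmod (fst ?V)" by (intro tendsto_intros)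
    moreover have "speed_D3 \<gamma> t = w t * cmod (fst ?V)"
    proof -
      have "\<eta> t = \<gamma> t" using t by (simp add: \<eta>_def)
      moreover have "cmod (fst (\<gamma> t)) < 1" using x by (simp add: mem_Times_iff)
      ultimately show ?thesis
        using levi_D3_horizontal(2)[OF x] d by (simp add: sqrt_poincare_metric w_def)
    qed
    ultimately show "(\<lambda>n. ?s n t) \<longlonglongrightarrow> speed_D3 \<gamma> t" by simp
  qed
  let ?i = "indicator {a..b} :: real \<Rightarrow> real"
  define f where "f t = ?i t *\<^sub>R lim (\<lambda>n. ?s n t)" for t
  have "f \<in> borel_measurable lebesgue"
    unfolding f_def[abs_def] by (intro borel_measurable_scaleR borel_measurable_indicator borel_measurable_lim_metric ms) simp
  moreover have "AE t in lebesgue. f t = ?i t *\<^sub>R speed_D3 \<gamma> t"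
    using lim by eventually_elim (auto simp: f_def limI split: split_indicator)
  ultimately have m: "(\<lambda>t. ?i t *\<^sub>R speed_D3 \<gamma> t) \<in> borel_measurable lebesgue"
    by (rule borel_measurable_AE)
  have W0: "0 \<le> W" using W[of a] ab pos[of a] by (smt (verit) atLeastAtMost_iff divide_nonneg_pos w_def)
  have bound: "AE t in lebesgue. t \<in> {a..b} \<longrightarrow> norm (?i t *\<^sub>R speed_D3 \<gamma> t) \<le> W * C"
    using lim
  proof eventually_elim
    case (elim t)
    show ?case
    proof
      assume t: "t \<in> {a..b}"
      have s: "\<bar>?s n t\<bar> \<le> W * C" for n
        using mult_mono[OF W[OF t] bq[of n t] W0] pos[of t] by (simp add: abs_mult w_def)
      have "(\<lambda>n. \<bar>?s n t\<bar>) \<longlonglongrightarrow> \<bar>speed_D3 \<gamma> t\<bar>" using elim t by (intro tendsto_intros) auto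
      then have "\<bar>speed_D3 \<gamma> t\<bar> \<le> W * C" by (rule LIMSEQ_le_const2) (use s in auto)
      then show "norm (?i t *\<^sub>R speed_D3 \<gamma> t) \<le> W * C" using t by simp
    qed
  qed
  have "integrable lebesgue (\<lambda>t. ?i t *\<^sub>R (?i t *\<^sub>R speed_D3 \<gamma> t))"
    by (rule integrableI_bounded_set_indicator[OF _ m _ bound]) (auto simp: emeasure_lborel_Icc_eq)
  moreover have "(\<lambda>t. ?i t *\<^sub>R (?i t *\<^sub>R speed_D3 \<gamma> t)) = (\<lambda>t. ?i t *\<^sub>R speed_D3 \<gamma> t)"
    by (auto simp: fun_eq_iff split: split_indicator)
  ultimately show ?thesis unfolding set_integrable_def by (simp only:)
qed

text \<open>The convex hull of \<open>K\<close> is compact and stays in \<open>S\<close>, so the derivative is bounded there and the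
  mean value inequality applies.\<close>

lemma C1_imp_lipschitz_on_compact:
  fixes G :: "'d::euclidean_space \<Rightarrow> real"
  assumes S: "convex S" and K: "compact K" "K \<subseteq> S"
    and G: "\<And>x. x \<in> S \<Longrightarrow> (G has_derivative D x) (at x)" "\<And>w. continuous_on S (\<lambda>x. D x w)"
  obtains L where "L-lipschitz_on K G"
proof -
  let ?T = "convex hull K"
  have T: "compact ?T" "?T \<subseteq> S" using compact_convex_hull[OF K(1)] hull_minimal[of K S convex, OF K(2) S] by auto
  have "\<exists>B. \<forall>x\<in>?T. \<bar>D x b\<bar> \<le> B" for b
  proof -
    have "compact ((\<lambda>x. D x b) ` ?T)" by (rule compact_continuous_image[OF continuous_on_subset[OF G(2) T(2)] T(1)])
    then show ?thesis using compact_imp_bounded bounded_iff by (metis (no_types, lifting) imageI real_norm_def)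
  qed
  then obtain B where B: "\<And>b x. x \<in> ?T \<Longrightarrow> \<bar>D x b\<bar> \<le> B b" by metis
  let ?L = "\<Sum>b\<in>Basis. \<bar>B b\<bar>"
  have "?L-lipschitz_on ?T G"
  proof (rule bounded_derivative_imp_lipschitz)
    show "(G has_derivative D x) (at x within ?T)" if "x \<in> ?T" for x
      using G(1) T(2) that has_derivative_at_withinI by blast
    show "onorm (D x) \<le> ?L" if x: "x \<in> ?T" for x
    proof (rule onorm_le)
      fix w
      have "x \<in> S" using x T(2) by blast
      then have "D x w = (\<Sum>b\<in>Basis. (w \<bullet> b) *\<^sub>R D x b)"
        by (intro linear_basis_expand has_derivative_linear[OF G(1)])
      then have "norm (D x w) \<le> (\<Sum>b\<in>Basis. \<bar>w \<bullet> b\<bar> * \<bar>D x b\<bar>)"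
        by (simp add: order_trans[OF sum_abs] abs_mult)
      also have "\<dots> \<le> (\<Sum>b\<in>Basis. norm w * \<bar>B b\<bar>)"
        using B[OF x] by (intro sum_mono mult_mono Basis_le_norm) (auto intro: order_trans[OF _ abs_ge_self])
      finally show "norm (D x w) \<le> ?L * norm w" by (simp add: sum_distrib_left mult.commute)
    qed
  qed (auto simp: convex_convex_hull intro: sum_nonneg)
  then show thesis using that lipschitz_on_subset hull_subset by metis
qed

lemma horizontal_curve_variation:
  assumes G: "\<And>x. x \<in> D3_pts \<Longrightarrow> (G has_derivative D x) (at x)" "\<And>w. continuous_on D3_pts (\<lambda>x. D x w)"
    "\<And>z t w. cmod z < 1 \<Longrightarrow> \<bar>D (z,t) (hlift z w)\<bar> \<le> K * sqrt (poincare_metric z w w)"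
    and ab: "a \<le> b" and \<gamma>: "horizontal_curve D3 a b \<gamma>"
  shows "\<bar>G (\<gamma> b) - G (\<gamma> a)\<bar> \<le> K * (LINT t:{a..b}|lebesgue. speed_D3 \<gamma> t)"
proof -
  have lip: "lipschitz_curve D3 a b \<gamma>" using \<gamma> by (simp add: horizontal_curve_def)
  note pts = lipschitz_curve_D3(1)[OF lip ab]
  obtain C where C: "C-lipschitz_on {a..b} \<gamma>" using lipschitz_curve_D3(2)[OF lip ab] by blast
  have "compact (\<gamma> ` {a..b})" by (rule compact_continuous_image[OF lipschitz_on_continuous_on[OF C] compact_Icc])
  moreover have "convex D3_pts" by (intro convex_Times convex_ball convex_UNIV)
  ultimately obtain L where L: "L-lipschitz_on (\<gamma> ` {a..b}) G"
    using C1_imp_lipschitz_on_compact[of D3_pts "\<gamma> ` {a..b}" G D] pts G(1,2) by metis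
  have lipG: "(L * C)-lipschitz_on {a..b} (\<lambda>t. G (\<gamma> t))" using lipschitz_on_compose2[OF C L] .
  have ae: "AE t in lebesgue. t \<in> {a..b} \<longrightarrow> (chart_map (chart_at D3 (\<gamma> t)) \<circ> \<gamma>) differentiable (at t) \<and>
        velocity D3 \<gamma> t \<in> Hbundle D3 (\<gamma> t)"
    using \<gamma> by (simp add: horizontal_curve_def)
  have "AE t in lebesgue. t \<in> {a..b} \<longrightarrow>
      (\<exists>d. ((\<lambda>t. G (\<gamma> t)) has_real_derivative d) (at t) \<and> \<bar>d\<bar> \<le> K * speed_D3 \<gamma> t)"
  proof (rule AE_lebesgue_Ioo[OF ae])
    fix t assume t: "a < t" "t < b" and d: "(chart_map (chart_at D3 (\<gamma> t)) \<circ> \<gamma>) differentiable (at t) \<and>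
        velocity D3 \<gamma> t \<in> Hbundle D3 (\<gamma> t)"
    have x: "\<gamma> t \<in> D3_pts" using pts t by (auto simp: image_subset_iff)
    let ?V = "velocity D3 \<gamma> t"
    have V: "(\<gamma> has_derivative (\<lambda>r. r *\<^sub>R ?V)) (at t)"
      using d unfolding velocity_D3[of \<gamma> t, OF x] by (simp add: vector_derivative_works has_vector_derivative_def)
    have "((\<lambda>t. G (\<gamma> t)) has_real_derivative D (\<gamma> t) ?V) (at t)"
      unfolding has_field_derivative_def
      by (rule has_derivative_eq_rhs[OF has_derivative_compose[OF V G(1)[OF x]]])
        (simp add: linear_cmul[OF has_derivative_linear[OF G(1)[OF x]]] mult.commute fun_eq_iff)
    moreover have "\<bar>D (\<gamma> t) ?V\<bar> \<le> K * speed_D3 \<gamma> t"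
      using G(3)[of "fst (\<gamma> t)" "snd (\<gamma> t)" "fst ?V"] levi_D3_horizontal[OF x, of ?V] d x
      by (simp add: mem_Times_iff)
    ultimately show "\<exists>d. ((\<lambda>t. G (\<gamma> t)) has_real_derivative d) (at t) \<and> \<bar>d\<bar> \<le> K * speed_D3 \<gamma> t" by blast
  qed
  from lipschitz_variation_bound[OF ab lipG this] speed_D3_integrable[OF ab \<gamma>]
  show ?thesis by simp
qed

section \<open>Horizontal connectedness of the model space\<close>

lemma C1_curve_lipschitz:
  fixes \<gamma> :: "real \<Rightarrow> 'f::real_normed_vector"
  assumes der: "\<And>t. t \<in> {a..b} \<Longrightarrow> (\<gamma> has_vector_derivative V t) (at t)" and V: "continuous_on {a..b} V"
  obtains C where "C-lipschitz_on {a..b} \<gamma>"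
proof -
  have "bounded (V ` {a..b})" by (intro compact_imp_bounded compact_continuous_image V compact_Icc)
  then obtain B where B: "B > 0" "\<And>t. t \<in> {a..b} \<Longrightarrow> norm (V t) \<le> B"
    unfolding bounded_pos by blast
  have "B-lipschitz_on {a..b} \<gamma>"
  proof (rule bounded_derivative_imp_lipschitz)
    show "(\<gamma> has_derivative (\<lambda>r. r *\<^sub>R V t)) (at t within {a..b})" if "t \<in> {a..b}" for t
      using has_vector_derivative_at_within[OF der[OF that]] unfolding has_vector_derivative_def .
    show "onorm (\<lambda>r. r *\<^sub>R V t) \<le> B" if "t \<in> {a..b}" for t
      by (rule onorm_le) (use mult_right_mono[OF B(2)[OF that]] in \<open>simp add: mult.commute[of "\<bar>_\<bar>"]\<close>)
  qed (use B in auto)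
  then show thesis by (rule that)
qed

lemma horizontal_curve_D3I:
  assumes der: "\<And>t. t \<in> {a..b} \<Longrightarrow> (\<gamma> has_vector_derivative hlift (fst (\<gamma> t)) (w t)) (at t)"
    and pts: "\<And>t. t \<in> {a..b} \<Longrightarrow> \<gamma> t \<in> D3_pts"
    and cont: "continuous_on {a..b} (\<lambda>t. hlift (fst (\<gamma> t)) (w t))"
  shows "horizontal_curve D3 a b \<gamma>"
proof -
  obtain C where C: "C-lipschitz_on {a..b} \<gamma>" using C1_curve_lipschitz[OF der cont] .
  have cm: "continuous_map (top_of_set {a..b}) (mtop D3) \<gamma>"
    using lipschitz_on_continuous_on[OF C] pts by (auto simp: D3_def continuous_map_in_subtopology)
  have "lipschitz_curve D3 a b \<gamma>"
    unfolding lipschitz_curve_def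
  proof (intro conjI cm ballI)
    fix t assume "t \<in> {a..b}"
    have "\<gamma> ` (UNIV \<inter> {a..b}) \<subseteq> D3_pts" using pts by blast
    then show "\<exists>I C. \<exists>c\<in>atlas D3. open I \<and> t \<in> I \<and> \<gamma> ` (I \<inter> {a..b}) \<subseteq> chart_dom c \<and>
        C-lipschitz_on (I \<inter> {a..b}) (chart_map c \<circ> \<gamma>)"
      using C by (intro exI[of _ UNIV] exI[of _ C] bexI[of _ "(D3_pts, \<lambda>x. x)"]) (auto simp: D3_def o_def)
  qed
  moreover have "(chart_map (chart_at D3 (\<gamma> t)) \<circ> \<gamma>) differentiable (at t) \<and> velocity D3 \<gamma> t \<in> Hbundle D3 (\<gamma> t)"
    if t: "t \<in> {a..b}" for t
  proof -
    have "velocity D3 \<gamma> t = hlift (fst (\<gamma> t)) (w t)"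
      unfolding velocity_D3(1)[of \<gamma> t, OF pts[OF t]] by (rule vector_derivative_at[OF der[OF t]])
    moreover have "hlift (fst (\<gamma> t)) (w t) \<in> Hbundle D3 (\<gamma> t)"
      using hlift_in_Hbundle[of "fst (\<gamma> t)" "w t" "snd (\<gamma> t)"] by simp
    ultimately show ?thesis
      unfolding velocity_D3(2)[of \<gamma> t, OF pts[OF t]] using der[OF t] differentiableI_vector by auto
  qed
  ultimately show ?thesis unfolding horizontal_curve_def by simp
qed

text \<open>The Carnot-Caratheodory distance is an infimum of lengths, so it needs at least one curve.  Go
  from \<open>z0\<close> radially to the centre, then along a loop at the centre, then radially to \<open>z1\<close>.
  The radial parts lift without changing the height, and the loop turns with an angular velocity
  \<open>\<omega>\<close> that produces the required change of height, which is proportional to \<open>\<omega>\<close>.  The squares of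
  positive parts make the whole curve \<open>C\<^sup>1\<close>.\<close>

lemma D3_horizontally_connected:
  assumes "x0 \<in> D3_pts" "x1 \<in> D3_pts"
  obtains a b \<gamma> where "a \<le> b" "\<gamma> a = x0" "\<gamma> b = x1" "horizontal_curve D3 a b \<gamma>"
proof -
  obtain z0 t0 where x0: "x0 = (z0, t0)" "cmod z0 < 1" using assms(1) by (cases x0) simp
  obtain z1 t1 where x1: "x1 = (z1, t1)" "cmod z1 < 1" using assms(2) by (cases x1) simp
  define p :: "real \<Rightarrow> real" where "p s = (max 0 s)\<^sup>2" for s
  define A A' where "A s = p (1 - s)" and "A' s = - (2 * max 0 (1 - s))" for s
  define B B' where "B s = p (s - 2)" and "B' s = 2 * max 0 (s - 2)" for s
  define c c' where "c s = p (s - 1) * p (2 - s)"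
    and "c' s = 2 * max 0 (s - 1) * p (2 - s) - p (s - 1) * (2 * max 0 (2 - s))" for s
  define k where "k s = (c s)\<^sup>2 / (1 - (c s)\<^sup>2 / 4)" for s
  have dp: "(p has_real_derivative 2 * max 0 s) (at s)" for s
    unfolding p_def[abs_def] by (rule positive_part_square_derivative)
  have dp1: "((\<lambda>s. p (s - r)) has_real_derivative 2 * max 0 (s - r)) (at s)" for r s
  proof -
    have "((\<lambda>s. s - r) has_real_derivative 1) (at s)" by (auto intro!: derivative_eq_intros)
    from DERIV_chain2[OF dp this] show ?thesis by simp
  qed
  have dp2: "((\<lambda>s. p (r - s)) has_real_derivative - (2 * max 0 (r - s))) (at s)" for r s
  proof -
    have "((\<lambda>s. r - s) has_real_derivative -1) (at s)" by (auto intro!: derivative_eq_intros)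
    from DERIV_chain2[OF dp this] show ?thesis by simp
  qed
  have dA: "(A has_real_derivative A' s) (at s)" and dB: "(B has_real_derivative B' s) (at s)" for s
    unfolding A_def[abs_def] B_def[abs_def] A'_def B'_def by (rule dp2, rule dp1)
  have dc: "(c has_real_derivative c' s) (at s)" for s
    unfolding c_def[abs_def] c'_def
    by (rule DERIV_cong[OF DERIV_mult[OF dp1 dp2]]) (simp add: algebra_simps)
  have cp: "continuous_on S p" for S unfolding p_def[abs_def] by (intro continuous_intros)
  have cA: "continuous_on S A" and cA': "continuous_on S A'" and cB: "continuous_on S B"
    and cB': "continuous_on S B'" and cc: "continuous_on S c" and cc': "continuous_on S c'" for S
    unfolding A_def[abs_def] B_def[abs_def] c_def[abs_def] A'_def[abs_def] B'_def[abs_def] c'_def[abs_def]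
    by (intro continuous_intros continuous_on_compose2[OF cp[of UNIV]]; simp)+
  have left: "c s = 0" "c' s = 0" "B s = 0" "B' s = 0" if "s \<le> 1" for s
    using that by (simp_all add: c_def c'_def B_def B'_def p_def)
  have mid: "A s = 0" "A' s = 0" "B s = 0" "B' s = 0" if "1 \<le> s" "s \<le> 2" for s
    using that by (simp_all add: A_def A'_def B_def B'_def p_def)
  have right: "c s = 0" "c' s = 0" "A s = 0" "A' s = 0" if "2 \<le> s" for s
    using that by (simp_all add: c_def c'_def A_def A'_def p_def)
  have p1: "0 \<le> p s" "s \<le> 1 \<Longrightarrow> p s \<le> 1" for s by (simp_all add: p_def power_le_one_iff)
  have c1: "0 \<le> c s" "c s \<le> 1" for s
  proof -
    show "0 \<le> c s" by (simp add: c_def p1)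
    show "c s \<le> 1"
    proof (cases "1 \<le> s \<and> s \<le> 2")
      case True
      then show ?thesis unfolding c_def by (intro mult_le_one p1) auto
    next
      case False
      then show ?thesis using left(1)[of s] right(1)[of s] by linarith
    qed
  qed
  have cpos: "1 - (c s)\<^sup>2 / 4 > 0" for s
    using power_mono[OF c1(2) c1(1), of s 2] by simp
  have ck: "continuous_on S k" for S
  proof -
    have "1 - (c s)\<^sup>2 / 4 \<noteq> 0" for s using cpos[of s] by linarith
    then show ?thesis unfolding k_def[abs_def]
      by (intro continuous_on_divide continuous_on_diff continuous_on_const continuous_on_power cc ballI) simp_all
  qed
  obtain T where T0: "\<And>s. s \<in> {-1..4} \<Longrightarrow> (T has_vector_derivative k s) (at s within {-1..4})"
    using antiderivative_continuous[OF ck] by blast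
  have T: "(T has_real_derivative k s) (at s)" if "s \<in> {0..3}" for s
    using T0[of s] that at_within_Icc_at[of "-1" s 4] by (simp add: has_real_derivative_iff_has_vector_derivative)
  have k0: "k s \<ge> 0" for s using cpos[of s] by (simp add: k_def)
  have kpos: "k s > 0" if "1 < s" "s < 2" for s
  proof -
    have "c s > 0" using that by (simp add: c_def p_def)
    then show ?thesis using cpos[of s] by (simp add: k_def)
  qed
  have "T 0 \<le> T 1"
    by (rule DERIV_nonneg_imp_nondecreasing[of 0 1 T]) (auto intro!: exI[of _ "k _"] T k0)
  also have "T 1 < T 2"
  proof (rule DERIV_pos_imp_increasing_open[of 1 2 T])
    show "\<exists>y. (T has_real_derivative y) (at s) \<and> 0 < y" if "1 < s" "s < 2" for s
      using T[of s] kpos[OF that] that by (intro exI[of _ "k s"]) simp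
    show "continuous_on {1..2} T"
      by (intro continuous_at_imp_continuous_on ballI DERIV_isCont[OF T]) auto
  qed simp
  also have "T 2 \<le> T 3"
    by (rule DERIV_nonneg_imp_nondecreasing[of 2 3 T]) (auto intro!: exI[of _ "k _"] T k0)
  finally have J: "T 3 - T 0 > 0" by simp
  define \<omega> where "\<omega> = - ((t1 - t0) / (T 3 - T 0))"
  define z where "z s = A s *\<^sub>R z0 + B s *\<^sub>R z1 + (c s / 2) *\<^sub>R cis (\<omega> * s)" for s
  define z' where "z' s = A' s *\<^sub>R z0 + B' s *\<^sub>R z1 + ((c' s / 2) *\<^sub>R cis (\<omega> * s) + (c s / 2) *\<^sub>R (\<omega> *\<^sub>R (\<i> * cis (\<omega> * s))))" for s
  define \<gamma> where "\<gamma> s = (z s, t0 - \<omega> * (T s - T 0))" for s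
  have dcis: "((\<lambda>s. cis (\<omega> * s)) has_vector_derivative \<omega> *\<^sub>R (\<i> * cis (\<omega> * s))) (at s)" for s
    unfolding has_vector_derivative_def by (auto intro!: derivative_eq_intros simp: fun_eq_iff)
  have dz: "(z has_vector_derivative z' s) (at s)" for s
  proof -
    have "((\<lambda>s. A s *\<^sub>R z0) has_vector_derivative A' s *\<^sub>R z0) (at s)"
      "((\<lambda>s. B s *\<^sub>R z1) has_vector_derivative B' s *\<^sub>R z1) (at s)"
      using has_vector_derivative_scaleR[OF dA has_vector_derivative_const] has_vector_derivative_scaleR[OF dB has_vector_derivative_const]
      by simp_all
    moreover have "((\<lambda>s. (c s / 2) *\<^sub>R cis (\<omega> * s)) has_vector_derivative
        (c' s / 2) *\<^sub>R cis (\<omega> * s) + (c s / 2) *\<^sub>R (\<omega> *\<^sub>R (\<i> * cis (\<omega> * s)))) (at s)"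
      using has_vector_derivative_scaleR[OF DERIV_cdivide[OF dc] dcis] by (simp only: add.commute)
    ultimately show ?thesis unfolding z_def[abs_def] z'_def by (intro has_vector_derivative_add)
  qed
  have cz': "continuous_on S z'" for S
    unfolding z'_def[abs_def] by (intro continuous_intros cA' cB' cc cc') auto
  have lt1: "cmod (z s) < 1" and area: "alphaB (z s) (z' s) = \<omega> * k s" if s: "s \<in> {0..3}" for s
  proof -
    consider "s \<le> 1" | "1 \<le> s" "s \<le> 2" | "2 \<le> s" by linarith
    then have "cmod (z s) < 1 \<and> alphaB (z s) (z' s) = \<omega> * k s"
    proof cases
      case 1
      have "A s \<ge> 0" "A s \<le> 1" using s by (auto simp: A_def intro: p1)
      then have "A s * cmod z0 < 1" using x0(2) by (meson le_less_trans mult_left_le_one_le norm_ge_zero)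
      then show ?thesis using left[OF 1] \<open>A s \<ge> 0\<close>
        by (simp add: z_def z'_def alphaB_def k_def)
    next
      case 2
      have e: "cnj (z s) * z' s = (cnj (cis (\<omega> * s)) * cis (\<omega> * s)) * ((c s / 2) *\<^sub>R ((c' s / 2) *\<^sub>R 1 + (c s / 2) *\<^sub>R (\<omega> *\<^sub>R \<i>)))"
        using mid[OF 2] by (simp add: z_def z'_def scaleR_conv_of_real algebra_simps)
      have "cnj (cis (\<omega> * s)) * cis (\<omega> * s) = 1" by (simp add: cis_cnj cis_mult)
      then have im: "Im (cnj (z s) * z' s) = \<omega> * (c s)\<^sup>2 / 4" unfolding e by (simp add: power2_eq_square)
      have nz: "cmod (z s) = c s / 2" using mid[OF 2] c1[of s] by (simp add: z_def)
      have "alphaB (z s) (z' s) = \<omega> * k s"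
        unfolding alphaB_def im nz k_def by (simp add: power_divide)
      then show ?thesis using c1[of s] nz by simp
    next
      case 3
      have "B s \<ge> 0" "B s \<le> 1" using s by (auto simp: B_def intro: p1)
      then have "B s * cmod z1 < 1" using x1(2) by (meson le_less_trans mult_left_le_one_le norm_ge_zero)
      then show ?thesis using right[OF 3] \<open>B s \<ge> 0\<close>
        by (simp add: z_def z'_def alphaB_def k_def)
    qed
    then show "cmod (z s) < 1" "alphaB (z s) (z' s) = \<omega> * k s" by auto
  qed
  have hl: "hlift (fst (\<gamma> s)) (z' s) = (z' s, - (\<omega> * k s))" if "s \<in> {0..3}" for s
    using area[OF that] by (simp add: hlift_def \<gamma>_def)
  have "horizontal_curve D3 0 3 \<gamma>"
  proof (rule horizontal_curve_D3I[where w=z'])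
    fix s :: real assume s: "s \<in> {0..3}"
    have "((\<lambda>s. t0 - \<omega> * (T s - T 0)) has_vector_derivative - (\<omega> * k s)) (at s)"
      unfolding has_real_derivative_iff_has_vector_derivative[symmetric]
      by (auto intro!: derivative_eq_intros T[OF s])
    from has_vector_derivative_Pair[OF dz this]
    show "(\<gamma> has_vector_derivative hlift (fst (\<gamma> s)) (z' s)) (at s)" unfolding hl[OF s] unfolding \<gamma>_def[abs_def] .
    show "\<gamma> s \<in> D3_pts" using lt1[OF s] by (simp add: \<gamma>_def)
  next
    have "continuous_on {0..3} (\<lambda>s. (z' s, - (\<omega> * k s)))" by (intro continuous_intros cz' ck)
    then show "continuous_on {0..3} (\<lambda>s. hlift (fst (\<gamma> s)) (z' s))" by (rule continuous_on_eq) (simp add: hl)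
  qed
  moreover have "\<gamma> 0 = x0" "\<gamma> 3 = x1"
    using J by (simp_all add: \<gamma>_def z_def x0(1) x1(1) A_def B_def c_def p_def \<omega>_def)
  ultimately show thesis using that[of 0 3 \<gamma>] by simp
qed

lemma cc_dist_variation:
  assumes G: "\<And>x. x \<in> D3_pts \<Longrightarrow> (G has_derivative D x) (at x)" "\<And>w. continuous_on D3_pts (\<lambda>x. D x w)"
    "\<And>z t w. cmod z < 1 \<Longrightarrow> \<bar>D (z,t) (hlift z w)\<bar> \<le> K * sqrt (poincare_metric z w w)"
    and K: "K > 0" and x: "x0 \<in> D3_pts" "x1 \<in> D3_pts"
  shows "\<bar>G x1 - G x0\<bar> \<le> K * cc_dist D3 x0 x1"
proof -
  let ?S = "{LINT t:{a..b}|lebesgue. speed_D3 \<gamma> t | a b \<gamma>.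
     a \<le> b \<and> \<gamma> a = x0 \<and> \<gamma> b = x1 \<and> horizontal_curve D3 a b \<gamma>}"
  have "?S \<noteq> {}" using D3_horizontally_connected[OF x] by (smt (verit, best) empty_Collect_eq)
  moreover have "\<bar>G x1 - G x0\<bar> / K \<le> l" if "l \<in> ?S" for l
  proof -
    from that obtain a b \<gamma> where l: "l = (LINT t:{a..b}|lebesgue. speed_D3 \<gamma> t)" "a \<le> b" "\<gamma> a = x0" "\<gamma> b = x1"
      "horizontal_curve D3 a b \<gamma>" by blast
    from horizontal_curve_variation[OF G l(2,5)] show ?thesis
      unfolding l(1,3,4) using K by (simp add: pos_divide_le_eq mult.commute)
  qed
  ultimately have "\<bar>G x1 - G x0\<bar> / K \<le> cc_dist D3 x0 x1"
    unfolding cc_dist_def by (rule cInf_greatest)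
  then show ?thesis using K by (simp add: pos_divide_le_eq mult.commute)
qed

theorem theorem6p2:
  fixes M :: "('a, 'e::euclidean_space) ph_data"
    and D :: "('a, 'e) covariant"
    and m :: nat and \<Lambda> k :: real
  assumes "1 / sqrt 2 \<le> \<Lambda>"
    and "pseudo_hermitian m M"
    and "chain_joinable M \<Lambda>"
    and "tanaka_webster M D"
    and "k > 0"
    and "ph_curvature_le m M D (- k)"
  shows "cr_kobayashi_hyperbolic M \<Lambda>"
  unfolding cr_kobayashi_hyperbolic_def
proof (intro conjI ballI impI)
  show "chain_joinable M \<Lambda>" by fact
next
  interpret pseudo_hermitian_manifold M m by unfold_locales fact
  fix p q assume p: "p \<in> points M" and q: "q \<in> points M" and "p \<noteq> q"
  obtain \<rho> :: "'a \<Rightarrow> real" and K where \<rho>: "\<rho> p \<noteq> \<rho> q" and K: "K \<ge> 0"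
    and var: "\<And>f. cr_map D3 M f \<Longrightarrow> bounded_gen_dilatation D3 M f \<Lambda> \<Longrightarrow>
      \<exists>D. (\<forall>x\<in>D3_pts. ((\<lambda>x. \<rho> (f x)) has_derivative D x) (at x)) \<and>
        (\<forall>w. continuous_on D3_pts (\<lambda>x. D x w)) \<and>
        (\<forall>z t w. cmod z < 1 \<longrightarrow> \<bar>D (z,t) (hlift z w)\<bar> \<le> K * sqrt (poincare_metric z w w))"
    using separating_function[OF p q \<open>p \<noteq> q\<close>, of \<Lambda>] by blast
  \<comment> \<open>The constant \<open>K + 1\<close> is positive also for \<open>K = 0\<close>.\<close>
  have step: "\<bar>\<rho> (f y) - \<rho> (f x)\<bar> \<le> (K + 1) * cc_dist D3 x y"
    if f: "cr_map D3 M f" "bounded_gen_dilatation D3 M f \<Lambda>" and xy: "x \<in> D3_pts" "y \<in> D3_pts" for f x y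
  proof -
    obtain D where D: "\<And>x. x \<in> D3_pts \<Longrightarrow> ((\<lambda>x. \<rho> (f x)) has_derivative D x) (at x)"
      "\<And>w. continuous_on D3_pts (\<lambda>x. D x w)"
      "\<And>z t w. cmod z < 1 \<Longrightarrow> \<bar>D (z,t) (hlift z w)\<bar> \<le> K * sqrt (poincare_metric z w w)"
      using var[OF f] by blast
    have "\<bar>D (z,t) (hlift z w)\<bar> \<le> (K + 1) * sqrt (poincare_metric z w w)" if "cmod z < 1" for z t w
    proof -
      have "sqrt (poincare_metric z w w) \<ge> 0" by (simp add: poincare_metric_def)
      moreover have "(K + 1) * sqrt (poincare_metric z w w) = K * sqrt (poincare_metric z w w) + sqrt (poincare_metric z w w)"
        by (simp add: distrib_right)
      ultimately show ?thesis using D(3)[OF that, of t w] by linarith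
    qed
    from cc_dist_variation[OF D(1,2) this _ xy] K show ?thesis by simp
  qed
  let ?S = "{\<Sum>i=1..k. cc_dist D3 (a i) (b i) | k pt a b f. cr_K_chain M \<Lambda> p q k pt a b f}"
  have "?S \<noteq> {}"
  proof -
    obtain k pt a b f where "cr_K_chain M \<Lambda> p q k pt a b f"
      using bspec[OF bspec[OF assms(3)[unfolded chain_joinable_def] p] q] by (elim exE)
    then have "(\<Sum>i=1..k. cc_dist D3 (a i) (b i)) \<in> ?S"
      by (intro CollectI exI conjI) (rule refl)
    then show ?thesis by (metis empty_iff)
  qed
  moreover have "\<bar>\<rho> q - \<rho> p\<bar> / (K + 1) \<le> l" if l_in: "l \<in> ?S" for l
  proof -
    obtain k pt a b f where l: "l = (\<Sum>i=1..k. cc_dist D3 (a i) (b i))" and ch: "cr_K_chain M \<Lambda> p q k pt a b f"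
      using l_in by (elim CollectE exE conjE)
    have ends: "pt 0 = p" "pt k = q" using ch by (auto simp: cr_K_chain_def)
    have link: "\<bar>\<rho> (pt i) - \<rho> (pt (i - 1))\<bar> \<le> (K + 1) * cc_dist D3 (a i) (b i)" if "i \<in> {1..k}" for i
    proof -
      have "a i \<in> D3_pts" "b i \<in> D3_pts" "cr_map D3 M (f i)" "bounded_gen_dilatation D3 M (f i) \<Lambda>"
        "f i (a i) = pt (i - 1)" "f i (b i) = pt i"
        using ch that by (simp_all add: cr_K_chain_def del: mem_Times_iff)
      with step[of "f i" "a i" "b i"] show ?thesis by simp
    qed
    have "\<rho> q - \<rho> p = (\<Sum>i=1..k. \<rho> (pt i) - \<rho> (pt (i - 1)))"
      using sum_telescope''[of 0 k "\<lambda>i. \<rho> (pt i)"] ends by simp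
    also have "\<bar>\<dots>\<bar> \<le> (\<Sum>i=1..k. (K + 1) * cc_dist D3 (a i) (b i))"
      by (rule order_trans[OF sum_abs sum_mono[OF link]])
    also have "\<dots> = (K + 1) * l" by (simp add: l sum_distrib_left)
    finally show ?thesis using K by (simp add: pos_divide_le_eq mult.commute)
  qed
  ultimately have "\<bar>\<rho> q - \<rho> p\<bar> / (K + 1) \<le> cr_kobayashi_dist M \<Lambda> p q"
    unfolding cr_kobayashi_dist_def by (rule cInf_greatest)
  moreover have "0 < \<bar>\<rho> q - \<rho> p\<bar> / (K + 1)" using \<rho> K by simp
  ultimately show "0 < cr_kobayashi_dist M \<Lambda> p q" by linarith
qed

end
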